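(* Let $G\in\{\mathrm{GSp}_{2n},\mathrm{Sp}_{2n}\}$ over $\mathbb F_q$. Fix a character $\chi\colon P\to\mathbb C^\times$, written as $\chi=(\alpha\circ m)(\beta\circ\chi_{\det})$ with characters $\alpha,\beta\colon\mathbb F_q^\times\to\mathbb C^\times$. Assume that $\beta=1$ (so that $\chi=\chi^J$). (a) If $n=2m$ is even, then the intertwining operator $I$ on $\operatorname{Ind}_P^G\chi$ is diagonalizable and has eigenvalues given by $$\left\{\pm q^{m^2+i(i+1)}:0\le i\le m-1\right\}\sqcup\left\{q^{\binom{2m+1}2}\right\}.$$ (b) If $n=2m+1$ is odd, then the intertwining operator $I$ on $\operatorname{Ind}_P^G\chi$ is diagonalizable and has eigenvalue multiset given by $$\left\{-(-1)^{m-\lfloor i/2\rfloor}q^{m(m+1)+\lfloor i/2\rfloor^2}:1\le i\le n+1\right\},$$ where multiplicities are those of the restriction of $I$ to the subspace $(\operatorname{Ind}_P^G\chi)^\chi$, and the set of eigenvalues of $I$ on all of $\operatorname{Ind}_P^G\chi$ is the underlying set of this multiset.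
   Context: $q$ is an odd prime power with $3\nmid q$, and $n\ge1$. $J=\begin{bmatrix}0&-1_n\\1_n&0\end{bmatrix}$. $\mathrm{GSp}_{2n}$ consists of $g\in\mathrm{GL}_{2n}(\mathbb F_q)$ with $g^\intercal Jg=\lambda J$ for some $\lambda\in\mathbb F_q^\times$; $\mathrm{Sp}_{2n}$ is the subgroup with $\lambda=1$. $P=\left\{\begin{bmatrix}A&B\\0&D\end{bmatrix}\in G\right\}$ with $n\times n$ blocks, and $U=\left\{\begin{bmatrix}1_n&B\\0&1_n\end{bmatrix}\in G\right\}$. $\chi_{\det}\colon P\to\mathbb F_q^\times$ is $\begin{bmatrix}A&B\\0&D\end{bmatrix}\mapsto(\det D)^{-1}$. $m\colon P\to\mathbb F_q^\times$ is $\begin{bmatrix}\lambda A&B\\0&A^{-\intercal}\end{bmatrix}\mapsto\lambda$ (trivial for $\mathrm{Sp}_{2n}$). (Every character of $P$ has the form $(\alpha\circ m)(\beta\circ\chi_{\det})$; the map $m$ should not be confused with the integer $m$ in (a), (b).) The character $\chi^J$ is $\chi^J\left(\begin{bmatrix}A&B\\0&D\end{bmatrix}\right)=\chi\left(\begin{bmatrix}D&0\\0&A\end{bmatrix}\right)$. $\operatorname{Ind}_P^G\chi$ is the space of functions $f\colon G\to\mathbb C$ with $f(pg)=\chi(p)f(g)$ for $p\in P$, $g\in G$, with $G$ acting by right translation; $(\operatorname{Ind}_P^G\chi)^\chi$ is the subspace of $f$ with $f(gp)=\chi(p)f(g)$ for all $p\in P$, $g\in G$. The operator $I\colon\operatorname{Ind}_P^G\chi\to\operatorname{Ind}_P^G\chi^J$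 is $(If)(g)=\sum_{u\in U}f(J^{-1}ug)$; it is $G$-equivariant. *)

theory Defs
  imports
    Complex_Main
    "HOL-Library.Cardinality"
    "HOL-Library.Multiset"
    "HOL-Library.Function_Algebras"
    "Jordan_Normal_Form.Determinant"
begin

definition fscale :: "complex \<Rightarrow> ('g \<Rightarrow> complex) \<Rightarrow> ('g \<Rightarrow> complex)" where
  "fscale c f = (\<lambda>x. c * f x)"

global_interpretation fn: vector_space "fscale :: complex \<Rightarrow> ('g \<Rightarrow> complex) \<Rightarrow> _"
  by unfold_locales (auto simp: fscale_def fun_eq_iff algebra_simps)

definition diagonalizable_on ::
  "('g \<Rightarrow> complex) set \<Rightarrow> (('g \<Rightarrow> complex) \<Rightarrow> ('g \<Rightarrow> complex)) \<Rightarrow> bool" where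
  "diagonalizable_on V T \<longleftrightarrow> T ` V \<subseteq> V \<and>
     (\<exists>B. fn.independent B \<and> fn.span B = V \<and> (\<forall>f\<in>B. \<exists>\<mu>. T f = fscale \<mu> f))"

definition eigenvalues_on ::
  "('g \<Rightarrow> complex) set \<Rightarrow> (('g \<Rightarrow> complex) \<Rightarrow> ('g \<Rightarrow> complex)) \<Rightarrow> complex set" where
  "eigenvalues_on V T = {\<mu>. \<exists>f\<in>V. f \<noteq> 0 \<and> T f = fscale \<mu> f}"

text \<open>Algebraic multiplicity: the dimension of the generalized eigenspace
  (meaningful for finite-dimensional \<open>V\<close>).\<close>

definition eigenvalue_mult ::
  "('g \<Rightarrow> complex) set \<Rightarrow> (('g \<Rightarrow> complex) \<Rightarrow> ('g \<Rightarrow> complex)) \<Rightarrow> complex \<Rightarrow> nat" where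
  "eigenvalue_mult V T \<mu> =
     fn.dim {f \<in> V. \<exists>k. ((\<lambda>h. T h - fscale \<mu> h) ^^ k) f = 0}"

definition has_eigenvalue_mset ::
  "('g \<Rightarrow> complex) set \<Rightarrow> (('g \<Rightarrow> complex) \<Rightarrow> ('g \<Rightarrow> complex)) \<Rightarrow> complex multiset \<Rightarrow> bool" where
  "has_eigenvalue_mset V T M \<longleftrightarrow>
     T ` V \<subseteq> V \<and> (\<forall>\<mu>. count M \<mu> = eigenvalue_mult V T \<mu>)"

definition Jmat :: "nat \<Rightarrow> 'a::field mat" where
  "Jmat n = four_block_mat (0\<^sub>m n n) (- 1\<^sub>m n) (1\<^sub>m n) (0\<^sub>m n n)"

definition Jinv :: "nat \<Rightarrow> 'a::field mat" where
  "Jinv n = four_block_mat (0\<^sub>m n n) (1\<^sub>m n) (- 1\<^sub>m n) (0\<^sub>m n n)"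

lemma Jinv_is_inverse:
  "Jmat n * Jinv n = (1\<^sub>m (n + n) :: 'a::field mat)"
  "Jinv n * Jmat n = (1\<^sub>m (n + n) :: 'a::field mat)"
proof -
  have z: "- 0\<^sub>m n n = (0\<^sub>m n n :: 'a mat)" and o: "four_block_mat (1\<^sub>m n) (0\<^sub>m n n) (0\<^sub>m n n) (1\<^sub>m n) = (1\<^sub>m (n + n) :: 'a mat)"
    by (auto intro!: eq_matI)
  show "Jmat n * Jinv n = (1\<^sub>m (n + n) :: 'a mat)"
    unfolding Jmat_def Jinv_def
    by (subst mult_four_block_mat[of _ n n _ n _ n _ _ n _ n]) (simp_all add: z o)
  show "Jinv n * Jmat n = (1\<^sub>m (n + n) :: 'a mat)"
    unfolding Jmat_def Jinv_def
    by (subst mult_four_block_mat[of _ n n _ n _ n _ _ n _ n]) (simp_all add: z o)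
qed

definition GSp :: "nat \<Rightarrow> 'a::field mat set" where
  "GSp n = {g \<in> carrier_mat (2 * n) (2 * n). invertible_mat g \<and>
     (\<exists>l. l \<noteq> 0 \<and> transpose_mat g * Jmat n * g = l \<cdot>\<^sub>m Jmat n)}"

definition Sp :: "nat \<Rightarrow> 'a::field mat set" where
  "Sp n = {g \<in> carrier_mat (2 * n) (2 * n). invertible_mat g \<and>
     transpose_mat g * Jmat n * g = Jmat n}"

definition siegel_P :: "nat \<Rightarrow> 'a::field mat set \<Rightarrow> 'a mat set" where
  "siegel_P n G = {p \<in> G. \<exists>A\<in>carrier_mat n n. \<exists>B\<in>carrier_mat n n. \<exists>D\<in>carrier_mat n n.
     p = four_block_mat A B (0\<^sub>m n n) D}"

definition siegel_U :: "nat \<Rightarrow> 'a::field mat set \<Rightarrow> 'a mat set" where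
  "siegel_U n G = {u \<in> G. \<exists>B\<in>carrier_mat n n.
     u = four_block_mat (1\<^sub>m n) B (0\<^sub>m n n) (1\<^sub>m n)}"

definition lin_character :: "'h::times set \<Rightarrow> ('h \<Rightarrow> complex) \<Rightarrow> bool" where
  "lin_character H \<chi> \<longleftrightarrow>
     (\<forall>x\<in>H. \<chi> x \<noteq> 0) \<and> (\<forall>x\<in>H. \<forall>y\<in>H. \<chi> (x * y) = \<chi> x * \<chi> y)"

definition chi_det :: "nat \<Rightarrow> 'a::field mat \<Rightarrow> 'a" where
  "chi_det n p = (case split_block p n n of (A, B, C, D) \<Rightarrow> inverse (det D))"

definition siegel_m :: "nat \<Rightarrow> 'a::field mat \<Rightarrow> 'a" where
  "siegel_m n p = (case split_block p n n of (A', B, C, D) \<Rightarrow>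
     (THE l. \<exists>A\<in>carrier_mat n n. A' = l \<cdot>\<^sub>m A \<and> D * transpose_mat A = 1\<^sub>m n))"

definition chi_J :: "nat \<Rightarrow> ('a::field mat \<Rightarrow> complex) \<Rightarrow> 'a mat \<Rightarrow> complex" where
  "chi_J n \<chi> p = (case split_block p n n of (A, B, C, D) \<Rightarrow>
     \<chi> (four_block_mat D (0\<^sub>m n n) (0\<^sub>m n n) A))"

lemma siegel_m_eq:
  fixes A :: "'a::field mat"
  assumes n: "n \<ge> 1" and A: "A \<in> carrier_mat n n" and B: "B \<in> carrier_mat n n"
    and D: "D \<in> carrier_mat n n" and inv: "D * transpose_mat A = 1\<^sub>m n"
  shows "siegel_m n (four_block_mat (l \<cdot>\<^sub>m A) B (0\<^sub>m n n) D) = l"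
proof -
  have sb: "split_block (four_block_mat (l \<cdot>\<^sub>m A) B (0\<^sub>m n n) D) n n
      = (l \<cdot>\<^sub>m A, B, 0\<^sub>m n n, D)"
    using A B D by (auto simp: split_block_def Let_def)
  have "k = l"
    if A': "A' \<in> carrier_mat n n" and eq: "l \<cdot>\<^sub>m A = k \<cdot>\<^sub>m A'"
      and inv': "D * transpose_mat A' = 1\<^sub>m n" for k A'
  proof -
    have tr: "transpose_mat (c \<cdot>\<^sub>m X) = c \<cdot>\<^sub>m transpose_mat X" for c and X :: "'a mat"
      by (rule eq_matI) auto
    have "k \<cdot>\<^sub>m 1\<^sub>m n = D * transpose_mat (k \<cdot>\<^sub>m A')"
      unfolding tr using D A' inv' by (simp add: mult_smult_distrib[of D n n])
    also have "\<dots> = l \<cdot>\<^sub>m 1\<^sub>m n"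
      unfolding eq[symmetric] tr using D A inv by (simp add: mult_smult_distrib[of D n n])
    finally have "(k \<cdot>\<^sub>m 1\<^sub>m n) $$ (0,0) = (l \<cdot>\<^sub>m 1\<^sub>m n) $$ (0,0)" by simp
    then show ?thesis using n by simp
  qed
  then show ?thesis
    unfolding siegel_m_def sb using A inv by auto
qed

text \<open>Functions on \<open>G\<close> are represented by functions on all matrices that vanish outside
  \<open>G\<close>.\<close>

definition Ind :: "nat \<Rightarrow> 'a::field mat set \<Rightarrow> ('a mat \<Rightarrow> complex) \<Rightarrow> ('a mat \<Rightarrow> complex) set" where
  "Ind n G \<chi> = {f. (\<forall>g. g \<notin> G \<longrightarrow> f g = 0) \<and>
     (\<forall>p\<in>siegel_P n G. \<forall>g\<in>G. f (p * g) = \<chi> p * f g)}"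

definition Ind_equivariant ::
  "nat \<Rightarrow> 'a::field mat set \<Rightarrow> ('a mat \<Rightarrow> complex) \<Rightarrow> ('a mat \<Rightarrow> complex) set" where
  "Ind_equivariant n G \<chi> =
     {f \<in> Ind n G \<chi>. \<forall>p\<in>siegel_P n G. \<forall>g\<in>G. f (g * p) = \<chi> p * f g}"

definition intertwiner ::
  "nat \<Rightarrow> 'a::field mat set \<Rightarrow> ('a mat \<Rightarrow> complex) \<Rightarrow> ('a mat \<Rightarrow> complex)" where
  "intertwiner n G f =
     (\<lambda>g. if g \<in> G then (\<Sum>u\<in>siegel_U n G. f (Jinv n * u * g)) else 0)"

end

theory Submission
  imports Defs
begin

text \<open>The first block \<open>C\<close> of the lower rows of \<open>g\<close> records how the Lagrangian row space of
\<open>(C D)\<close> meets the base point \<open>L\<^sub>0\<close> of the Lagrangian Grassmannian \<open>P\G\<close>: the left kernel of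
\<open>C\<close> is \<open>L\<^sub>0 \<inter> L\<^sub>0 g\<close>. Since \<open>\<beta> = 1\<close>, the character \<open>\<chi>\<close> is the restriction to \<open>P\<close> of
\<open>\<alpha>\<close> composed with the similitude factor; dividing by that function on \<open>G\<close> identifies
\<open>Ind \<chi>\<close> with the functions on Lagrangians, and the intertwiner with the opposition operator
"sum over all Lagrangians transversal to the given one". Its eigenvalues are
\<open>\<lambda>\<^sub>j = (-1)^j q^((j choose 2) + ((n+1-j) choose 2))\<close> for \<open>0 \<le> j \<le> n\<close>, and the stated lists
are these numbers, with \<open>j\<close> and \<open>n + 1 - j\<close> paired.

The space of \<open>P\<close>-biequivariant functions is computed completely. By the double coset decomposition
(\<open>double_coset\<close>) such a function is, up to the twist by \<open>\<alpha>\<close>, a polynomial of degree at most \<open>n\<close>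
in \<open>z\<close>, the number of vectors in \<open>L\<^sub>0 \<inter> L\<^sub>0 g\<close>, which takes the values \<open>q^0, ..., q^n\<close>. In the
Newton basis \<open>N\<^sub>j(z) = (z - 1)(z - q)...(z - q^(j-1))\<close>, the intertwiner sends \<open>N\<^sub>j\<close> to the
polynomial \<open>q^(((n+1) choose 2) + (j choose 2)) (1 - z/q^n)...(1 - q^(j-1) z/q^n)\<close>
(\<open>T_basis_fun\<close>). This rests on one counting identity, the sum of \<open>N\<^sub>j(card (ker S))\<close> over symmetric
\<open>r \<times> r\<close> matrices \<open>S\<close> (\<open>sum_sym_mats_newton_poly\<close>), which follows by induction because the symmetric
forms that kill a given nonzero vector are the symmetric forms on a space of one dimension less.
Comparing leading coefficients, the operator is triangular with diagonal entries \<open>\<lambda>\<^sub>j\<close>.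

When \<open>n\<close> is odd the diagonal entries repeat, so triangularity alone does not give
diagonalizability. But the operator is symmetric for the \<open>L\<^sup>2\<close> inner product on \<open>G\<close>
(\<open>T_symmetric\<close>), and Gram-Schmidt applied to a triangular basis of a symmetric operator
produces orthogonal eigenvectors with the same diagonal entries (\<open>triangular_eigenbasis\<close>). This gives the
multiplicities on the biequivariant functions (\<open>eigenbasis_multiplicity\<close>).

Finally the intertwiner commutes with right translations, and \<open>Ind \<chi>\<close> is spanned by the translates
of the biequivariant function supported on \<open>P\<close>. Hence \<open>Ind \<chi>\<close> is spanned by translates of
the biequivariant eigenvectors (\<open>span_translates\<close>), so the operator is diagonalizable there with the same
set of eigenvalues.
\<close>

section \<open>Symmetric operators with a triangular basis\<close>

text \<open>The \<open>L\<^sup>2\<close> inner product over \<open>G\<close>, conjugate-linear in the second argument. It is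
definite only on functions that vanish outside \<open>G\<close>.\<close>

definition cip :: "'g set \<Rightarrow> ('g \<Rightarrow> complex) \<Rightarrow> ('g \<Rightarrow> complex) \<Rightarrow> complex" where
  "cip G f h = (\<Sum>x\<in>G. f x * cnj (h x))"

lemma cip_simps:
  "cip G (f + f') h = cip G f h + cip G f' h"
  "cip G (f - f') h = cip G f h - cip G f' h"
  "cip G (fscale c f) h = c * cip G f h"
  "cip G f (h + h') = cip G f h + cip G f h'"
  "cip G f (h - h') = cip G f h - cip G f h'"
  "cip G f (fscale c h) = cnj c * cip G f h"
  "cip G 0 h = 0" "cip G f 0 = 0"
  by (simp_all add: cip_def fscale_def sum.distrib sum_subtractf sum_distrib_left algebra_simps)

lemma cip_commute: "cip G h f = cnj (cip G f h)"
  by (simp add: cip_def mult.commute)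

lemma cip_self_eq_0:
  assumes "finite G" "cip G f f = 0" "x \<in> G"
  shows "f x = 0"
proof -
  have "cip G f f = of_real (\<Sum>x\<in>G. (cmod (f x))\<^sup>2)"
    by (simp add: cip_def complex_norm_square[symmetric])
  with assms(2) have "(\<Sum>x\<in>G. (cmod (f x))\<^sup>2) = 0"
    by (metis of_real_eq_0_iff)
  with assms(1,3) show ?thesis
    by (simp add: sum_nonneg_eq_0_iff)
qed

lemma cip_span_right:
  assumes "h \<in> fn.span B" "\<And>b. b \<in> B \<Longrightarrow> cip G f b = 0"
  shows "cip G f h = 0"
proof -
  have "fn.span B \<subseteq> {h. cip G f h = 0}"
    by (intro fn.span_minimal) (auto simp: assms(2) cip_simps fn.subspace_def)
  with assms(1) show ?thesis by blast
qed

text \<open>One Gram-Schmidt step per element of \<open>B\<close>: after splitting off the part of the new vector that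
lies in the span so far, only its orthogonal remainder has to be removed from \<open>f\<close>.\<close>

lemma ex_orthogonal_projection:
  assumes G: "finite G" and B: "finite B"
  shows "\<exists>p\<in>fn.span B. \<forall>b\<in>B. cip G (f - p) b = 0"
  using B
proof (induction B arbitrary: f)
  case empty
  then show ?case by (auto intro: fn.span_zero)
next
  case (insert b B)
  obtain p where p: "p \<in> fn.span B" "\<forall>x\<in>B. cip G (f - p) x = 0"
    using insert.IH by blast
  obtain r where r: "r \<in> fn.span B" "\<forall>x\<in>B. cip G (b - r) x = 0"
    using insert.IH by blast
  define c where "c = cip G (f - p) (b - r) / cip G (b - r) (b - r)"
  let ?p = "p + fscale c (b - r)"
  have sub: "fn.span B \<subseteq> fn.span (insert b B)"
    by (intro fn.span_mono) auto
  have mem: "?p \<in> fn.span (insert b B)"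
    using p(1) r(1) sub fn.span_base[of b "insert b B"]
    by (intro fn.span_add fn.span_scale fn.span_diff) auto
  have B0: "cip G (f - ?p) x = 0" if "x \<in> B" for x
    using p(2) r(2) that by (simp add: cip_simps)
  have r0: "cip G (f - ?p) r = 0"
    using cip_span_right[OF r(1)] B0 by blast
  have br0: "cip G (f - ?p) (b - r) = 0"
  proof (cases "cip G (b - r) (b - r) = 0")
    case True
    have "(b - r) x = 0" if "x \<in> G" for x
      using cip_self_eq_0[OF G True that] .
    then show ?thesis
      unfolding cip_def by (intro sum.neutral) auto
  next
    case False
    have "cip G (f - ?p) (b - r) = cip G (f - p) (b - r) - c * cip G (b - r) (b - r)"
      by (simp add: cip_simps algebra_simps)
    also have "\<dots> = 0" using False by (simp add: c_def)
    finally show ?thesis .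
  qed
  have "cip G (f - ?p) b = cip G (f - ?p) (b - r) + cip G (f - ?p) r"
    by (simp add: cip_simps)
  then have "cip G (f - ?p) b = 0" using br0 r0 by simp
  with mem B0 show ?case by blast
qed

text \<open>Linearity of \<open>T\<close> is required for all functions and not only on \<open>V\<close>; this holds for operators
given by a formula and spares membership side conditions.\<close>

locale symmetric_operator =
  fixes G :: "'g set" and V :: "('g \<Rightarrow> complex) set"
    and T :: "('g \<Rightarrow> complex) \<Rightarrow> 'g \<Rightarrow> complex"
  assumes finite_G: "finite G"
    and subspace_V: "fn.subspace V"
    and support: "f \<in> V \<Longrightarrow> x \<notin> G \<Longrightarrow> f x = 0"
    and T_add: "T (f + h) = T f + T h"
    and T_scale: "T (fscale c f) = fscale c (T f)"
    and T_mem: "f \<in> V \<Longrightarrow> T f \<in> V"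
    and T_sym: "f \<in> V \<Longrightarrow> h \<in> V \<Longrightarrow> cip G (T f) h = cip G f (T h)"
begin

lemma T_diff: "T (f - h) = T f - T h"
proof -
  have eq: "g - h = g + fscale (-1) h" for g h :: "'g \<Rightarrow> complex"
    by (simp add: fun_eq_iff fscale_def)
  show ?thesis
    unfolding eq T_add T_scale ..
qed

lemma T_zero: "T 0 = 0"
  using T_diff[of 0 0] by simp

lemma cip_definite: "f \<in> V \<Longrightarrow> cip G f f = 0 \<Longrightarrow> f = 0"
  using cip_self_eq_0[OF finite_G, of f] support[of f] by (fastforce simp: fun_eq_iff)

lemma cip_eigenvector:
  assumes "f \<in> V" "v \<in> V" "T v = fscale (of_real l) v"
  shows "cip G (T f - fscale \<mu> f) v = (of_real l - \<mu>) * cip G f v"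
  using T_sym[OF assms(1,2)] assms(3) by (simp add: cip_simps algebra_simps)

text \<open>Pairing with an eigenvector turns powers of \<open>T - \<mu>\<close> into powers of a number. So a generalized
eigenvector for \<open>\<mu>\<close> is orthogonal to every eigenvector with another eigenvalue.\<close>

lemma cip_eigenvector_pow:
  assumes "f \<in> V" "v \<in> V" "T v = fscale (of_real l) v"
  shows "((\<lambda>h. T h - fscale \<mu> h) ^^ k) f \<in> V \<and>
    cip G (((\<lambda>h. T h - fscale \<mu> h) ^^ k) f) v = (of_real l - \<mu>) ^ k * cip G f v"
proof -
  define S where "S = (\<lambda>h. T h - fscale \<mu> h)"
  have SV: "S h \<in> V" if "h \<in> V" for h
    unfolding S_def using that T_mem subspace_V by (intro fn.subspace_diff fn.subspace_scale)
  have S: "cip G (S h) v = (of_real l - \<mu>) * cip G h v" if "h \<in> V" for h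
    unfolding S_def using cip_eigenvector[OF that assms(2,3)] .
  have "(S ^^ k) f \<in> V \<and> cip G ((S ^^ k) f) v = (of_real l - \<mu>) ^ k * cip G f v"
    by (induction k) (simp_all add: SV S assms(1))
  then show ?thesis unfolding S_def .
qed

lemma span_eigenvectors_diagonalizable:
  assumes E: "fn.span E = V" and ev: "\<And>f. f \<in> E \<Longrightarrow> \<exists>\<mu>. T f = fscale \<mu> f"
  shows "diagonalizable_on V T"
proof -
  obtain B where B: "B \<subseteq> E" "fn.independent B" "E \<subseteq> fn.span B"
    by (rule fn.maximal_independent_subset[of E])
  have "fn.span B = fn.span E"
    using fn.span_mono[OF B(1)] fn.span_minimal[OF B(3) fn.subspace_span] by blast
  then have "fn.span B = V" using E by simp
  moreover have "\<forall>f\<in>B. \<exists>\<mu>. T f = fscale \<mu> f" using ev B(1) by auto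
  moreover have "T ` V \<subseteq> V" using T_mem by auto
  ultimately show ?thesis
    unfolding diagonalizable_on_def using B(2) by auto
qed

text \<open>An eigenvector whose eigenvalue is not in \<open>L\<close> would be orthogonal to every element of \<open>E\<close>, hence to
itself.\<close>

lemma span_eigenvectors_eigenvalues:
  assumes E: "fn.span E = V"
    and ev: "\<And>f. f \<in> E \<Longrightarrow> \<exists>l\<in>L. T f = fscale (of_real l) f"
    and at: "\<And>l. l \<in> L \<Longrightarrow> \<exists>f\<in>V. f \<noteq> 0 \<and> T f = fscale (of_real l) f"
  shows "eigenvalues_on V T = of_real ` L"
proof (intro equalityI subsetI)
  fix \<mu> assume "\<mu> \<in> eigenvalues_on V T"
  then obtain f where f: "f \<in> V" "f \<noteq> 0" "T f = fscale \<mu> f"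
    unfolding eigenvalues_on_def by blast
  show "\<mu> \<in> of_real ` L"
  proof (rule ccontr)
    assume \<mu>: "\<mu> \<notin> of_real ` L"
    have "cip G f v = 0" if v: "v \<in> E" for v
    proof -
      obtain l where l: "l \<in> L" "T v = fscale (of_real l) v" using ev[OF v] by blast
      have "v \<in> V" using v E fn.span_base by blast
      from cip_eigenvector[OF f(1) this l(2), of \<mu>] f(3)
      have "(of_real l - \<mu>) * cip G f v = 0" by (simp add: cip_simps)
      with \<mu> l(1) show ?thesis by auto
    qed
    moreover have "f \<in> fn.span E" using f(1) E by simp
    ultimately have "cip G f f = 0" by (intro cip_span_right[of f E]) auto
    with f cip_definite show False by blast
  qed
next
  fix \<mu> :: complex assume "\<mu> \<in> of_real ` L"
  with at show "\<mu> \<in> eigenvalues_on V T"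
    unfolding eigenvalues_on_def by blast
qed

definition orthogonal_eigenbasis :: "nat \<Rightarrow> (nat \<Rightarrow> real) \<Rightarrow> (nat \<Rightarrow> 'g \<Rightarrow> complex) \<Rightarrow> bool" where
  "orthogonal_eigenbasis N l v \<longleftrightarrow>
     (\<forall>j<N. v j \<in> V \<and> v j \<noteq> 0 \<and> T (v j) = fscale (of_real (l j)) (v j)) \<and>
     (\<forall>i<N. \<forall>j<N. i \<noteq> j \<longrightarrow> cip G (v i) (v j) = 0) \<and>
     fn.span (v ` {..<N}) = V"

text \<open>The Gram-Schmidt vector \<open>v j\<close> is orthogonal to the span \<open>F\<close> of the earlier basis elements, which \<open>T\<close>
preserves. By triangularity \<open>T (v j) - l j v j\<close> lies in \<open>F\<close>, and by symmetry it is orthogonal to \<open>F\<close>;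
so it vanishes. In this way every diagonal entry has its own eigenvector, also when entries repeat.\<close>

lemma triangular_eigenbasis:
  assumes b: "\<And>j. j < N \<Longrightarrow> b j \<notin> fn.span (b ` {..<j})"
    and tri: "\<And>j. j < N \<Longrightarrow> T (b j) - fscale (of_real (l j)) (b j) \<in> fn.span (b ` {..<j})"
    and spanV: "fn.span (b ` {..<N}) = V"
  shows "\<exists>v. orthogonal_eigenbasis N l v"
proof -
  let ?F = "\<lambda>j. fn.span (b ` {..<j})"
  have bV: "b j \<in> V" if "j < N" for j
    using fn.span_base[of "b j" "b ` {..<N}"] that spanV by auto
  have FV: "?F j \<subseteq> V" if "j \<le> N" for j
    unfolding spanV[symmetric] using that by (intro fn.span_mono) auto
  have Fmono: "?F i \<subseteq> ?F j" if "i \<le> j" for i j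
    using that by (intro fn.span_mono) auto
  have TF: "T h \<in> ?F j" if "h \<in> ?F j" "j \<le> N" for h j
  proof -
    have "T (b i) \<in> ?F j" if i: "i < j" for i
    proof -
      have "T (b i) - fscale (of_real (l i)) (b i) \<in> ?F j"
        using tri[of i] i \<open>j \<le> N\<close> Fmono[of i j] by auto
      moreover have "fscale (of_real (l i)) (b i) \<in> ?F j"
        using i by (intro fn.span_scale fn.span_base) auto
      ultimately show ?thesis
        using fn.span_add by fastforce
    qed
    then have "?F j \<subseteq> {h. T h \<in> ?F j}"
      by (intro fn.span_minimal)
        (auto simp: fn.subspace_def T_add T_scale T_zero fn.span_zero fn.span_add fn.span_scale)
    with that show ?thesis by blast
  qed
  have "\<forall>j. \<exists>p. p \<in> ?F j \<and> (\<forall>h\<in>b ` {..<j}. cip G (b j - p) h = 0)"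
    using ex_orthogonal_projection[OF finite_G, of "b ` {..<j}" "b j" for j] by blast
  then obtain p where p: "\<And>j. p j \<in> ?F j" "\<And>j h. h \<in> b ` {..<j} \<Longrightarrow> cip G (b j - p j) h = 0"
    by metis
  define v where "v j = b j - p j" for j
  have vF: "cip G (v j) h = 0" if "h \<in> ?F j" for j h
    using cip_span_right[OF that] p(2) unfolding v_def by blast
  have vmem: "v j \<in> ?F (Suc j)" for j
  proof -
    have "b j \<in> ?F (Suc j)" by (intro fn.span_base) auto
    moreover have "p j \<in> ?F (Suc j)" using p(1)[of j] Fmono[of j "Suc j"] by auto
    ultimately show ?thesis unfolding v_def by (rule fn.span_diff)
  qed
  have vV: "v j \<in> V" if "j < N" for j
    using vmem FV[of "Suc j"] that by auto
  have eig: "T (v j) = fscale (of_real (l j)) (v j)" if j: "j < N" for j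
  proof -
    let ?w = "T (v j) - fscale (of_real (l j)) (v j)"
    have "?w = (T (b j) - fscale (of_real (l j)) (b j)) - (T (p j) - fscale (of_real (l j)) (p j))"
      unfolding v_def by (simp add: T_diff fn.scale_right_diff_distrib)
    also have "\<dots> \<in> ?F j"
    proof (rule fn.span_diff[OF tri[OF j]])
      show "T (p j) - fscale (of_real (l j)) (p j) \<in> ?F j"
        using TF[OF p(1)] p(1) j by (intro fn.span_diff fn.span_scale) auto
    qed
    finally have w: "?w \<in> ?F j" .
    then have wV: "?w \<in> V" using FV[of j] j by auto
    have "cip G ?w ?w = cip G (T (v j)) ?w - of_real (l j) * cip G (v j) ?w"
      by (simp only: cip_simps(2,3))
    also have "\<dots> = cip G (v j) (T ?w) - of_real (l j) * cip G (v j) ?w"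
      using T_sym[OF vV[OF j] wV] by (simp only:)
    also have "\<dots> = 0"
      using vF[OF w] vF[OF TF[OF w]] j by (simp only: mult_zero_right diff_zero less_imp_le)
    finally have "?w = 0" using cip_definite wV by blast
    then show ?thesis by simp
  qed
  have nz: "v j \<noteq> 0" if "j < N" for j
    using b[OF that] p(1)[of j] unfolding v_def by auto
  have orth: "cip G (v i) (v j) = 0" if "i \<noteq> j" for i j
  proof -
    have less: "cip G (v j) (v i) = 0" if "i < j" for i j
      using vF vmem Fmono[of "Suc i" j] that by fastforce
    show ?thesis using less[of i j] less[of j i] that cip_commute[of G "v i" "v j"]
      by (cases "i < j") auto
  qed
  have "b j \<in> fn.span (v ` {..<N})" if "j < N" for j
    using that
  proof (induction j rule: less_induct)
    case (less j)
    have "?F j \<subseteq> fn.span (v ` {..<N})"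
      using less by (intro fn.span_minimal) auto
    then have "p j \<in> fn.span (v ` {..<N})" using p(1) by blast
    moreover have "v j \<in> fn.span (v ` {..<N})"
      using less by (intro fn.span_base) auto
    ultimately show ?case using fn.span_add[of "v j" "v ` {..<N}" "p j"] v_def[of j] by (metis diff_add_cancel)
  qed
  then have "V \<subseteq> fn.span (v ` {..<N})"
    unfolding spanV[symmetric] by (intro fn.span_minimal) auto
  moreover have "fn.span (v ` {..<N}) \<subseteq> V"
    using vV subspace_V by (intro fn.span_minimal) auto
  ultimately show ?thesis
    unfolding orthogonal_eigenbasis_def using vV nz eig orth by blast
qed

text \<open>The generalized eigenspace is spanned by the basis vectors with that eigenvalue: its other components
are killed by \<open>cip_eigenvector_pow\<close>.\<close>

lemma eigenbasis_multiplicity: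
  assumes "orthogonal_eigenbasis N l v"
  shows "eigenvalue_mult V T \<mu> = card {j. j < N \<and> of_real (l j) = \<mu>}"
proof -
  have vV: "\<And>j. j < N \<Longrightarrow> v j \<in> V" and nz: "\<And>j. j < N \<Longrightarrow> v j \<noteq> 0"
    and eig: "\<And>j. j < N \<Longrightarrow> T (v j) = fscale (of_real (l j)) (v j)"
    and orth: "\<And>i j. i < N \<Longrightarrow> j < N \<Longrightarrow> i \<noteq> j \<Longrightarrow> cip G (v i) (v j) = 0"
    and span: "fn.span (v ` {..<N}) = V"
    using assms unfolding orthogonal_eigenbasis_def by auto
  let ?I = "{j. j < N \<and> of_real (l j) = \<mu>}" and ?K = "{j. j < N \<and> of_real (l j) \<noteq> \<mu>}"
  let ?S = "\<lambda>h. T h - fscale \<mu> h"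
  have vIV: "fn.span (v ` ?I) \<subseteq> V"
    using vV subspace_V by (intro fn.span_minimal) auto
  have "{f \<in> V. \<exists>k. (?S ^^ k) f = 0} = fn.span (v ` ?I)"
  proof (intro equalityI subsetI)
    fix f assume "f \<in> {f \<in> V. \<exists>k. (?S ^^ k) f = 0}"
    then obtain k where f: "f \<in> V" "(?S ^^ k) f = 0" by blast
    have "{..<N} = ?I \<union> ?K" by auto
    then have "f \<in> fn.span (v ` ?I \<union> v ` ?K)" using f(1) span by (simp add: image_Un)
    then obtain x y where xy: "x \<in> fn.span (v ` ?I)" "y \<in> fn.span (v ` ?K)" "f = x + y"
      unfolding fn.span_Un by blast
    have yV: "y \<in> V" using xy(2) vV subspace_V fn.span_minimal[of "v ` ?K" V] by auto
    have "cip G y (v j) = 0" if j: "j \<in> ?K" for j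
    proof -
      have "cip G (v j) x = 0"
        using xy(1) by (rule cip_span_right) (use j orth in auto)
      then have x0: "cip G x (v j) = 0" by (subst cip_commute) simp
      have "cip G ((?S ^^ k) f) (v j) = (of_real (l j) - \<mu>) ^ k * cip G f (v j)"
        using cip_eigenvector_pow[where f = f and v = "v j" and l = "l j"] f(1) j vV eig by blast
      then have "(of_real (l j) - \<mu>) ^ k * cip G f (v j) = 0"
        unfolding f(2) cip_simps by simp
      then have "cip G f (v j) = 0" using j by simp
      with x0 xy(3) show ?thesis by (simp add: cip_simps)
    qed
    then have "cip G y y = 0" using cip_span_right[OF xy(2), of G y] by blast
    then have "y = 0" using cip_definite yV by blast
    with xy show "f \<in> fn.span (v ` ?I)" by simp
  next
    fix f assume f: "f \<in> fn.span (v ` ?I)"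
    have "fn.span (v ` ?I) \<subseteq> {f. T f = fscale \<mu> f}"
      by (intro fn.span_minimal)
        (auto simp: fn.subspace_def T_add T_scale T_zero eig fn.scale_right_distrib
          fn.scale_left_commute)
    with f have "T f = fscale \<mu> f" by blast
    then have "(?S ^^ Suc 0) f = 0" by (simp only: funpow.simps comp_apply id_apply diff_self)
    then show "f \<in> {f \<in> V. \<exists>k. (?S ^^ k) f = 0}" using f vIV by blast
  qed
  moreover have "fn.independent (v ` {..<N})"
    unfolding fn.dependent_def
  proof
    assume "\<exists>a\<in>v ` {..<N}. a \<in> fn.span (v ` {..<N} - {a})"
    then obtain j where j: "j < N" "v j \<in> fn.span (v ` {..<N} - {v j})" by blast
    have "cip G (v j) (v j) = 0"
      using j(2) by (rule cip_span_right) (use j(1) orth in auto)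
    with j(1) cip_definite vV nz show False by blast
  qed
  then have ind: "fn.independent (v ` ?I)"
    by (rule fn.independent_mono) auto
  have "inj_on v {..<N}"
  proof (rule inj_onI)
    fix i j assume ij: "i \<in> {..<N}" "j \<in> {..<N}" "v i = v j"
    then have "cip G (v i) (v j) \<noteq> 0"
      using cip_definite[of "v i"] vV nz by auto
    with ij orth[of i j] show "i = j" by auto
  qed
  then have "card (v ` ?I) = card ?I"
    by (intro card_image) (auto elim: inj_on_subset)
  ultimately show ?thesis
    unfolding eigenvalue_mult_def by (simp only: fn.dim_span_eq_card_independent[OF ind])
qed

end

section \<open>Newton polynomials with nodes at the powers of \<open>q\<close>\<close>

text \<open>For \<open>z = q^s\<close> this is the number of linearly independent \<open>j\<close>-tuples in an \<open>s\<close>-dimensional space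
over the field with \<open>q\<close> elements; as polynomials in \<open>z\<close> they form the Newton basis
with nodes \<open>q^0, q^1, ...\<close>.\<close>

definition newton_poly :: "'a::comm_ring_1 \<Rightarrow> nat \<Rightarrow> 'a \<Rightarrow> 'a" where
  "newton_poly q j z = (\<Prod>l<j. z - q ^ l)"

lemma newton_poly_Suc_mult: "newton_poly q (Suc j) (q * z) = (q * z - 1) * (q ^ j * newton_poly q j z)"
proof -
  have "newton_poly q (Suc j) (q * z) = (q * z - 1) * (\<Prod>l<j. q * (z - q ^ l))"
    unfolding newton_poly_def by (subst prod.lessThan_Suc_shift) (simp add: algebra_simps)
  then show ?thesis
    by (simp add: newton_poly_def prod.distrib)
qed

lemma newton_poly_at_smaller_power: "s < j \<Longrightarrow> newton_poly q j (q ^ s) = 0"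
  unfolding newton_poly_def by (rule prod_zero) auto

lemma newton_poly_at_power_nonzero:
  fixes q :: "'a::idom"
  assumes "inj (\<lambda>s. q ^ s)"
  shows "newton_poly q s (q ^ s) \<noteq> 0"
proof -
  have "q ^ s \<noteq> q ^ l" if "l < s" for l using injD[OF assms, of s l] that by auto
  then show ?thesis unfolding newton_poly_def by auto
qed

lemma newton_poly_mult_linear:
  "(a + b * z) * newton_poly q i z = b * newton_poly q (Suc i) z + (a + b * q ^ i) * newton_poly q i z"
  by (simp add: newton_poly_def algebra_simps)

text \<open>Expansion of a product of \<open>j\<close> linear factors in the Newton basis; only its leading coefficient
matters, the lower ones are left unspecified.\<close>

lemma newton_expansion:
  "\<exists>c. \<forall>z. (\<Prod>l<j. a l + b l * z) =
    (\<Prod>l<j. b l) * newton_poly q j z + (\<Sum>i<j. c i * newton_poly q i z)"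
proof (induction j)
  case 0
  then show ?case by (simp add: newton_poly_def)
next
  case (Suc j)
  then obtain c where c: "\<And>z. (\<Prod>l<j. a l + b l * z) =
    (\<Prod>l<j. b l) * newton_poly q j z + (\<Sum>i<j. c i * newton_poly q i z)" by blast
  let ?B = "\<Prod>l<j. b l" and ?N = "newton_poly q"
  \<comment> \<open>Multiplying by a linear factor keeps the index of a Newton polynomial (\<open>A\<close>) or raises it by one (\<open>C\<close>).\<close>
  define A where "A = (\<lambda>i. (if i = j then ?B else c i) * (a j + b j * q ^ i))"
  define C where "C = (\<lambda>i. if i = 0 then 0 else b j * c (i - 1))"
  have "(\<Prod>l<Suc j. a l + b l * z) = (\<Prod>l<Suc j. b l) * ?N (Suc j) z + (\<Sum>i<Suc j. (A i + C i) * ?N i z)" for z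
  proof -
    have A: "(\<Sum>i<Suc j. A i * ?N i z) =
        (\<Sum>i<j. c i * ((a j + b j * q ^ i) * ?N i z)) + ?B * ((a j + b j * q ^ j) * ?N j z)"
      by (simp add: A_def mult.assoc)
    have C: "(\<Sum>i<Suc j. C i * ?N i z) = (\<Sum>i<j. c i * (b j * ?N (Suc i) z))"
      by (subst sum.lessThan_Suc_shift) (simp add: C_def mult_ac)
    have "(\<Prod>l<Suc j. a l + b l * z) = ((\<Prod>l<j. b l) * ?N j z + (\<Sum>i<j. c i * ?N i z)) * (a j + b j * z)"
      by (simp add: c)
    also have "\<dots> = ?B * ((a j + b j * z) * ?N j z) + (\<Sum>i<j. c i * ((a j + b j * z) * ?N i z))"
    proof -
      have "(?B * n + (\<Sum>i<j. c i * ?N i z)) * x = ?B * (x * n) + (\<Sum>i<j. c i * (x * ?N i z))" for n x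
        by (simp add: distrib_right distrib_left sum_distrib_right sum_distrib_left mult_ac)
      then show ?thesis .
    qed
    also have "\<dots> = ?B * (b j * ?N (Suc j) z) + (\<Sum>i<Suc j. C i * ?N i z) + (\<Sum>i<Suc j. A i * ?N i z)"
      unfolding newton_poly_mult_linear A C by (simp only: distrib_left sum.distrib ac_simps)
    also have "\<dots> = (\<Prod>l<Suc j. b l) * ?N (Suc j) z + (\<Sum>i<Suc j. (A i + C i) * ?N i z)"
      by (simp add: distrib_right sum.distrib mult.assoc del: sum.lessThan_Suc)
    finally show ?thesis .
  qed
  then show ?case by (intro exI[of _ "\<lambda>i. A i + C i"]) blast
qed

lemma newton_interpolation:
  fixes q :: "'a::field"
  assumes "inj (\<lambda>s. q ^ s)"
  shows "\<exists>c. \<forall>s<n. (\<Sum>j<n. c j * newton_poly q j (q ^ s)) = y s"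
proof (induction n)
  case (Suc n)
  then obtain c where c: "\<And>s. s < n \<Longrightarrow> (\<Sum>j<n. c j * newton_poly q j (q ^ s)) = y s" by blast
  define d where "d = c(n := (y n - (\<Sum>j<n. c j * newton_poly q j (q ^ n))) / newton_poly q n (q ^ n))"
  have d: "(\<Sum>j<Suc n. d j * newton_poly q j z) = (\<Sum>j<n. c j * newton_poly q j z) + d n * newton_poly q n z" for z
    by (auto simp: d_def intro!: sum.cong)
  have "(\<Sum>j<Suc n. d j * newton_poly q j (q ^ s)) = y s" if "s < Suc n" for s
    using that newton_poly_at_power_nonzero[OF assms, of n] unfolding d
    by (cases "s = n") (auto simp: d_def c newton_poly_at_smaller_power)
  then show ?case by blast
qed simp

lemma newton_poly_independent:
  fixes q :: "'a::field"
  assumes inj: "inj (\<lambda>s. q ^ s)"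
    and eq: "\<And>s. s \<le> j \<Longrightarrow> newton_poly q j (q ^ s) = (\<Sum>i<j. c i * newton_poly q i (q ^ s))"
  shows False
proof -
  have "c i = 0" if "i < j" for i
    using that
  proof (induction i rule: less_induct)
    case (less i)
    have zero: "c k * newton_poly q k (q ^ i) = 0" if "k < j" "k \<noteq> i" for k
    proof (cases "k < i")
      case True
      with less.IH[OF True \<open>k < j\<close>] show ?thesis by simp
    next
      case False
      with that newton_poly_at_smaller_power[of i k q] show ?thesis by simp
    qed
    have "(\<Sum>k<j. c k * newton_poly q k (q ^ i)) = (\<Sum>k\<in>{i}. c k * newton_poly q k (q ^ i))"
      using less.prems zero by (intro sum.mono_neutral_right) auto
    then have "(\<Sum>k<j. c k * newton_poly q k (q ^ i)) = c i * newton_poly q i (q ^ i)" by simp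
    moreover have "newton_poly q j (q ^ i) = 0"
      using less.prems by (rule newton_poly_at_smaller_power)
    ultimately have "c i * newton_poly q i (q ^ i) = 0"
      using eq[OF less_imp_le[OF less.prems]] by simp
    then show ?case using newton_poly_at_power_nonzero[OF inj, of i] by simp
  qed
  then have "newton_poly q j (q ^ j) = 0" using eq[of j] by simp
  with newton_poly_at_power_nonzero[OF inj] show False by blast
qed

section \<open>Kernels of symmetric matrices over a finite field\<close>

lemma card_carrier_vec: "card (carrier_vec n :: 'a::finite vec set) = CARD('a) ^ n"
proof -
  have "bij_betw vec_of_list {xs. set xs \<subseteq> (UNIV :: 'a set) \<and> length xs = n} (carrier_vec n)"
    by (rule bij_betwI[where g = list_of_vec]) (auto simp: list_vec vec_list intro: carrier_vecI)
  then show ?thesis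
    using card_lists_length_eq[of "UNIV :: 'a set" n] by (simp add: bij_betw_same_card)
qed

lemma finite_carrier_vec [simp]: "finite (carrier_vec n :: 'a::finite vec set)"
  by (rule card_ge_0_finite) (simp add: card_carrier_vec)

lemma finite_carrier_mat [simp]: "finite (carrier_mat m n :: 'a::finite mat set)"
proof -
  have "carrier_mat m n \<subseteq> mat_of_rows n ` {xs. set xs \<subseteq> (carrier_vec n :: 'a vec set) \<and> length xs = m}"
  proof
    fix M :: "'a mat" assume M: "M \<in> carrier_mat m n"
    then have "M = mat_of_rows n (rows M)" by (metis carrier_matD(2) mat_of_rows_rows)
    moreover have "rows M \<in> {xs. set xs \<subseteq> carrier_vec n \<and> length xs = m}"
      using M rows_carrier[of M] by auto
    ultimately show "M \<in> mat_of_rows n ` {xs. set xs \<subseteq> carrier_vec n \<and> length xs = m}"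
      by (rule image_eqI)
  qed
  then show ?thesis
    by (rule finite_subset) (intro finite_imageI finite_lists_length_eq finite_carrier_vec)
qed

text \<open>The kernel is measured by its number of vectors, a power of the field size, instead of by its
dimension: counting arguments then need no notion of rank.\<close>

definition kernel_card :: "'a::field mat \<Rightarrow> nat" where
  "kernel_card M = card {x \<in> carrier_vec (dim_col M). M *\<^sub>v x = 0\<^sub>v (dim_row M)}"

lemma inverse_mult_vec:
  fixes X :: "'a::field mat"
  assumes "X \<in> carrier_mat n n" "X' \<in> carrier_mat n n" "X' * X = 1\<^sub>m n" "v \<in> carrier_vec n"
  shows "X' *\<^sub>v (X *\<^sub>v v) = v"
  using assms by (metis assoc_mult_mat_vec one_mult_mat_vec)

lemma kernel_card_mult_left:
  fixes M :: "'a::field mat"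
  assumes M: "M \<in> carrier_mat n m" and X: "X \<in> carrier_mat n n" "X' \<in> carrier_mat n n" "X' * X = 1\<^sub>m n"
  shows "kernel_card (X * M) = kernel_card M"
proof -
  have "X * M *\<^sub>v x = 0\<^sub>v n \<longleftrightarrow> M *\<^sub>v x = 0\<^sub>v n" if x: "x \<in> carrier_vec m" for x
  proof
    assume "X * M *\<^sub>v x = 0\<^sub>v n"
    then have "X *\<^sub>v (M *\<^sub>v x) = 0\<^sub>v n" using M X x by (simp add: assoc_mult_mat_vec[of X n n M m])
    then have "X' *\<^sub>v (X *\<^sub>v (M *\<^sub>v x)) = 0\<^sub>v n" using X by (intro eq_vecI) auto
    then show "M *\<^sub>v x = 0\<^sub>v n" using inverse_mult_vec[OF X, of "M *\<^sub>v x"] M x by simp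
  next
    assume "M *\<^sub>v x = 0\<^sub>v n"
    then show "X * M *\<^sub>v x = 0\<^sub>v n"
      using M X x by (simp add: assoc_mult_mat_vec[of X n n M m]) (intro eq_vecI, auto)
  qed
  then have "{x \<in> carrier_vec m. X * M *\<^sub>v x = 0\<^sub>v n} = {x \<in> carrier_vec m. M *\<^sub>v x = 0\<^sub>v n}" by auto
  with M X show ?thesis unfolding kernel_card_def by simp
qed

lemma kernel_card_mult_right:
  fixes M :: "'a::field mat"
  assumes M: "M \<in> carrier_mat n m" and Y: "Y \<in> carrier_mat m m" "Y' \<in> carrier_mat m m"
    and inv: "Y' * Y = 1\<^sub>m m" "Y * Y' = 1\<^sub>m m"
  shows "kernel_card (M * Y) = kernel_card M"
proof -
  have "bij_betw (\<lambda>x. Y *\<^sub>v x) {x \<in> carrier_vec m. M * Y *\<^sub>v x = 0\<^sub>v n} {x \<in> carrier_vec m. M *\<^sub>v x = 0\<^sub>v n}"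
  proof (rule bij_betwI[where g = "\<lambda>x. Y' *\<^sub>v x"])
    show "(*\<^sub>v) Y \<in> {x \<in> carrier_vec m. M * Y *\<^sub>v x = 0\<^sub>v n} \<rightarrow> {x \<in> carrier_vec m. M *\<^sub>v x = 0\<^sub>v n}"
      using M Y by (auto simp: assoc_mult_mat_vec[of M n m Y m])
    show "(*\<^sub>v) Y' \<in> {x \<in> carrier_vec m. M *\<^sub>v x = 0\<^sub>v n} \<rightarrow> {x \<in> carrier_vec m. M * Y *\<^sub>v x = 0\<^sub>v n}"
      using M Y inverse_mult_vec[OF Y(2) Y(1) inv(2)] by (auto simp: assoc_mult_mat_vec[of M n m Y m])
  qed (use inverse_mult_vec[OF Y(2) Y(1) inv(2)] inverse_mult_vec[OF Y inv(1)] in auto)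
  then show ?thesis
    unfolding kernel_card_def using M Y by (simp add: bij_betw_same_card)
qed

definition sym_mats :: "nat \<Rightarrow> 'a::field mat set" where
  "sym_mats n = {S \<in> carrier_mat n n. transpose_mat S = S}"

lemma sym_mats_carrier: "S \<in> sym_mats n \<Longrightarrow> S \<in> carrier_mat n n"
  by (simp add: sym_mats_def)

lemma sym_mats_index: "S \<in> sym_mats n \<Longrightarrow> i < n \<Longrightarrow> j < n \<Longrightarrow> S $$ (i, j) = S $$ (j, i)"
  unfolding sym_mats_def by (metis (mono_tags, lifting) carrier_matD(1,2) index_transpose_mat(1) mem_Collect_eq)

lemma sym_matsI: "S \<in> carrier_mat n n \<Longrightarrow> (\<And>i j. i < n \<Longrightarrow> j < n \<Longrightarrow> S $$ (i, j) = S $$ (j, i)) \<Longrightarrow> S \<in> sym_mats n"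
  unfolding sym_mats_def by auto

lemma finite_sym_mats [simp]: "finite (sym_mats n :: 'a::{field,finite} mat set)"
  unfolding sym_mats_def by simp

definition top_left :: "nat \<Rightarrow> 'a mat \<Rightarrow> 'a mat" where
  "top_left r S = mat r r (\<lambda>ij. S $$ ij)"

definition sym_extend :: "nat \<Rightarrow> 'a mat \<Rightarrow> 'a vec \<Rightarrow> 'a mat" where
  "sym_extend n S v = mat (Suc n) (Suc n) (\<lambda>(i, j).
     if i < n \<and> j < n then S $$ (i, j) else if i = n then v $ j else v $ i)"

lemma top_left_sym: "S \<in> sym_mats n \<Longrightarrow> r \<le> n \<Longrightarrow> top_left r S \<in> sym_mats r"
  by (rule sym_matsI) (auto simp: top_left_def sym_mats_index)

lemma sym_extend_sym: "S \<in> sym_mats n \<Longrightarrow> sym_extend n S v \<in> sym_mats (Suc n)"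
  by (rule sym_matsI) (auto simp: sym_extend_def sym_mats_index)

lemma top_left_sym_extend: "S \<in> sym_mats n \<Longrightarrow> top_left n (sym_extend n S v) = S"
  using sym_mats_carrier[of S n] by (auto simp: top_left_def sym_extend_def)

lemma sym_extend_top_left:
  assumes "S \<in> sym_mats (Suc n)"
  shows "sym_extend n (top_left n S) (row S n) = S"
proof (rule eq_matI)
  fix i j assume "i < dim_row S" "j < dim_col S"
  then have ij: "i < Suc n" "j < Suc n" using sym_mats_carrier[OF assms] by auto
  then show "sym_extend n (top_left n S) (row S n) $$ (i, j) = S $$ (i, j)"
    using sym_mats_carrier[OF assms] sym_mats_index[OF assms, of i n]
    by (auto simp: sym_extend_def top_left_def less_Suc_eq)
qed (use sym_mats_carrier[OF assms] in \<open>auto simp: sym_extend_def\<close>)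

text \<open>A symmetric matrix of size \<open>n + 1\<close> is its upper left block together with an arbitrary last row.\<close>

lemma sum_top_left_Suc:
  fixes F :: "'a::{field,finite} mat \<Rightarrow> complex"
  shows "(\<Sum>S\<in>sym_mats (Suc n). F (top_left n S)) = of_nat CARD('a) ^ Suc n * (\<Sum>S\<in>sym_mats n. F S)"
proof -
  have "(\<Sum>S\<in>sym_mats (Suc n). F (top_left n S)) =
      (\<Sum>(S, v)\<in>sym_mats n \<times> (carrier_vec (Suc n) :: 'a vec set). F S)"
  proof (rule sum.reindex_bij_witness[where i = "\<lambda>(S, v). sym_extend n S v" and j = "\<lambda>S. (top_left n S, row S n)"])
    fix p :: "'a mat \<times> 'a vec" assume p: "p \<in> sym_mats n \<times> carrier_vec (Suc n)"
    obtain S v where Sv: "p = (S, v)" by (cases p)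
    have "row (sym_extend n S v) n = v"
      using p unfolding Sv sym_extend_def by (intro eq_vecI) auto
    then show "(top_left n (case p of (S, v) \<Rightarrow> sym_extend n S v), row (case p of (S, v) \<Rightarrow> sym_extend n S v) n) = p"
      using p unfolding Sv by (simp add: top_left_sym_extend)
    show "(case p of (S, v) \<Rightarrow> sym_extend n S v) \<in> sym_mats (Suc n)"
      using p unfolding Sv by (simp add: sym_extend_sym)
  next
    fix S :: "'a mat" assume S: "S \<in> sym_mats (Suc n)"
    then show "(top_left n S, row S n) \<in> sym_mats n \<times> carrier_vec (Suc n)"
      using sym_mats_carrier[OF S] by (auto simp: top_left_sym intro!: carrier_vecI)
  qed (auto simp: sym_extend_top_left)
  also have "\<dots> = of_nat CARD('a) ^ Suc n * (\<Sum>S\<in>sym_mats n. F S)"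
    by (simp add: sum.cartesian_product[symmetric] card_carrier_vec sum_distrib_left)
  finally show ?thesis .
qed

lemma sum_top_left:
  fixes F :: "'a::{field,finite} mat \<Rightarrow> complex"
  assumes "r \<le> n"
  shows "of_nat CARD('a) ^ (Suc r choose 2) * (\<Sum>S\<in>sym_mats n. F (top_left r S)) =
    of_nat CARD('a) ^ (Suc n choose 2) * (\<Sum>S\<in>sym_mats r. F S)"
  using assms
proof (induction n rule: dec_induct)
  case base
  have "top_left r S = S" if "S \<in> sym_mats r" for S :: "'a mat"
    using sym_mats_carrier[OF that] by (auto simp: top_left_def)
  then show ?case by simp
next
  case (step n)
  have "top_left r (top_left n S) = top_left r S" for S :: "'a mat"
    using step.hyps by (auto simp: top_left_def)
  then have "(\<Sum>S\<in>sym_mats (Suc n). F (top_left r S)) = of_nat CARD('a) ^ Suc n * (\<Sum>S\<in>sym_mats n. F (top_left r S))"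
    using sum_top_left_Suc[of "\<lambda>S. F (top_left r S)" n] by simp
  moreover have "Suc (Suc n) choose 2 = Suc n + (Suc n choose 2)"
    by (simp add: numeral_2_eq_2)
  ultimately show ?case using step.IH by (simp add: power_add mult_ac)
qed

lemma card_sym_mats: "of_nat (card (sym_mats n :: 'a::{field,finite} mat set)) = (of_nat CARD('a) ^ (Suc n choose 2) :: complex)"
proof -
  have "sym_mats 0 = {0\<^sub>m 0 0 :: 'a mat}"
    by (auto simp: sym_mats_def)
  then show ?thesis using sum_top_left[of 0 n "\<lambda>_ :: 'a mat. 1 :: complex"] by (simp add: numeral_2_eq_2)
qed

text \<open>The rank one perturbation \<open>Y = 1 + (x - e) w\<^sup>T\<close> of the identity maps the unit vector \<open>e\<close> to \<open>x\<close>
as soon as \<open>w \<bullet> e = 1\<close>, and it is injective if moreover \<open>w \<bullet> x \<noteq> 0\<close>. A suitable \<open>w\<close> is \<open>e\<close> itself or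
\<open>e\<close> plus another unit vector.\<close>

lemma ex_invertible_unit_vec_image:
  fixes x :: "'a::field vec"
  assumes x: "x \<in> carrier_vec n" "x \<noteq> 0\<^sub>v n" and k: "k < n"
  shows "\<exists>Y\<in>carrier_mat n n. \<exists>Y'\<in>carrier_mat n n. Y * Y' = 1\<^sub>m n \<and> Y' * Y = 1\<^sub>m n \<and> Y *\<^sub>v unit_vec n k = x"
proof -
  obtain i where i: "i < n" "x $ i \<noteq> 0"
    using x by (metis carrier_vecD eq_vecI index_zero_vec(1) index_zero_vec(2))
  \<comment> \<open>A functional with value \<open>1\<close> at the unit vector that does not vanish at \<open>x\<close>.\<close>
  define w :: "'a vec" where "w = (if x $ k \<noteq> 0 then unit_vec n k else unit_vec n k + unit_vec n i)"
  have w: "w \<in> carrier_vec n" by (simp add: w_def)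
  have wk: "w $ k = 1" using k i by (auto simp: w_def)
  have wx: "w \<bullet> x \<noteq> 0"
    using x k i by (auto simp: w_def add_scalar_prod_distrib[of _ n] scalar_prod_left_unit)
  define d where "d = x - unit_vec n k"
  have d: "d \<in> carrier_vec n" using x by (simp add: d_def)
  define Y where "Y = mat n n (\<lambda>(a, b). (if a = b then 1 else 0) + d $ a * w $ b)"
  have Y: "Y \<in> carrier_mat n n" by (simp add: Y_def)
  have Yv: "Y *\<^sub>v v = v + (w \<bullet> v) \<cdot>\<^sub>v d" if v: "v \<in> carrier_vec n" for v
  proof (rule eq_vecI)
    fix a assume "a < dim_vec (v + (w \<bullet> v) \<cdot>\<^sub>v d)"
    then have a: "a < n" using v d by simp
    have "(Y *\<^sub>v v) $ a = (\<Sum>b<n. (if b = a then v $ b else 0) + d $ a * (w $ b * v $ b))"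
      using a v by (auto simp: Y_def scalar_prod_def atLeast0LessThan algebra_simps intro!: sum.cong)
    also have "\<dots> = v $ a + d $ a * (w \<bullet> v)"
      using a v by (simp add: sum.distrib scalar_prod_def atLeast0LessThan sum_distrib_left)
    finally show "(Y *\<^sub>v v) $ a = (v + (w \<bullet> v) \<cdot>\<^sub>v d) $ a"
      using a v d by (simp add: mult.commute)
  qed (use Y d v in auto)
  have "v = 0\<^sub>v n" if v: "v \<in> carrier_vec n" and "Y *\<^sub>v v = 0\<^sub>v n" for v
  proof -
    have eq: "v + (w \<bullet> v) \<cdot>\<^sub>v d = 0\<^sub>v n" using Yv[OF v] that by simp
    have wd: "w \<bullet> d = w \<bullet> x - 1"
      unfolding d_def using w x k wk by (simp add: scalar_prod_minus_distrib[of _ n] scalar_prod_right_unit)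
    have "w \<bullet> (v + (w \<bullet> v) \<cdot>\<^sub>v d) = 0" unfolding eq using w by simp
    then have "w \<bullet> v + (w \<bullet> v) * (w \<bullet> d) = 0"
      using w v d by (simp add: scalar_prod_add_distrib[of _ n])
    then have "(w \<bullet> v) * (w \<bullet> x) = 0"
      unfolding wd by (simp add: algebra_simps)
    then have "w \<bullet> v = 0" using wx by simp
    then show ?thesis using eq v d by (auto simp: vec_eq_iff)
  qed
  then have "det Y \<noteq> 0" using det_0_iff_vec_prod_zero_field[OF Y] by blast
  then obtain Y' where "Y' \<in> carrier_mat n n" "Y * Y' = 1\<^sub>m n" "Y' * Y = 1\<^sub>m n"
    using det_non_zero_imp_unit[OF Y] unfolding Units_def by (auto simp: ring_mat_def)
  moreover have "Y *\<^sub>v unit_vec n k = x"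
    using Yv[of "unit_vec n k"] w k wk x by (auto simp: d_def scalar_prod_right_unit)
  ultimately show ?thesis using Y by blast
qed

lemma kernel_card_sym_extend_0:
  fixes S :: "'a::{field,finite} mat"
  assumes "S \<in> carrier_mat n n"
  shows "kernel_card (sym_extend n S (0\<^sub>v (Suc n))) = CARD('a) * kernel_card S"
proof -
  let ?E = "sym_extend n S (0\<^sub>v (Suc n))"
  let ?K = "{x \<in> carrier_vec n. S *\<^sub>v x = 0\<^sub>v n}"
  let ?L = "{x \<in> carrier_vec (Suc n). ?E *\<^sub>v x = 0\<^sub>v (Suc n)}"
  have Ev: "(?E *\<^sub>v x) $ i = (if i < n then (S *\<^sub>v vec n (\<lambda>k. x $ k)) $ i else 0)"
    if "x \<in> carrier_vec (Suc n)" "i < Suc n" for x i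
    using that assms by (auto simp: sym_extend_def scalar_prod_def intro!: sum.neutral)
  have dims: "dim_row ?E = Suc n" "dim_col ?E = Suc n" "dim_row S = n" "dim_col S = n"
    using assms by (simp_all add: sym_extend_def)
  have mem: "x \<in> ?L \<longleftrightarrow> x \<in> carrier_vec (Suc n) \<and> vec n (\<lambda>k. x $ k) \<in> ?K" for x
  proof (cases "x \<in> carrier_vec (Suc n)")
    case True
    have "?E *\<^sub>v x = 0\<^sub>v (Suc n) \<longleftrightarrow> (\<forall>i<Suc n. (?E *\<^sub>v x) $ i = 0)"
      using dims by (auto simp: vec_eq_iff simp del: index_mult_mat_vec)
    also have "\<dots> \<longleftrightarrow> (\<forall>i<n. (S *\<^sub>v vec n (\<lambda>k. x $ k)) $ i = 0)"
      using Ev[OF True] by auto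
    also have "\<dots> \<longleftrightarrow> S *\<^sub>v vec n (\<lambda>k. x $ k) = 0\<^sub>v n"
      using dims by (auto simp: vec_eq_iff simp del: index_mult_mat_vec)
    finally show ?thesis using True by auto
  qed auto
  have "bij_betw (\<lambda>(y, c). vec (Suc n) (\<lambda>k. if k < n then y $ k else c)) (?K \<times> (UNIV :: 'a set)) ?L"
  proof (rule bij_betwI[where g = "\<lambda>x. (vec n (\<lambda>k. x $ k), x $ n)"])
    have restr: "vec n (\<lambda>k. vec (Suc n) (\<lambda>k. if k < n then y $ k else c) $ k) = y"
      if "y \<in> ?K" for y and c :: 'a
      using that by (intro eq_vecI) auto
    then show "(\<lambda>(y, c). vec (Suc n) (\<lambda>k. if k < n then y $ k else c)) \<in> ?K \<times> UNIV \<rightarrow> ?L"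
    proof -
      have "vec (Suc n) (\<lambda>k. if k < n then y $ k else c) \<in> ?L" if "y \<in> ?K" for y and c :: 'a
        using mem[of "vec (Suc n) (\<lambda>k. if k < n then y $ k else c)"] restr[OF that, of c] that by auto
      then show ?thesis by auto
    qed
    show "(\<lambda>x. (vec n (\<lambda>k. x $ k), x $ n)) \<in> ?L \<rightarrow> ?K \<times> UNIV"
      using mem by blast
    show "(vec n (\<lambda>k. (case p of (y, c) \<Rightarrow> vec (Suc n) (\<lambda>k. if k < n then y $ k else c)) $ k),
        (case p of (y, c) \<Rightarrow> vec (Suc n) (\<lambda>k. if k < n then y $ k else c)) $ n) = p"
      if "p \<in> ?K \<times> UNIV" for p :: "'a vec \<times> 'a"
      using that restr by (cases p) auto
    show "(case (vec n (\<lambda>k. x $ k), x $ n) of (y, c) \<Rightarrow> vec (Suc n) (\<lambda>k. if k < n then y $ k else c)) = x"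
      if "x \<in> ?L" for x
      using that by (intro eq_vecI) (auto simp: less_Suc_eq)
  qed
  then have "card ?L = card (?K \<times> (UNIV :: 'a set))"
    by (simp add: bij_betw_same_card)
  then show ?thesis
    unfolding kernel_card_def dims by (simp add: card_cartesian_product mult.commute)
qed

lemma congruence_cancel:
  fixes S :: "'a::field mat"
  assumes "S \<in> carrier_mat n n" "Y \<in> carrier_mat n n" "Y' \<in> carrier_mat n n" "Y * Y' = 1\<^sub>m n"
  shows "transpose_mat Y' * (transpose_mat Y * S * Y) * Y' = S"
proof -
  have "transpose_mat Y' * (transpose_mat Y * S * Y) * Y' = transpose_mat (Y * Y') * S * (Y * Y')"
    using assms(1-3) by (simp add: transpose_mult[of _ n n _ n] assoc_mult_mat[of _ n n _ n _ n])
  then show ?thesis using assms by simp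
qed

lemma congruence_sym:
  fixes S :: "'a::field mat"
  assumes "S \<in> sym_mats n" "Y \<in> carrier_mat n n"
  shows "transpose_mat Y * S * Y \<in> sym_mats n"
proof -
  have S: "S \<in> carrier_mat n n" "transpose_mat S = S" using assms(1) by (simp_all add: sym_mats_def)
  have "transpose_mat (transpose_mat Y * S * Y) = transpose_mat Y * (transpose_mat S * Y)"
    using S(1) assms(2) by (simp add: transpose_mult[of _ n n _ n])
  then show ?thesis
    using S assms(2) by (simp add: sym_mats_def assoc_mult_mat[of _ n n _ n _ n])
qed

text \<open>After a change of basis \<open>x\<close> is the last unit vector, and a symmetric matrix that kills it is
an arbitrary symmetric matrix of size \<open>n\<close> bordered by zeros.\<close>

lemma sum_sym_mats_kernel_vec:
  fixes x :: "'a::{field,finite} vec" and F :: "nat \<Rightarrow> complex"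
  assumes x: "x \<in> carrier_vec (Suc n)" "x \<noteq> 0\<^sub>v (Suc n)"
  shows "(\<Sum>S | S \<in> sym_mats (Suc n) \<and> S *\<^sub>v x = 0\<^sub>v (Suc n). F (kernel_card S)) =
    (\<Sum>S\<in>(sym_mats n :: 'a mat set). F (CARD('a) * kernel_card S))"
proof -
  let ?N = "Suc n" and ?e = "unit_vec (Suc n) n :: 'a vec"
  obtain Y Y' where Y: "Y \<in> carrier_mat ?N ?N" "Y' \<in> carrier_mat ?N ?N" "Y * Y' = 1\<^sub>m ?N" "Y' * Y = 1\<^sub>m ?N"
    and Yx: "Y *\<^sub>v ?e = x"
    using ex_invertible_unit_vec_image[OF x, of n] by auto
  have Y'x: "Y' *\<^sub>v x = ?e"
    using inverse_mult_vec[OF Y(1,2,4), of ?e] Yx by simp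
  let ?E = "\<lambda>S. sym_extend n S (0\<^sub>v ?N)"
  have E: "?E S \<in> sym_mats ?N" if "S \<in> sym_mats n" for S :: "'a mat"
    using that by (rule sym_extend_sym)
  have Ee: "?E S *\<^sub>v ?e = 0\<^sub>v ?N" for S
    by (intro eq_vecI) (auto simp: sym_extend_def scalar_prod_right_unit)
  have E_top: "?E (top_left n S) = S" if S: "S \<in> sym_mats ?N" "S *\<^sub>v ?e = 0\<^sub>v ?N" for S
  proof -
    have "row S n $ j = 0\<^sub>v ?N $ j" if j: "j < ?N" for j
    proof -
      have "(S *\<^sub>v ?e) $ j = S $$ (j, n)"
        using sym_mats_carrier[OF S(1)] j by (simp add: scalar_prod_right_unit)
      then show ?thesis
        using S(2) j sym_mats_carrier[OF S(1)] sym_mats_index[OF S(1), of j n] by simp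
    qed
    then have "row S n = 0\<^sub>v ?N"
      using sym_mats_carrier[OF S(1)] by (intro eq_vecI) auto
    then show ?thesis using sym_extend_top_left[OF S(1)] by simp
  qed
  show ?thesis
  proof (rule sum.reindex_bij_witness[where j = "\<lambda>S. top_left n (transpose_mat Y * S * Y)"
        and i = "\<lambda>S. transpose_mat Y' * ?E S * Y'"])
    fix S assume "S \<in> {S. S \<in> sym_mats ?N \<and> S *\<^sub>v x = 0\<^sub>v ?N}"
    then have S: "S \<in> sym_mats ?N" "S \<in> carrier_mat ?N ?N" "S *\<^sub>v x = 0\<^sub>v ?N"
      using sym_mats_carrier by auto
    let ?S = "transpose_mat Y * S * Y"
    have "?S *\<^sub>v ?e = transpose_mat Y *\<^sub>v (S *\<^sub>v x)"
      unfolding Yx[symmetric] using S Y by (simp add: assoc_mult_mat_vec[of _ ?N ?N _ ?N])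
    then have S': "?S \<in> sym_mats ?N" "?S *\<^sub>v ?e = 0\<^sub>v ?N"
      using S Y congruence_sym[OF S(1) Y(1)] by (auto intro!: eq_vecI)
    have eq: "?E (top_left n ?S) = ?S" using E_top[OF S'] .
    then show "transpose_mat Y' * ?E (top_left n ?S) * Y' = S"
      using congruence_cancel[OF S(2) Y(1,2,3)] by simp
    show "top_left n ?S \<in> sym_mats n" using S'(1) by (simp add: top_left_sym)
    have inv: "transpose_mat Y' * transpose_mat Y = 1\<^sub>m ?N"
      using Y by (simp add: transpose_mult[of _ ?N ?N _ ?N, symmetric])
    have "kernel_card ?S = kernel_card (transpose_mat Y * (S * Y))"
      using S Y by (simp add: assoc_mult_mat[of _ ?N ?N _ ?N _ ?N])
    also have "\<dots> = kernel_card (S * Y)"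
      using S Y inv by (intro kernel_card_mult_left[of _ ?N ?N _ "transpose_mat Y'"]) auto
    also have "\<dots> = kernel_card S"
      using S Y by (intro kernel_card_mult_right[of _ ?N ?N _ Y']) auto
    finally have "kernel_card ?S = kernel_card S" .
    moreover have "kernel_card (?E (top_left n ?S)) = CARD('a) * kernel_card (top_left n ?S)"
      by (rule kernel_card_sym_extend_0) (simp add: top_left_def)
    ultimately show "F (CARD('a) * kernel_card (top_left n ?S)) = F (kernel_card S)"
      using eq by simp
  next
    fix S :: "'a mat" assume S: "S \<in> sym_mats n"
    have c: "?E S \<in> carrier_mat ?N ?N" using sym_mats_carrier[OF E[OF S]] .
    have "transpose_mat Y * (transpose_mat Y' * ?E S * Y') * Y = ?E S"
      by (rule congruence_cancel[OF c Y(2,1,4)])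
    then show "top_left n (transpose_mat Y * (transpose_mat Y' * ?E S * Y') * Y) = S"
      using S by (simp add: top_left_sym_extend)
    have "transpose_mat Y' * ?E S * Y' *\<^sub>v x = transpose_mat Y' *\<^sub>v (?E S *\<^sub>v (Y' *\<^sub>v x))"
      using c Y x by (simp add: assoc_mult_mat_vec[of _ ?N ?N _ ?N])
    also have "\<dots> = 0\<^sub>v ?N" unfolding Y'x Ee using Y by (auto intro!: eq_vecI)
    finally show "transpose_mat Y' * ?E S * Y' \<in> {S. S \<in> sym_mats ?N \<and> S *\<^sub>v x = 0\<^sub>v ?N}"
      using congruence_sym[OF E[OF S] Y(2)] by simp
  qed
qed

text \<open>Double counting of the pairs of a symmetric matrix \<open>S\<close> and a nonzero \<open>x\<close> in its kernel: the factor
\<open>K - 1\<close> of \<open>newton_poly q (Suc j) K\<close> is the number of such \<open>x\<close> for a given \<open>S\<close>.\<close>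

lemma sum_sym_mats_newton_poly_Suc:
  fixes q :: complex
  assumes q: "q = of_nat CARD('a::{field,finite})"
  shows "(\<Sum>S\<in>(sym_mats (Suc n) :: 'a mat set). newton_poly q (Suc j) (of_nat (kernel_card S))) =
    (q ^ Suc n - 1) * (q ^ j * (\<Sum>S\<in>(sym_mats n :: 'a mat set). newton_poly q j (of_nat (kernel_card S))))"
proof -
  let ?N = "Suc n"
  let ?V = "carrier_vec ?N - {0\<^sub>v ?N} :: 'a vec set"
  have q0: "q \<noteq> 0" using q by simp
  \<comment> \<open>The rest of \<open>newton_poly q (Suc j) k\<close> after removing the factor \<open>k - 1\<close>.\<close>
  let ?F = "\<lambda>k. q ^ j * newton_poly q j (of_nat k / q)"
  have "newton_poly q (Suc j) (of_nat (kernel_card S)) =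
      (\<Sum>x\<in>{x\<in>?V. S *\<^sub>v x = 0\<^sub>v ?N}. ?F (kernel_card S))" if "S \<in> sym_mats ?N" for S :: "'a mat"
  proof -
    have S: "S \<in> carrier_mat ?N ?N" using sym_mats_carrier[OF that] .
    let ?K = "{x \<in> carrier_vec ?N. S *\<^sub>v x = 0\<^sub>v ?N}"
    have "0\<^sub>v ?N \<in> ?K" using S by (auto intro!: eq_vecI)
    moreover have fin: "finite ?K" by simp
    moreover have "{x\<in>?V. S *\<^sub>v x = 0\<^sub>v ?N} = ?K - {0\<^sub>v ?N}" by auto
    moreover have "card ?K \<ge> 1"
      using calculation(1) fin by (metis One_nat_def Suc_leI card_gt_0_iff empty_iff)
    ultimately have "of_nat (card {x\<in>?V. S *\<^sub>v x = 0\<^sub>v ?N}) = (of_nat (kernel_card S) - 1 :: complex)"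
      using S by (simp add: kernel_card_def of_nat_diff)
    then show ?thesis
      using newton_poly_Suc_mult[of q j "of_nat (kernel_card S) / q"] q0 by simp
  qed
  then have "(\<Sum>S\<in>(sym_mats ?N :: 'a mat set). newton_poly q (Suc j) (of_nat (kernel_card S))) =
      (\<Sum>S\<in>(sym_mats ?N :: 'a mat set). \<Sum>x\<in>{x\<in>?V. S *\<^sub>v x = 0\<^sub>v ?N}. ?F (kernel_card S))"
    by (intro sum.cong) auto
  also have "\<dots> = (\<Sum>x\<in>?V. \<Sum>S | S \<in> sym_mats ?N \<and> S *\<^sub>v x = 0\<^sub>v ?N. ?F (kernel_card S))"
    by (rule sum.swap_restrict) auto
  also have "\<dots> = (\<Sum>x\<in>?V. \<Sum>S\<in>(sym_mats n :: 'a mat set). ?F (CARD('a) * kernel_card S))"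
    by (intro sum.cong sum_sym_mats_kernel_vec) auto
  also have "\<dots> = of_nat (card ?V) * (q ^ j * (\<Sum>S\<in>(sym_mats n :: 'a mat set). newton_poly q j (of_nat (kernel_card S))))"
    using q0 q by (simp add: sum_distrib_left)
  also have "of_nat (card ?V) = q ^ ?N - 1"
    using q by (simp add: card_carrier_vec card_Diff_singleton of_nat_diff)
  finally show ?thesis .
qed

text \<open>The product on the right vanishes for \<open>j > n\<close>, as it should, because an \<open>n\<close>-dimensional kernel
contains no \<open>j\<close> independent vectors.\<close>

lemma sum_sym_mats_newton_poly:
  fixes q :: complex
  assumes q: "q = of_nat CARD('a::{field,finite})"
  shows "(\<Sum>S\<in>(sym_mats n :: 'a mat set). newton_poly q j (of_nat (kernel_card S))) =
    q ^ ((Suc n choose 2) + (j choose 2)) * (\<Prod>l<j. 1 - q ^ l / q ^ n)"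
proof (induction j arbitrary: n)
  case 0
  then show ?case using q by (simp add: newton_poly_def card_sym_mats binomial_eq_0)
next
  case (Suc j)
  have q0: "q \<noteq> 0" using q by simp
  show ?case
  proof (cases n)
    case 0
    have "kernel_card S = 1" if "S \<in> sym_mats 0" for S :: "'a mat"
    proof -
      have "{x \<in> carrier_vec 0. S *\<^sub>v x = 0\<^sub>v 0} = carrier_vec 0"
        using sym_mats_carrier[OF that] by (auto intro!: eq_vecI)
      then show ?thesis
        using sym_mats_carrier[OF that] card_carrier_vec[where 'a = 'a and n = 0]
        by (simp add: kernel_card_def)
    qed
    then have "(\<Sum>S\<in>(sym_mats n :: 'a mat set). newton_poly q (Suc j) (of_nat (kernel_card S))) = 0"
      using 0 by (intro sum.neutral) (auto simp: newton_poly_def prod.lessThan_Suc_shift simp del: prod.lessThan_Suc)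
    then show ?thesis using 0 by (simp add: prod.lessThan_Suc_shift del: prod.lessThan_Suc)
  next
    case (Suc m)
    have prod: "(\<Prod>l<Suc j. 1 - q ^ l / q ^ n) = (1 - 1 / q ^ n) * (\<Prod>l<j. 1 - q ^ l / q ^ m)"
      unfolding prod.lessThan_Suc_shift using q0 Suc by simp
    have choose: "Suc n choose 2 = n + (Suc m choose 2)" "Suc j choose 2 = j + (j choose 2)"
      unfolding Suc by (simp_all add: numeral_2_eq_2)
    have qn: "q ^ n - 1 = q ^ n * (1 - 1 / q ^ n)" using q0 by (simp add: algebra_simps)
    have "(\<Sum>S\<in>(sym_mats n :: 'a mat set). newton_poly q (Suc j) (of_nat (kernel_card S))) =
        (q ^ n - 1) * (q ^ j * (q ^ ((Suc m choose 2) + (j choose 2)) * (\<Prod>l<j. 1 - q ^ l / q ^ m)))"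
      unfolding Suc sum_sym_mats_newton_poly_Suc[OF q] Suc.IH ..
    also have "\<dots> = q ^ ((Suc n choose 2) + (Suc j choose 2)) * (\<Prod>l<Suc j. 1 - q ^ l / q ^ n)"
      unfolding prod choose qn power_add by (simp only: mult_ac)
    finally show ?thesis .
  qed
qed

section \<open>Rank normal form and kernels of partial identities\<close>

definition inverse_mats :: "nat \<Rightarrow> 'a::field mat \<Rightarrow> 'a mat \<Rightarrow> bool" where
  "inverse_mats n X X' \<longleftrightarrow> X \<in> carrier_mat n n \<and> X' \<in> carrier_mat n n \<and> X * X' = 1\<^sub>m n \<and> X' * X = 1\<^sub>m n"

lemma inverse_mats_mult:
  assumes "inverse_mats n X X'" "inverse_mats n Z Z'"
  shows "inverse_mats n (X * Z) (Z' * X')"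
proof -
  have c: "X \<in> carrier_mat n n" "X' \<in> carrier_mat n n" "Z \<in> carrier_mat n n" "Z' \<in> carrier_mat n n"
    using assms by (auto simp: inverse_mats_def)
  have "X * Z * (Z' * X') = X * (Z * Z') * X'" "Z' * X' * (X * Z) = Z' * (X' * X) * Z"
    using c by (simp_all add: assoc_mult_mat[of _ n n _ n _ n])
  then show ?thesis using assms c by (simp add: inverse_mats_def)
qed

lemma inverse_mats_sym: "inverse_mats n X X' \<Longrightarrow> inverse_mats n X' X"
  by (auto simp: inverse_mats_def)

lemma inverse_mats_one: "inverse_mats n (1\<^sub>m n) (1\<^sub>m n)"
  by (simp add: inverse_mats_def)

lemma inverse_mats_transpose: "inverse_mats n X X' \<Longrightarrow> inverse_mats n (transpose_mat X) (transpose_mat X')"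
  by (auto simp: inverse_mats_def transpose_mult[of _ n n _ n, symmetric])

lemma inverse_mats_of_kernel:
  fixes M :: "'a::field mat"
  assumes M: "M \<in> carrier_mat n n" and ker: "\<And>v. v \<in> carrier_vec n \<Longrightarrow> M *\<^sub>v v = 0\<^sub>v n \<Longrightarrow> v = 0\<^sub>v n"
  shows "\<exists>M'. inverse_mats n M M'"
proof -
  have "det M \<noteq> 0" using det_0_iff_vec_prod_zero_field[OF M] ker by blast
  then show ?thesis
    using det_non_zero_imp_unit[OF M] M unfolding Units_def
    by (auto simp: ring_mat_def inverse_mats_def)
qed

lemma four_block_mat_eq_iff:
  fixes A :: "'a::zero mat"
  assumes "A \<in> carrier_mat a c" "B \<in> carrier_mat a d" "C \<in> carrier_mat b c" "D \<in> carrier_mat b d"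
    "A' \<in> carrier_mat a c" "B' \<in> carrier_mat a d" "C' \<in> carrier_mat b c" "D' \<in> carrier_mat b d"
  shows "four_block_mat A B C D = four_block_mat A' B' C' D' \<longleftrightarrow> A = A' \<and> B = B' \<and> C = C' \<and> D = D'"
proof
  assume eq: "four_block_mat A B C D = four_block_mat A' B' C' D'"
  have split: "split_block (four_block_mat A B C D) a c = (A, B, C, D)"
    if "A \<in> carrier_mat a c" "B \<in> carrier_mat a d" "C \<in> carrier_mat b c" "D \<in> carrier_mat b d" for A B C D :: "'a mat"
    using that by (auto simp: split_block_def Let_def)
  show "A = A' \<and> B = B' \<and> C = C' \<and> D = D'"
    using split[OF assms(1-4)] split[OF assms(5-8)] unfolding eq by simp
qed simp

lemma four_block_mat_obtain:
  fixes g :: "'a::zero mat"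
  assumes "g \<in> carrier_mat (n + n) (n + n)"
  obtains A B C D where "A \<in> carrier_mat n n" "B \<in> carrier_mat n n" "C \<in> carrier_mat n n" "D \<in> carrier_mat n n"
    "g = four_block_mat A B C D"
proof -
  obtain A B C D where s: "split_block g n n = (A, B, C, D)" by (metis prod_cases4)
  show ?thesis
    using split_block[OF s, of n n] assms that by auto
qed

text \<open>The identity of size \<open>r\<close>, padded by zeros. Being idempotent it replaces a subdivision of the \<open>n \<times> n\<close>
blocks into smaller blocks: products with it and with \<open>1 - e\<close> select the sub-blocks.\<close>

definition diag_idem :: "nat \<Rightarrow> nat \<Rightarrow> 'a::field mat" where
  "diag_idem n r = mat n n (\<lambda>(i, j). if i = j \<and> i < r then 1 else 0)"

lemma diag_idem_carrier: "diag_idem n r \<in> carrier_mat n n"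
  by (simp add: diag_idem_def)

text \<open>Some vector \<open>y\<close> has a nonzero image \<open>w\<close>; moving both to the first unit vector makes the first
column of the matrix a unit vector, a column operation clears the rest of the first row, and the
remaining block is treated by induction.\<close>

lemma rank_normal_form:
  fixes C :: "'a::field mat"
  assumes "C \<in> carrier_mat n n"
  shows "\<exists>X X' Y Y' r. inverse_mats n X X' \<and> inverse_mats n Y Y' \<and> r \<le> n \<and> X * C * Y = diag_idem n r"
  using assms
proof (induction n arbitrary: C)
  case 0
  have "1\<^sub>m 0 * C * 1\<^sub>m 0 = diag_idem 0 0" using 0 by (auto simp: diag_idem_def)
  then show ?case using inverse_mats_one[of 0] by blast
next
  case (Suc n)
  note C = Suc.prems
  let ?N = "Suc n"
  show ?case
  proof (cases "C = 0\<^sub>m ?N ?N")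
    case True
    have "1\<^sub>m ?N * C * 1\<^sub>m ?N = diag_idem ?N 0" using C True by (auto simp: diag_idem_def)
    then show ?thesis using inverse_mats_one[of ?N] by blast
  next
    case False
    then obtain i k where ik: "i < ?N" "k < ?N" "C $$ (i, k) \<noteq> 0"
      using eq_matI[of C "0\<^sub>m ?N ?N"] C by auto
    let ?e = "unit_vec ?N 0 :: 'a vec" and ?y = "unit_vec ?N k :: 'a vec"
    let ?w = "C *\<^sub>v ?y"
    have w: "?w \<in> carrier_vec ?N" using C by simp
    have "?w $ i \<noteq> 0" using C ik by (simp add: scalar_prod_right_unit)
    then have w0: "?w \<noteq> 0\<^sub>v ?N" using ik by auto
    have y0: "?y \<noteq> 0\<^sub>v ?N" using ik by (auto simp: vec_eq_iff)
    obtain Y1 Y1' where Y1: "inverse_mats ?N Y1 Y1'" "Y1 *\<^sub>v ?e = ?y"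
      using ex_invertible_unit_vec_image[OF _ y0, of 0] unfolding inverse_mats_def by auto
    obtain X1 X1' where X1: "inverse_mats ?N X1 X1'" "X1 *\<^sub>v ?e = ?w"
      using ex_invertible_unit_vec_image[OF w w0, of 0] unfolding inverse_mats_def by auto
    have c1: "X1 \<in> carrier_mat ?N ?N" "X1' \<in> carrier_mat ?N ?N" "Y1 \<in> carrier_mat ?N ?N" "Y1' \<in> carrier_mat ?N ?N"
      and X1': "X1' * X1 = 1\<^sub>m ?N"
      using X1(1) Y1(1) by (auto simp: inverse_mats_def)
    define C1 where "C1 = X1' * C * Y1"
    have C1: "C1 \<in> carrier_mat ?N ?N" using c1 C by (simp add: C1_def)
    have "C1 *\<^sub>v ?e = X1' *\<^sub>v (C *\<^sub>v (Y1 *\<^sub>v ?e))"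
      unfolding C1_def using c1 C by (simp add: assoc_mult_mat_vec[of _ ?N ?N _ ?N])
    also have "\<dots> = ?e"
      unfolding Y1(2) X1(2)[symmetric] by (rule inverse_mult_vec[OF c1(1,2) X1']) simp
    finally have C1e: "C1 *\<^sub>v ?e = ?e" .
    have col0: "C1 $$ (i, 0) = (if i = 0 then 1 else 0)" if "i < ?N" for i
    proof -
      have "(C1 *\<^sub>v ?e) $ i = C1 $$ (i, 0)" using C1 that by (simp add: scalar_prod_right_unit)
      then show ?thesis using C1e that by simp
    qed
    define V where "V = mat 1 n (\<lambda>(i, j). C1 $$ (0, Suc j))"
    define C2 where "C2 = mat n n (\<lambda>(i, j). C1 $$ (Suc i, Suc j))"
    have VC2: "V \<in> carrier_mat 1 n" "C2 \<in> carrier_mat n n" by (simp_all add: V_def C2_def)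
    have C1_block: "C1 = four_block_mat (1\<^sub>m 1) V (0\<^sub>m n 1) C2"
      using C1 by (intro eq_matI) (auto simp: V_def C2_def col0)
    let ?Q = "four_block_mat (1\<^sub>m 1) (- V) (0\<^sub>m n 1) (1\<^sub>m n)" and ?Q' = "four_block_mat (1\<^sub>m 1) V (0\<^sub>m n 1) (1\<^sub>m n)"
    have VV: "- V + V = 0\<^sub>m 1 n" "V + - V = 0\<^sub>m 1 n" using VC2 by auto
    have z: "- 0\<^sub>m n n + 1\<^sub>m n = (1\<^sub>m n :: 'a mat)" "0\<^sub>m n n + 1\<^sub>m n = (1\<^sub>m n :: 'a mat)" by auto
    have Q: "inverse_mats ?N ?Q ?Q'"
      unfolding inverse_mats_def using VC2 four_block_one_mat[of 1 n, where 'a = 'a]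
      by (auto simp: mult_four_block_mat[of _ 1 1 _ n _ n _ _ 1 _ n] VV z simp del: four_block_one_mat)
    obtain X2 X2' Y2 Y2' r where IH: "inverse_mats n X2 X2'" "inverse_mats n Y2 Y2'" "r \<le> n" "X2 * C2 * Y2 = diag_idem n r"
      using Suc.IH[OF VC2(2)] by blast
    have c2: "X2 \<in> carrier_mat n n" "X2' \<in> carrier_mat n n" "Y2 \<in> carrier_mat n n" "Y2' \<in> carrier_mat n n"
      using IH(1,2) by (auto simp: inverse_mats_def)
    let ?D = "\<lambda>X. four_block_mat (1\<^sub>m 1) (0\<^sub>m 1 n) (0\<^sub>m n 1) X"
    have D_mult: "?D X * ?D Z = ?D (X * Z)" if "X \<in> carrier_mat n n" "Z \<in> carrier_mat n n" for X Z :: "'a mat"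
      using that by (auto simp: mult_four_block_mat[of _ 1 1 _ n _ n _ _ 1 _ n])
    have D_inv: "inverse_mats ?N (?D X) (?D X')" if "inverse_mats n X X'" for X X' :: "'a mat"
    proof -
      have c: "X \<in> carrier_mat n n" "X' \<in> carrier_mat n n" "X * X' = 1\<^sub>m n" "X' * X = 1\<^sub>m n"
        using that by (auto simp: inverse_mats_def)
      have "?D X * ?D X' = 1\<^sub>m ?N" "?D X' * ?D X = 1\<^sub>m ?N"
        unfolding D_mult[OF c(1,2)] D_mult[OF c(2,1)] c(3,4) by simp_all
      then show ?thesis using c(1,2) by (auto simp: inverse_mats_def)
    qed
    have "C1 * ?Q = ?D C2"
      unfolding C1_block using VC2 by (auto simp: mult_four_block_mat[of _ 1 1 _ n _ n _ _ 1 _ n] VV)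
    moreover have "?D X2 * ?D C2 * ?D Y2 = ?D (diag_idem n r)"
      using D_mult[of X2 C2] D_mult[of "X2 * C2" Y2] c2 VC2 IH(4) by simp
    moreover have "?D (diag_idem n r) = diag_idem ?N (Suc r)"
      by (rule eq_matI) (auto simp: diag_idem_def)
    moreover have "?D X2 * X1' * C * (Y1 * (?Q * ?D Y2)) = ?D X2 * (C1 * ?Q) * ?D Y2"
    proof -
      have "?D X2 \<in> carrier_mat ?N ?N" "?D Y2 \<in> carrier_mat ?N ?N" "?Q \<in> carrier_mat ?N ?N"
        using D_inv[OF IH(1)] D_inv[OF IH(2)] Q by (auto simp: inverse_mats_def)
      then show ?thesis
        unfolding C1_def using c1 C by (simp add: assoc_mult_mat[of _ ?N ?N _ ?N _ ?N])
    qed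
    ultimately have "?D X2 * X1' * C * (Y1 * (?Q * ?D Y2)) = diag_idem ?N (Suc r)" by simp
    moreover have "inverse_mats ?N (?D X2 * X1') (X1 * ?D X2')"
      by (rule inverse_mats_mult[OF D_inv[OF IH(1)] inverse_mats_sym[OF X1(1)]])
    moreover have "inverse_mats ?N (Y1 * (?Q * ?D Y2)) (?D Y2' * ?Q' * Y1')"
      by (rule inverse_mats_mult[OF Y1(1) inverse_mats_mult[OF Q D_inv[OF IH(2)]]])
    ultimately show ?thesis using IH(3) Suc_le_mono by blast
  qed
qed

text \<open>The matrix inside the transpose is the lower left block of \<open>J\<^sup>-\<^sup>1 u w\<close> for \<open>u\<close> the unipotent element given by \<open>S\<close> and
\<open>w\<close> the representative of rank \<open>r\<close>. On the kernel in question the coordinates from \<open>r\<close> on vanish, and the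
first \<open>r\<close> coordinates are killed by the upper left block of \<open>S\<close>.\<close>

lemma kernel_card_big_cell:
  fixes S :: "'a::{field,finite} mat"
  assumes S: "S \<in> sym_mats n" and r: "r \<le> n"
  shows "kernel_card (transpose_mat (- (1\<^sub>m n - diag_idem n r) + - (S * diag_idem n r))) = kernel_card (top_left r S)"
proof -
  have Sc: "S \<in> carrier_mat n n" using sym_mats_carrier[OF S] .
  let ?e = "diag_idem n r :: 'a mat"
  let ?M = "transpose_mat (- (1\<^sub>m n - ?e) + - (S * ?e))"
  have M: "?M \<in> carrier_mat n n" using Sc by (simp add: diag_idem_carrier)
  have Mi: "?M $$ (i, j) = - (if i < r then S $$ (i, j) else if i = j then 1 else 0)" if ij: "i < n" "j < n" for i j
  proof -
    have "(S * ?e) $$ (j, i) = (\<Sum>k<n. S $$ (j, k) * (if k = i \<and> k < r then 1 else 0))"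
      using ij Sc by (auto simp: diag_idem_def scalar_prod_def atLeast0LessThan)
    also have "\<dots> = (\<Sum>k<n. if k = i then (if i < r then S $$ (j, i) else 0) else 0)"
      by (intro sum.cong) auto
    also have "\<dots> = (if i < r then S $$ (j, i) else 0)" using ij by simp
    finally show ?thesis using ij Sc sym_mats_index[OF S, of j i] by (auto simp: diag_idem_def)
  qed
  let ?K = "{x \<in> carrier_vec n. ?M *\<^sub>v x = 0\<^sub>v n}" and ?L = "{y \<in> carrier_vec r. top_left r S *\<^sub>v y = 0\<^sub>v r}"
  let ?ext = "\<lambda>y. vec n (\<lambda>i. if i < r then y $ i else 0)"
  have Mx: "(?M *\<^sub>v x) $ i = - (if i < r then (\<Sum>k<n. S $$ (i, k) * x $ k) else x $ i)"
    if x: "x \<in> carrier_vec n" and i: "i < n" for x i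
  proof -
    have "(?M *\<^sub>v x) $ i = (\<Sum>k<n. ?M $$ (i, k) * x $ k)"
      using carrier_matD[OF M] carrier_vecD[OF x] i
      by (simp add: scalar_prod_def atLeast0LessThan del: index_transpose_mat)
    also have "\<dots> = (\<Sum>k<n. - (if i < r then S $$ (i, k) * x $ k else if i = k then x $ k else 0))"
      by (intro sum.cong) (auto simp: Mi i)
    also have "\<dots> = - (if i < r then (\<Sum>k<n. S $$ (i, k) * x $ k) else x $ i)"
      using i by (auto simp: sum_negf)
    finally show ?thesis .
  qed
  have Sy: "(top_left r S *\<^sub>v y) $ i = (\<Sum>k<n. S $$ (i, k) * ?ext y $ k)" if "y \<in> carrier_vec r" "i < r" for y i
  proof -
    have "(\<Sum>k<n. S $$ (i, k) * ?ext y $ k) = (\<Sum>k<r. S $$ (i, k) * y $ k)"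
      using r by (intro sum.mono_neutral_cong_right) auto
    then show ?thesis
      using that by (auto simp: top_left_def scalar_prod_def atLeast0LessThan intro!: sum.cong)
  qed
  have ext_mem: "?ext y \<in> ?K \<longleftrightarrow> y \<in> ?L" if y: "y \<in> carrier_vec r" for y
  proof -
    have "?ext y \<in> ?K \<longleftrightarrow> (\<forall>i<n. (?M *\<^sub>v ?ext y) $ i = 0)"
      using M by (auto simp: vec_eq_iff simp del: index_mult_mat_vec)
    also have "\<dots> \<longleftrightarrow> (\<forall>i<r. (top_left r S *\<^sub>v y) $ i = 0)"
      using r Sy[OF y] by (auto simp: Mx simp del: index_mult_mat_vec)
    also have "\<dots> \<longleftrightarrow> y \<in> ?L"
      using y by (auto simp: vec_eq_iff top_left_def simp del: index_mult_mat_vec)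
    finally show ?thesis .
  qed
  have K_ext: "?ext (vec r (\<lambda>i. x $ i)) = x" if x: "x \<in> ?K" for x
  proof (rule eq_vecI)
    fix i assume "i < dim_vec x"
    then have i: "i < n" using x by auto
    have "(?M *\<^sub>v x) $ i = 0" using x i by auto
    then show "?ext (vec r (\<lambda>i. x $ i)) $ i = x $ i" using Mx[of x i] x i by auto
  qed (use x in auto)
  have "bij_betw ?ext ?L ?K"
  proof (rule bij_betwI[where g = "\<lambda>x. vec r (\<lambda>i. x $ i)"])
    show "?ext \<in> ?L \<rightarrow> ?K" using ext_mem by blast
    show "(\<lambda>x. vec r (\<lambda>i. x $ i)) \<in> ?K \<rightarrow> ?L"
    proof
      fix x assume x: "x \<in> ?K"
      then show "vec r (\<lambda>i. x $ i) \<in> ?L"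
        using ext_mem[of "vec r (\<lambda>i. x $ i)"] K_ext[OF x] by (metis vec_carrier)
    qed
    show "vec r (\<lambda>i. ?ext y $ i) = y" if "y \<in> ?L" for y
      using that r by (intro eq_vecI) auto
  qed (use K_ext in auto)
  then have "card ?K = card ?L" by (simp add: bij_betw_same_card)
  moreover have "dim_row ?M = n" "dim_col ?M = n" "dim_row (top_left r S) = r" "dim_col (top_left r S) = r"
    using carrier_matD[OF M] by (simp_all add: top_left_def)
  ultimately show ?thesis
    unfolding kernel_card_def by (simp only:)
qed

lemma kernel_card_diag_idem:
  assumes r: "r \<le> n"
  shows "kernel_card (diag_idem n r :: 'a::{field,finite} mat) = CARD('a) ^ (n - r)"
proof -
  let ?e = "diag_idem n r :: 'a mat"
  let ?K = "{x \<in> carrier_vec n. ?e *\<^sub>v x = 0\<^sub>v n}"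
  have ex: "(?e *\<^sub>v x) $ i = (if i < r then x $ i else 0)" if "x \<in> carrier_vec n" "i < n" for x i
  proof -
    have "(?e *\<^sub>v x) $ i = (\<Sum>k<n. (if i = k \<and> i < r then 1 else 0) * x $ k)"
      using that by (simp add: diag_idem_def scalar_prod_def atLeast0LessThan)
    also have "\<dots> = (\<Sum>k<n. if k = i then (if i < r then x $ i else 0) else 0)"
      by (intro sum.cong) auto
    finally have "(?e *\<^sub>v x) $ i = (\<Sum>k<n. if k = i then (if i < r then x $ i else 0) else 0)" .
    then show ?thesis using that by simp
  qed
  have mem: "x \<in> ?K \<longleftrightarrow> x \<in> carrier_vec n \<and> (\<forall>i<r. x $ i = 0)" for x
    using r ex[of x] by (cases "x \<in> carrier_vec n") (auto simp: vec_eq_iff diag_idem_def simp del: index_mult_mat_vec)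
  have "bij_betw (\<lambda>x. vec (n - r) (\<lambda>i. x $ (r + i))) ?K (carrier_vec (n - r))"
  proof (rule bij_betwI[where g = "\<lambda>y. vec n (\<lambda>i. if i < r then 0 else y $ (i - r))"])
    show "(\<lambda>y. vec n (\<lambda>i. if i < r then 0 else y $ (i - r))) \<in> carrier_vec (n - r) \<rightarrow> ?K"
      using r by (intro Pi_I) (simp only: mem, auto)
    show "vec n (\<lambda>i. if i < r then 0 else vec (n - r) (\<lambda>i. x $ (r + i)) $ (i - r)) = x" if "x \<in> ?K" for x
      using that r unfolding mem by (intro eq_vecI) auto
  qed (use r in \<open>auto intro!: eq_vecI\<close>)
  then have "card ?K = card (carrier_vec (n - r) :: 'a vec set)"
    by (rule bij_betw_same_card)
  then show ?thesis
    unfolding kernel_card_def by (simp add: card_carrier_vec diag_idem_def)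
qed

section \<open>Similitudes and the Siegel parabolic\<close>

lemma smult_smult_mat: "a \<cdot>\<^sub>m (b \<cdot>\<^sub>m M) = (a * b :: 'a::semigroup_mult) \<cdot>\<^sub>m M"
  by (auto simp: mat_eq_iff mult.assoc)

lemma one_smult_mat_id: "(1 :: 'a::monoid_mult) \<cdot>\<^sub>m M = M"
  by (auto simp: mat_eq_iff)

lemma Jmat_carrier: "Jmat n \<in> carrier_mat (n + n) (n + n)"
  unfolding Jmat_def by simp

lemma Jinv_carrier: "Jinv n \<in> carrier_mat (n + n) (n + n)"
  unfolding Jinv_def by simp

definition similitude :: "nat \<Rightarrow> 'a::field \<Rightarrow> 'a mat \<Rightarrow> bool" where
  "similitude n l g \<longleftrightarrow> g \<in> carrier_mat (n + n) (n + n) \<and> transpose_mat g * Jmat n * g = l \<cdot>\<^sub>m Jmat n"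

lemma similitude_carrier: "similitude n l g \<Longrightarrow> g \<in> carrier_mat (n + n) (n + n)"
  by (simp add: similitude_def)

text \<open>The four blocks of \<open>g\<^sup>T J g = l J\<close>; the two off-diagonal ones are transposes of each other up to
sign, which leaves three conditions.\<close>

lemma similitude_four_block:
  fixes A :: "'a::field mat"
  assumes c: "A \<in> carrier_mat n n" "B \<in> carrier_mat n n" "C \<in> carrier_mat n n" "D \<in> carrier_mat n n"
  shows "similitude n l (four_block_mat A B C D) \<longleftrightarrow>
    transpose_mat A * C = transpose_mat C * A \<and> transpose_mat B * D = transpose_mat D * B \<and>
    transpose_mat A * D - transpose_mat C * B = l \<cdot>\<^sub>m 1\<^sub>m n"
proof -
  let ?T = transpose_mat
  let ?g = "four_block_mat A B C D"
  have J: "Jmat n * ?g = four_block_mat (- C) (- D) A B"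
    unfolding Jmat_def using c by (simp add: mult_four_block_mat[of _ n n _ n _ n _ _ n _ n])
  have "?T ?g * Jmat n * ?g = ?T ?g * (Jmat n * ?g)"
    using c Jmat_carrier by (intro assoc_mult_mat[of _ "n + n" "n + n" _ "n + n" _ "n + n"]) auto
  also have "\<dots> = four_block_mat (- (?T A * C) + ?T C * A) (- (?T A * D) + ?T C * B)
      (- (?T B * C) + ?T D * A) (- (?T B * D) + ?T D * B)"
    unfolding J using c by (simp add: transpose_four_block_mat[of _ n n _ n _ n] mult_four_block_mat[of _ n n _ n _ n _ _ n _ n])
  finally have lhs: "?T ?g * Jmat n * ?g = \<dots>" .
  have rhs: "l \<cdot>\<^sub>m Jmat n = four_block_mat (0\<^sub>m n n) (- (l \<cdot>\<^sub>m 1\<^sub>m n)) (l \<cdot>\<^sub>m 1\<^sub>m n) (0\<^sub>m n n)"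
    unfolding Jmat_def by (subst smult_four_block_mat[of _ n n _ n _ n]) (auto intro!: cong_four_block_mat)
  have e1: "- X + Y = 0\<^sub>m n n \<longleftrightarrow> X = Y" "- X + Y = - Z \<longleftrightarrow> X - Y = Z" "- X + Y = Z \<longleftrightarrow> Y - X = Z"
    if "X \<in> carrier_mat n n" "Y \<in> carrier_mat n n" "Z \<in> carrier_mat n n" for X Y Z :: "'a mat"
    using that by (auto simp: mat_eq_iff algebra_simps eq_neg_iff_add_eq_0)
  have tr: "?T (?T A * D - ?T C * B) = ?T D * A - ?T B * C"
    using c by (simp add: transpose_minus[of _ n n] transpose_mult[of _ n n _ n])
  have tl: "?T (l \<cdot>\<^sub>m 1\<^sub>m n) = (l \<cdot>\<^sub>m 1\<^sub>m n :: 'a mat)" by (auto simp: mat_eq_iff)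
  have "similitude n l ?g \<longleftrightarrow> - (?T A * C) + ?T C * A = 0\<^sub>m n n \<and> - (?T A * D) + ?T C * B = - (l \<cdot>\<^sub>m 1\<^sub>m n) \<and>
      - (?T B * C) + ?T D * A = l \<cdot>\<^sub>m 1\<^sub>m n \<and> - (?T B * D) + ?T D * B = 0\<^sub>m n n"
    unfolding similitude_def lhs rhs using c by (subst four_block_mat_eq_iff[of _ n n _ n _ n]) auto
  also have "\<dots> \<longleftrightarrow> ?T A * C = ?T C * A \<and> ?T A * D - ?T C * B = l \<cdot>\<^sub>m 1\<^sub>m n \<and>
      ?T D * A - ?T B * C = l \<cdot>\<^sub>m 1\<^sub>m n \<and> ?T B * D = ?T D * B"
    by (intro arg_cong2[of _ _ _ _ "(\<and>)"] e1) (use c in auto)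
  also have "\<dots> \<longleftrightarrow> ?T A * C = ?T C * A \<and> ?T B * D = ?T D * B \<and> ?T A * D - ?T C * B = l \<cdot>\<^sub>m 1\<^sub>m n"
    using tr tl by metis
  finally show ?thesis .
qed

lemma similitude_mult:
  fixes g :: "'a::field mat"
  assumes "similitude n l g" "similitude n m h"
  shows "similitude n (l * m) (g * h)"
proof -
  have c: "g \<in> carrier_mat (n + n) (n + n)" "h \<in> carrier_mat (n + n) (n + n)"
    "(Jmat n :: 'a mat) \<in> carrier_mat (n + n) (n + n)"
    using assms Jmat_carrier by (auto simp: similitude_def)
  have "transpose_mat (g * h) * Jmat n * (g * h) = transpose_mat h * (transpose_mat g * Jmat n * g) * h"
    using c by (simp add: transpose_mult[of _ "n + n" "n + n" _ "n + n"]
        assoc_mult_mat[of _ "n + n" "n + n" _ "n + n" _ "n + n"])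
  also have "transpose_mat g * Jmat n * g = l \<cdot>\<^sub>m Jmat n" using assms(1) by (simp add: similitude_def)
  also have "transpose_mat h * (l \<cdot>\<^sub>m Jmat n) * h = l \<cdot>\<^sub>m (transpose_mat h * Jmat n * h)"
    using c by (simp add: mult_smult_distrib[of _ "n + n" "n + n"] mult_smult_assoc_mat[of _ "n + n" "n + n"])
  also have "\<dots> = (l * m) \<cdot>\<^sub>m Jmat n"
    using assms(2) by (simp add: similitude_def smult_smult_mat one_smult_mat_id)
  finally show ?thesis using c by (simp add: similitude_def)
qed

lemma similitude_inverse:
  fixes g :: "'a::field mat"
  assumes g: "similitude n l g" and l: "l \<noteq> 0"
  shows "\<exists>h. similitude n (inverse l) h \<and> g * h = 1\<^sub>m (n + n) \<and> h * g = 1\<^sub>m (n + n)"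
proof -
  let ?N = "n + n" and ?J = "Jmat n :: 'a mat" and ?T = transpose_mat
  have c: "g \<in> carrier_mat ?N ?N" "?J \<in> carrier_mat ?N ?N" "(Jinv n :: 'a mat) \<in> carrier_mat ?N ?N"
    and eq: "?T g * ?J * g = l \<cdot>\<^sub>m ?J"
    using g Jmat_carrier Jinv_carrier by (auto simp: similitude_def)
  define h where "h = inverse l \<cdot>\<^sub>m (Jinv n * (?T g * ?J))"
  have h: "h \<in> carrier_mat ?N ?N" using c by (simp add: h_def)
  have "h * g = inverse l \<cdot>\<^sub>m (Jinv n * (?T g * ?J * g))"
    unfolding h_def using c by (simp add: mult_smult_assoc_mat[of _ ?N ?N] assoc_mult_mat[of _ ?N ?N _ ?N _ ?N])
  also have "\<dots> = 1\<^sub>m ?N"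
    unfolding eq using l c by (simp add: mult_smult_distrib[of _ ?N ?N] Jinv_is_inverse smult_smult_mat one_smult_mat_id)
  finally have hg: "h * g = 1\<^sub>m ?N" .
  then have gh: "g * h = 1\<^sub>m ?N" using mat_mult_left_right_inverse[OF h c(1)] by simp
  have "l \<cdot>\<^sub>m (?T h * ?J * h) = ?T h * (l \<cdot>\<^sub>m ?J) * h"
    using h c by (simp add: mult_smult_distrib[of _ ?N ?N] mult_smult_assoc_mat[of _ ?N ?N])
  also have "\<dots> = ?T (g * h) * ?J * (g * h)"
    unfolding eq[symmetric] using c h
    by (simp add: transpose_mult[of _ ?N ?N _ ?N] assoc_mult_mat[of _ ?N ?N _ ?N _ ?N])
  also have "\<dots> = ?J" unfolding gh using c by simp
  finally have "?T h * ?J * h = inverse l \<cdot>\<^sub>m ?J"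
    using l by (metis (no_types) left_inverse one_smult_mat_id smult_smult_mat one_smult_mat_id)
  then show ?thesis using h hg gh by (auto simp: similitude_def)
qed

lemma similitude_invertible: "similitude n l g \<Longrightarrow> l \<noteq> 0 \<Longrightarrow> invertible_mat g"
  using similitude_inverse[of n l g] similitude_carrier[of n l g]
  unfolding invertible_mat_def inverts_mat_def by (metis carrier_matD similitude_carrier square_mat.simps)

lemma GSp_iff: "g \<in> GSp n \<longleftrightarrow> (\<exists>l. l \<noteq> 0 \<and> similitude n l g)"
  using similitude_invertible unfolding GSp_def similitude_def mult_2 by blast

lemma Sp_iff: "g \<in> Sp n \<longleftrightarrow> similitude n 1 g"
  using similitude_invertible[of n 1 g] unfolding Sp_def similitude_def mult_2 by auto

lemma similitude_unique:
  assumes "n \<ge> 1" "similitude n l g" "similitude n m g"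
  shows "l = m"
proof -
  have "l \<cdot>\<^sub>m Jmat n = m \<cdot>\<^sub>m Jmat n" using assms by (simp add: similitude_def)
  then have "(l \<cdot>\<^sub>m Jmat n) $$ (n, 0) = (m \<cdot>\<^sub>m Jmat n) $$ (n, 0)" by simp
  then show ?thesis using assms(1) by (simp add: Jmat_def)
qed

text \<open>The similitude factor, unique when \<open>n \<ge> 1\<close>.\<close>

definition multiplier :: "nat \<Rightarrow> 'a::field mat \<Rightarrow> 'a" where
  "multiplier n g = (THE l. similitude n l g)"

lemma multiplier_eq: "n \<ge> 1 \<Longrightarrow> similitude n l g \<Longrightarrow> multiplier n g = l"
  unfolding multiplier_def using similitude_unique by (intro the_equality) blast+

lemma similitude_levi:
  fixes X :: "'a::field mat"
  assumes "inverse_mats n X X'"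
  shows "similitude n 1 (four_block_mat X (0\<^sub>m n n) (0\<^sub>m n n) (transpose_mat X'))"
    "similitude n 1 (four_block_mat (transpose_mat X') (0\<^sub>m n n) (0\<^sub>m n n) X)"
proof -
  have c: "X \<in> carrier_mat n n" "X' \<in> carrier_mat n n" "X * X' = 1\<^sub>m n" "X' * X = 1\<^sub>m n"
    using assms by (auto simp: inverse_mats_def)
  have "transpose_mat X * transpose_mat X' = 1\<^sub>m n"
    using c by (simp add: transpose_mult[of _ n n _ n, symmetric])
  moreover have z: "1\<^sub>m n - 0\<^sub>m n n = 1 \<cdot>\<^sub>m (1\<^sub>m n :: 'a mat)" by (auto simp: mat_eq_iff)
  ultimately show "similitude n 1 (four_block_mat X (0\<^sub>m n n) (0\<^sub>m n n) (transpose_mat X'))"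
    "similitude n 1 (four_block_mat (transpose_mat X') (0\<^sub>m n n) (0\<^sub>m n n) X)"
    using c z by (simp_all add: similitude_four_block)
qed

definition unipotent :: "nat \<Rightarrow> 'a::field mat \<Rightarrow> 'a mat" where
  "unipotent n S = four_block_mat (1\<^sub>m n) S (0\<^sub>m n n) (1\<^sub>m n)"

lemma similitude_unipotent_iff:
  "S \<in> carrier_mat n n \<Longrightarrow> similitude n 1 (unipotent n S) \<longleftrightarrow> S \<in> sym_mats n"
  unfolding unipotent_def by (auto simp: similitude_four_block sym_mats_def)

text \<open>With \<open>e\<close> the idempotent of rank \<open>r\<close> and \<open>f = 1 - e\<close> this is the partial Weyl element that is
the identity on the \<open>f\<close> coordinates and the standard symplectic rotation on the \<open>e\<close> coordinates.\<close>

definition coset_rep :: "nat \<Rightarrow> nat \<Rightarrow> 'a::field mat" where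
  "coset_rep n r = four_block_mat (1\<^sub>m n - diag_idem n r) (- diag_idem n r) (diag_idem n r) (1\<^sub>m n - diag_idem n r)"

lemma diag_idem_algebra:
  fixes n r :: nat
  defines "e \<equiv> diag_idem n r :: 'a::field mat"
  defines "f \<equiv> 1\<^sub>m n - e"
  shows "e \<in> carrier_mat n n" "f \<in> carrier_mat n n" "transpose_mat e = e" "transpose_mat f = f"
    "e * e = e" "f * f = f" "e * f = 0\<^sub>m n n" "f * e = 0\<^sub>m n n" "e + f = 1\<^sub>m n"
proof -
  show c: "e \<in> carrier_mat n n" "f \<in> carrier_mat n n" unfolding f_def e_def by (auto intro!: minus_carrier_mat diag_idem_carrier)
  show te: "transpose_mat e = e" by (rule eq_matI) (auto simp: e_def diag_idem_def)
  show "transpose_mat f = f" using te c(1) by (simp add: f_def transpose_minus[of _ n n])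
  show ee: "e * e = e"
  proof (rule eq_matI)
    fix i j assume "i < dim_row e" "j < dim_col e"
    then have ij: "i < n" "j < n" using c by auto
    have "(e * e) $$ (i, j) = (\<Sum>k<n. (if i = k \<and> i < r then 1 else 0) * (if k = j \<and> k < r then 1 else 0))"
      using ij by (simp add: e_def diag_idem_def scalar_prod_def atLeast0LessThan)
    also have "\<dots> = (\<Sum>k<n. if k = i then (if i = j \<and> i < r then 1 else 0) else 0)"
      by (intro sum.cong) auto
    finally show "(e * e) $$ (i, j) = e $$ (i, j)" using ij by (simp add: e_def diag_idem_def)
  qed (use c in auto)
  show "e * f = 0\<^sub>m n n" "f * e = 0\<^sub>m n n"
    using c(1) ee by (simp_all add: f_def mult_minus_distrib_mat[of _ n n _ n] minus_mult_distrib_mat[of _ n n _ _ n] minus_r_inv_mat)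
  then show "f * f = f"
    using c by (subst (1) f_def) (auto simp: minus_mult_distrib_mat[of _ n n _ _ n] mat_eq_iff)
  show "e + f = 1\<^sub>m n" using c(1) by (auto simp: f_def mat_eq_iff)
qed

lemma similitude_coset_rep: "similitude n 1 (coset_rep n r :: 'a::field mat)"
proof -
  let ?e = "diag_idem n r :: 'a mat" and ?f = "1\<^sub>m n - diag_idem n r :: 'a mat"
  note D = diag_idem_algebra[of n r, where 'a = 'a]
  have "- ?e * ?f = - (?e * ?f)" "?f * - ?e = - (?f * ?e)" "?e * - ?e = - (?e * ?e)"
    using D(1,2) by simp_all
  moreover have "- 0\<^sub>m n n = (0\<^sub>m n n :: 'a mat)" by (auto simp: mat_eq_iff)
  ultimately have m: "- ?e * ?f = 0\<^sub>m n n" "?f * - ?e = 0\<^sub>m n n" "?e * - ?e = - ?e"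
    unfolding D(5,7,8) by simp_all
  have one: "?f - - ?e = 1 \<cdot>\<^sub>m 1\<^sub>m n"
    using D(1,2) by (auto simp: mat_eq_iff)
  show ?thesis
    unfolding coset_rep_def similitude_four_block[OF D(2) uminus_carrier_mat[OF D(1)] D(1,2)]
      transpose_uminus D(3,4,6,7,8) m one by simp
qed

lemma similitude_Jinv: "similitude n 1 (Jinv n :: 'a::field mat)"
proof -
  have "transpose_mat (- 1\<^sub>m n) = (- 1\<^sub>m n :: 'a mat)" by (auto simp: mat_eq_iff)
  moreover have "0\<^sub>m n n - - 1\<^sub>m n = (1\<^sub>m n :: 'a mat)" by (auto simp: mat_eq_iff)
  ultimately show ?thesis
    unfolding Jinv_def by (subst similitude_four_block) auto
qed

text \<open>Both groups are treated at once: they contain all similitudes of factor \<open>1\<close> and are closed under products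
and inverses.\<close>

locale symplectic_group =
  fixes n :: nat and G :: "'a::{field,finite} mat set"
  assumes n_pos: "n \<ge> 1" and G_cases: "G = GSp n \<or> G = Sp n"
begin

abbreviation "P \<equiv> siegel_P n G"

lemma G_similitude: "g \<in> G \<Longrightarrow> \<exists>l. l \<noteq> 0 \<and> similitude n l g"
  using G_cases GSp_iff Sp_iff by (metis zero_neq_one)

lemma in_G: "similitude n 1 g \<Longrightarrow> g \<in> G"
  using G_cases GSp_iff[of g n] Sp_iff[of g n] by (metis one_neq_zero)

lemma G_carrier: "g \<in> G \<Longrightarrow> g \<in> carrier_mat (n + n) (n + n)"
  using G_similitude similitude_carrier by blast

lemma finite_G: "finite G"
  by (rule finite_subset[of _ "carrier_mat (n + n) (n + n)"]) (use G_carrier in auto)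

lemma similitude_multiplier: "g \<in> G \<Longrightarrow> similitude n (multiplier n g) g"
  using G_similitude multiplier_eq[OF n_pos] by blast

lemma multiplier_nonzero: "g \<in> G \<Longrightarrow> multiplier n g \<noteq> 0"
  using G_similitude multiplier_eq[OF n_pos] by blast

lemma G_mult: "g \<in> G \<Longrightarrow> h \<in> G \<Longrightarrow> g * h \<in> G"
  using G_cases similitude_mult[of n _ g _ h] unfolding GSp_iff[abs_def]
  by (metis GSp_iff Sp_iff mult_1 no_zero_divisors)

lemma multiplier_mult: "g \<in> G \<Longrightarrow> h \<in> G \<Longrightarrow> multiplier n (g * h) = multiplier n g * multiplier n h"
  by (intro multiplier_eq[OF n_pos] similitude_mult similitude_multiplier)

lemma G_inverse: "g \<in> G \<Longrightarrow> \<exists>h\<in>G. g * h = 1\<^sub>m (n + n) \<and> h * g = 1\<^sub>m (n + n)"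
proof -
  assume g: "g \<in> G"
  show ?thesis
  proof (cases "G = Sp n")
    case True
    then have "similitude n 1 g" using g Sp_iff by blast
    from similitude_inverse[OF this] show ?thesis using True Sp_iff by (metis inverse_1 one_neq_zero)
  next
    case False
    then have "G = GSp n" using G_cases by simp
    then show ?thesis
      using similitude_inverse[OF similitude_multiplier[OF g] multiplier_nonzero[OF g]] multiplier_nonzero[OF g]
      by (metis GSp_iff inverse_nonzero_iff_nonzero)
  qed
qed

lemma G_assoc: "g \<in> G \<Longrightarrow> h \<in> G \<Longrightarrow> k \<in> G \<Longrightarrow> g * h * k = g * (h * k)"
  using G_carrier by (intro assoc_mult_mat[of _ "n + n" "n + n" _ "n + n" _ "n + n"]) auto

lemma G_one_mult: "g \<in> G \<Longrightarrow> 1\<^sub>m (n + n) * g = g" "g \<in> G \<Longrightarrow> g * 1\<^sub>m (n + n) = g"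
  by (auto dest: G_carrier)

lemma Jinv_in_G: "Jinv n \<in> G"
  by (intro in_G similitude_Jinv)

lemma P_in_G: "p \<in> P \<Longrightarrow> p \<in> G"
  by (simp add: siegel_P_def)

lemma P_I:
  "four_block_mat A B (0\<^sub>m n n) D \<in> G \<Longrightarrow> A \<in> carrier_mat n n \<Longrightarrow> B \<in> carrier_mat n n \<Longrightarrow> D \<in> carrier_mat n n
    \<Longrightarrow> four_block_mat A B (0\<^sub>m n n) D \<in> P"
  unfolding siegel_P_def by blast

text \<open>The diagonal blocks of an element of \<open>P\<close> determine each other up to the similitude factor.\<close>

lemma P_obtain:
  assumes "p \<in> P"
  obtains A B D where "A \<in> carrier_mat n n" "B \<in> carrier_mat n n" "D \<in> carrier_mat n n"
    "p = four_block_mat A B (0\<^sub>m n n) D"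
    "transpose_mat A * D = multiplier n p \<cdot>\<^sub>m 1\<^sub>m n"
    "inverse_mats n (transpose_mat A) (inverse (multiplier n p) \<cdot>\<^sub>m D)"
    "inverse_mats n D (inverse (multiplier n p) \<cdot>\<^sub>m transpose_mat A)"
proof -
  let ?l = "multiplier n p"
  obtain A B D where c: "A \<in> carrier_mat n n" "B \<in> carrier_mat n n" "D \<in> carrier_mat n n"
    and p: "p = four_block_mat A B (0\<^sub>m n n) D"
    using assms unfolding siegel_P_def by blast
  have "similitude n ?l (four_block_mat A B (0\<^sub>m n n) D)"
    using similitude_multiplier[OF P_in_G[OF assms]] p by simp
  then have "transpose_mat A * D - 0\<^sub>m n n * B = ?l \<cdot>\<^sub>m 1\<^sub>m n"
    using c by (simp add: similitude_four_block)
  moreover have "transpose_mat A * D - 0\<^sub>m n n * B = transpose_mat A * D" using c by (auto simp: mat_eq_iff)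
  ultimately have AD: "transpose_mat A * D = ?l \<cdot>\<^sub>m 1\<^sub>m n" by simp
  have l: "?l \<noteq> 0" using multiplier_nonzero[OF P_in_G[OF assms]] .
  have 1: "transpose_mat A * (inverse ?l \<cdot>\<^sub>m D) = 1\<^sub>m n"
    using c AD l by (simp add: mult_smult_distrib[of _ n n] smult_smult_mat one_smult_mat_id)
  have 2: "inverse ?l \<cdot>\<^sub>m transpose_mat A * D = 1\<^sub>m n"
    using c AD l by (simp add: mult_smult_assoc_mat[of _ n n] smult_smult_mat one_smult_mat_id)
  have "inverse_mats n (transpose_mat A) (inverse ?l \<cdot>\<^sub>m D)"
    using 1 mat_mult_left_right_inverse[OF _ _ 1] c by (simp add: inverse_mats_def)
  moreover have "inverse_mats n D (inverse ?l \<cdot>\<^sub>m transpose_mat A)"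
    using 2 mat_mult_left_right_inverse[OF _ _ 2] c by (simp add: inverse_mats_def)
  ultimately show ?thesis using that c p AD by blast
qed

lemma siegel_m_eq_multiplier:
  assumes "p \<in> P"
  shows "siegel_m n p = multiplier n p"
proof -
  let ?l = "multiplier n p"
  obtain A B D where b: "A \<in> carrier_mat n n" "B \<in> carrier_mat n n" "D \<in> carrier_mat n n"
    "p = four_block_mat A B (0\<^sub>m n n) D" "inverse_mats n (transpose_mat A) (inverse ?l \<cdot>\<^sub>m D)"
    using P_obtain[OF assms] by metis
  have l: "?l \<noteq> 0" using multiplier_nonzero[OF P_in_G[OF assms]] .
  have "inverse ?l \<cdot>\<^sub>m D * transpose_mat A = 1\<^sub>m n" using b(5) by (simp add: inverse_mats_def)
  moreover have "transpose_mat (inverse ?l \<cdot>\<^sub>m A) = inverse ?l \<cdot>\<^sub>m transpose_mat A"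
    by (auto simp: mat_eq_iff)
  ultimately have "D * transpose_mat (inverse ?l \<cdot>\<^sub>m A) = 1\<^sub>m n"
    using b(1,3) by (simp add: mult_smult_distrib[of _ n n] mult_smult_assoc_mat[of _ n n])
  from siegel_m_eq[OF n_pos _ b(2,3) this, of ?l] b(1) l show ?thesis
    unfolding b(4) by (simp add: smult_smult_mat one_smult_mat_id)
qed

lemma chi_det_nonzero:
  assumes "p \<in> P"
  shows "chi_det n p \<noteq> 0"
proof -
  obtain A B D where b: "A \<in> carrier_mat n n" "B \<in> carrier_mat n n" "D \<in> carrier_mat n n"
    "p = four_block_mat A B (0\<^sub>m n n) D" "inverse_mats n D (inverse (multiplier n p) \<cdot>\<^sub>m transpose_mat A)"
    using P_obtain[OF assms] by metis
  let ?E = "inverse (multiplier n p) \<cdot>\<^sub>m transpose_mat A"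
  have "det D * det ?E = det (D * ?E)"
    using b(1,3) by (intro det_mult[symmetric]) auto
  also have "\<dots> = 1" using b(5) by (simp add: inverse_mats_def)
  finally have "det D * det ?E = 1" .
  then have "det D \<noteq> 0" by auto
  moreover have "chi_det n p = inverse (det D)"
    using b(1-4) by (simp add: chi_det_def split_block_def Let_def) (auto intro!: arg_cong[of _ _ det])
  ultimately show ?thesis by simp
qed

lemma P_mult: assumes "p \<in> P" "p' \<in> P" shows "p * p' \<in> P"
proof -
  obtain A B D where b: "A \<in> carrier_mat n n" "B \<in> carrier_mat n n" "D \<in> carrier_mat n n"
    "p = four_block_mat A B (0\<^sub>m n n) D" using P_obtain[OF assms(1)] by metis
  obtain A' B' D' where b': "A' \<in> carrier_mat n n" "B' \<in> carrier_mat n n" "D' \<in> carrier_mat n n"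
    "p' = four_block_mat A' B' (0\<^sub>m n n) D'" using P_obtain[OF assms(2)] by metis
  have "p * p' = four_block_mat (A * A') (A * B' + B * D') (0\<^sub>m n n) (D * D')"
    unfolding b(4) b'(4) using b(1-3) b'(1-3) by (simp add: mult_four_block_mat[of _ n n _ n _ n _ _ n _ n])
  then show ?thesis
    using G_mult[OF P_in_G[OF assms(1)] P_in_G[OF assms(2)]] P_I b(1-3) b'(1-3) by simp
qed

text \<open>An upper unitriangular block matrix is a similitude exactly if its upper right block is symmetric.\<close>

lemma siegel_U_eq: "siegel_U n G = unipotent n ` sym_mats n"
proof (intro equalityI subsetI)
  fix u assume u: "u \<in> siegel_U n G"
  then obtain B where B: "B \<in> carrier_mat n n" "u = unipotent n B"
    unfolding siegel_U_def unipotent_def by auto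
  have "u \<in> G" using u by (simp add: siegel_U_def)
  then obtain l where l: "similitude n l u" using G_similitude by blast
  have "transpose_mat B * 1\<^sub>m n = transpose_mat (1\<^sub>m n) * B"
    using similitude_four_block[OF one_carrier_mat B(1) zero_carrier_mat one_carrier_mat] l
    unfolding B(2) unipotent_def by blast
  then have "transpose_mat B = B" using B(1) by simp
  then show "u \<in> unipotent n ` sym_mats n" using B by (auto simp: sym_mats_def)
next
  fix u :: "'a mat" assume "u \<in> unipotent n ` sym_mats n"
  then obtain S :: "'a mat" where S: "S \<in> sym_mats n" "u = unipotent n S" by auto
  have c: "S \<in> carrier_mat n n" using sym_mats_carrier[OF S(1)] .
  have "u \<in> G" unfolding S(2) using similitude_unipotent_iff[OF c] S(1) in_G by simp
  with S(2) c show "u \<in> siegel_U n G"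
    unfolding siegel_U_def unipotent_def by blast
qed

lemma inj_unipotent: "inj_on (unipotent n) (sym_mats n :: 'a mat set)"
proof (rule inj_onI)
  fix S T :: "'a mat" assume "S \<in> sym_mats n" "T \<in> sym_mats n" "unipotent n S = unipotent n T"
  then show "S = T"
    using four_block_mat_eq_iff[of "1\<^sub>m n" n n S n "0\<^sub>m n n" n "1\<^sub>m n" "1\<^sub>m n" T "0\<^sub>m n n" "1\<^sub>m n"]
    by (simp add: unipotent_def sym_mats_carrier)
qed

lemma U_in_P: "u \<in> siegel_U n G \<Longrightarrow> u \<in> P"
  unfolding siegel_U_def siegel_P_def using one_carrier_mat[of n] by blast

lemma levi_in_P:
  assumes "inverse_mats n X X'"
  shows "four_block_mat X (0\<^sub>m n n) (0\<^sub>m n n) (transpose_mat X') \<in> P"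
    "four_block_mat (transpose_mat X') (0\<^sub>m n n) (0\<^sub>m n n) X \<in> P"
  using similitude_levi[OF assms] in_G assms by (auto intro!: P_I simp: inverse_mats_def)

text \<open>The lower left block is brought to the normal form \<open>e\<close> by Levi elements. The similitude condition then
makes \<open>e A\<close> symmetric, so that a unipotent element clears everything of the upper left
block \<open>A\<close> but \<open>f A f\<close>, where \<open>f = 1 - e\<close>; since \<open>g\<close> is invertible, \<open>M = f A f + e\<close> is invertible, and the Levi element
given by \<open>M\<close> normalizes the first block column to that of the representative. Two elements of the group with
the same first block column differ by right multiplication with an element of \<open>P\<close>.\<close>

lemma double_coset:
  assumes g: "g \<in> G"
  shows "\<exists>r p p' p''. r \<le> n \<and> p \<in> P \<and> p' \<in> P \<and> p'' \<in> P \<and> p * g * p' = coset_rep n r * p''"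
proof -
  let ?T = transpose_mat
  obtain A B C D where b: "A \<in> carrier_mat n n" "B \<in> carrier_mat n n" "C \<in> carrier_mat n n" "D \<in> carrier_mat n n"
    "g = four_block_mat A B C D"
    using four_block_mat_obtain[OF G_carrier[OF g]] by metis
  obtain X X' Y Y' r where nf: "inverse_mats n X X'" "inverse_mats n Y Y'" "r \<le> n" "X * C * Y = diag_idem n r"
    using rank_normal_form[OF b(3)] by blast
  define e where "e = (diag_idem n r :: 'a mat)"
  define f where "f = 1\<^sub>m n - e"
  note alg = diag_idem_algebra[of n r, where 'a = 'a, folded e_def, folded f_def]
  note e = alg(1) and f = alg(2)
  let ?p1 = "four_block_mat (?T X') (0\<^sub>m n n) (0\<^sub>m n n) X" and ?q = "four_block_mat Y (0\<^sub>m n n) (0\<^sub>m n n) (?T Y')"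
  have p1: "?p1 \<in> P" and q: "?q \<in> P" using levi_in_P nf(1,2) by auto
  have XY: "X \<in> carrier_mat n n" "X' \<in> carrier_mat n n" "Y \<in> carrier_mat n n" "Y' \<in> carrier_mat n n"
    using nf(1,2) by (auto simp: inverse_mats_def)
  define A1 where "A1 = ?T X' * A * Y"
  define B1 where "B1 = ?T X' * B * ?T Y'"
  define D1 where "D1 = X * D * ?T Y'"
  have c1: "A1 \<in> carrier_mat n n" "B1 \<in> carrier_mat n n" "D1 \<in> carrier_mat n n"
    using XY b by (auto simp: A1_def B1_def D1_def)
  have g1: "?p1 * g * ?q = four_block_mat A1 B1 e D1"
    unfolding b(5) A1_def B1_def D1_def e_def nf(4)[symmetric] using XY b
    by (simp add: mult_four_block_mat[of _ n n _ n _ n _ _ n _ n])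
  have g1G: "four_block_mat A1 B1 e D1 \<in> G"
    unfolding g1[symmetric] using G_mult P_in_G p1 q g by blast
  obtain l1 where "similitude n l1 (four_block_mat A1 B1 e D1)" using G_similitude[OF g1G] by blast
  then have A1e: "?T A1 * e = e * A1"
    using c1 e alg(3) by (simp add: similitude_four_block)
  note asc = assoc_mult_mat[of _ n n _ n _ n]
  \<comment> \<open>Symmetry of \<open>e A1\<close> kills the block that left multiplication by unipotent elements cannot reach.\<close>
  have eA1f: "e * A1 * f = 0\<^sub>m n n"
    unfolding A1e[symmetric] using c1 e f alg(7) by (simp add: asc)
  have A1_e: "A1 * e = e * A1 * e + f * A1 * e"
  proof -
    have "A1 * e = (e + f) * (A1 * e)" using alg(9) c1 e by simp
    then show ?thesis using c1 e f by (simp add: add_mult_distrib_mat[of _ n n _ _ n] asc)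
  qed
  \<comment> \<open>The last summand only makes \<open>S\<close> symmetric; it disappears in \<open>S * e\<close>.\<close>
  define S where "S = - (e * A1 * e + f * A1 * e + ?T (f * A1 * e))"
  have Sc: "S \<in> carrier_mat n n" using c1 e f by (simp add: S_def)
  have eAe: "?T (e * A1 * e) = e * A1 * e"
  proof -
    have "?T (e * A1 * e) = e * (?T A1 * e)" using c1 e alg(3) by (simp add: transpose_mult[of _ n n _ n])
    also have "\<dots> = e * e * A1" unfolding A1e using c1 e by (simp add: asc)
    also have "\<dots> = ?T A1 * e * e" unfolding alg(5) A1e[symmetric] using c1 e alg(5) by (simp add: asc)
    also have "\<dots> = e * A1 * e" unfolding A1e ..
    finally show ?thesis .
  qed
  have S: "S \<in> sym_mats n"
  proof -
    have "?T S = - (e * A1 * e + ?T (f * A1 * e) + f * A1 * e)"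
      unfolding S_def using c1 e f eAe
      by (simp add: transpose_uminus transpose_add[of _ n n])
    also have "\<dots> = S"
      unfolding S_def using c1 e f by (auto simp: mat_eq_iff algebra_simps)
    finally show ?thesis using Sc by (simp add: sym_mats_def)
  qed
  have "?T (f * A1 * e) * e = 0\<^sub>m n n"
  proof -
    have "?T (f * A1 * e) * e = e * (?T A1 * (f * e))"
      using c1 e f alg(3,4) by (simp add: transpose_mult[of _ n n _ n] asc)
    also have "f * e = 0\<^sub>m n n" by (rule alg(8))
    finally show ?thesis using c1 e by simp
  qed
  moreover have "(e * A1 * e) * e = e * A1 * e" "(f * A1 * e) * e = f * A1 * e"
    using c1 e f alg(5) by (simp_all add: asc)
  ultimately have Se: "S * e = - (e * A1 * e + f * A1 * e)"
    unfolding S_def using c1 e f by (simp add: add_mult_distrib_mat[of _ n n _ _ n])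
  define A2 where "A2 = A1 + S * e"
  have A2c: "A2 \<in> carrier_mat n n" using c1 Sc e by (simp add: A2_def)
  have A1_split: "A1 = A1 * e + f * A1 * f"
  proof -
    have "A1 = A1 * (e + f)" using alg(9) c1 by simp
    also have "\<dots> = A1 * e + A1 * f" using c1 e f by (intro mult_add_distrib_mat)
    also have "\<dots> = A1 * e + (e + f) * A1 * f" unfolding alg(9) using c1 by simp
    also have "(e + f) * A1 * f = e * A1 * f + f * A1 * f" using c1 e f by (simp add: add_mult_distrib_mat[of _ n n _ _ n])
    also have "\<dots> = f * A1 * f" unfolding eA1f using c1 f by simp
    finally show ?thesis .
  qed
  have A2: "A2 = f * A1 * f"
  proof -
    have "A2 = (A1 * e + f * A1 * f) + - (A1 * e)"
      unfolding A2_def Se A1_e[symmetric] using A1_split by simp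
    also have "\<dots> = f * A1 * f" using c1 e f by (auto simp: mat_eq_iff)
    finally show ?thesis .
  qed
  define B2 where "B2 = B1 + S * D1"
  have B2: "B2 \<in> carrier_mat n n" using c1 Sc by (simp add: B2_def)
  have u: "unipotent n S \<in> P" using U_in_P siegel_U_eq S by blast
  have g2: "unipotent n S * four_block_mat A1 B1 e D1 = four_block_mat A2 B2 e D1"
    unfolding unipotent_def A2_def B2_def using Sc c1 e by (simp add: mult_four_block_mat[of _ n n _ n _ n _ _ n _ n])
  have g2G: "four_block_mat A2 B2 e D1 \<in> G"
    unfolding g2[symmetric] using G_mult P_in_G u g1G by blast
  obtain l where l: "l \<noteq> 0" "similitude n l (four_block_mat A2 B2 e D1)" using G_similitude[OF g2G] by blast
  have full: "?T A2 * D1 - e * B2 = l \<cdot>\<^sub>m 1\<^sub>m n"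
    using l(2) A2c B2 e c1 alg(3) by (simp add: similitude_four_block)
  define M where "M = A2 + e"
  have Mc: "M \<in> carrier_mat n n" using A2c e by (simp add: M_def)
  have fA2: "A2 * f = A2" "e * A2 = 0\<^sub>m n n"
  proof -
    have "A2 * f = f * A1 * (f * f)" "e * A2 = e * f * A1 * f"
      unfolding A2 using c1 e f by (simp_all add: asc)
    then show "A2 * f = A2" "e * A2 = 0\<^sub>m n n"
      unfolding alg(6,7) A2 using c1 f by simp_all
  qed
  have eM: "e * M = e" "M * f = A2"
    unfolding M_def using A2c e f fA2 alg(5,7)
    by (simp_all add: mult_add_distrib_mat[of _ n n _ n] add_mult_distrib_mat[of _ n n _ _ n])
  have "\<exists>M'. inverse_mats n M M'"
  proof (rule inverse_mats_of_kernel[OF Mc])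
    fix v assume v: "v \<in> carrier_vec n" "M *\<^sub>v v = 0\<^sub>v n"
    have ev: "e *\<^sub>v v = 0\<^sub>v n"
    proof -
      have "e *\<^sub>v v = e *\<^sub>v (M *\<^sub>v v)" using assoc_mult_mat_vec[OF e Mc v(1)] eM(1) by simp
      also have "\<dots> = 0\<^sub>v n" unfolding v(2) using e by auto
      finally show ?thesis .
    qed
    have "A2 *\<^sub>v v + e *\<^sub>v v = 0\<^sub>v n"
      using v(2) add_mult_distrib_mat_vec[OF A2c e v(1)] by (simp add: M_def)
    then have A2v: "A2 *\<^sub>v v = 0\<^sub>v n" unfolding ev using A2c v(1) by simp
    \<comment> \<open>The first block column of a similitude has full rank: it has an explicit left inverse.\<close>
    have full': "?T D1 * A2 - ?T B2 * e = l \<cdot>\<^sub>m 1\<^sub>m n"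
    proof -
      have "?T (?T A2 * D1 - e * B2) = ?T D1 * A2 - ?T B2 * e"
        using A2c B2 c1 e alg(3) by (simp add: transpose_minus[of _ n n] transpose_mult[of _ n n _ n])
      moreover have "?T (l \<cdot>\<^sub>m 1\<^sub>m n) = l \<cdot>\<^sub>m 1\<^sub>m n" by (auto simp: mat_eq_iff)
      ultimately show ?thesis unfolding full by simp
    qed
    have "l \<cdot>\<^sub>v v = l \<cdot>\<^sub>m 1\<^sub>m n *\<^sub>v v" by (intro eq_vecI) (use v(1) in auto)
    also have "\<dots> = ?T D1 *\<^sub>v (A2 *\<^sub>v v) - ?T B2 *\<^sub>v (e *\<^sub>v v)"
      unfolding full'[symmetric] using v(1) A2c B2 c1 e
      by (simp add: minus_mult_distrib_mat_vec[of _ n n] assoc_mult_mat_vec[of _ n n _ n])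
    also have "\<dots> = 0\<^sub>v n" unfolding A2v ev using B2 c1 by auto
    finally have "l \<cdot>\<^sub>v v = 0\<^sub>v n" .
    then show "v = 0\<^sub>v n" using l(1) v(1) by (auto simp: vec_eq_iff)
  qed
  then obtain M' where M': "inverse_mats n M M'" by blast
  have M'c: "M' \<in> carrier_mat n n" "M' * M = 1\<^sub>m n" using M' by (auto simp: inverse_mats_def)
  let ?p3 = "four_block_mat M' (0\<^sub>m n n) (0\<^sub>m n n) (?T M)"
  have p3: "?p3 \<in> P" using levi_in_P(1)[OF inverse_mats_sym[OF M']] .
  have M'A2: "M' * A2 = f"
  proof -
    have "M' * A2 = (M' * M) * f" unfolding eM(2)[symmetric] using M'c(1) Mc f by (simp add: asc)
    then show ?thesis using M'c f by simp
  qed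
  have Me: "?T M * e = e"
  proof -
    have "?T M * e = ?T (e * M)" using Mc e alg(3) by (simp add: transpose_mult[of _ n n _ n])
    then show ?thesis unfolding eM alg(3) .
  qed
  have g3: "?p3 * four_block_mat A2 B2 e D1 = four_block_mat f (M' * B2) e (?T M * D1)"
    using f A2c B2 e c1 Mc M'c(1) by (simp add: mult_four_block_mat[of _ n n _ n _ n _ _ n _ n] M'A2 Me)
  have g3G: "four_block_mat f (M' * B2) e (?T M * D1) \<in> G"
    unfolding g3[symmetric] using G_mult P_in_G p3 g2G by blast
  let ?w = "coset_rep n r :: 'a mat"
  have w: "?w = four_block_mat f (- e) e f" by (simp add: coset_rep_def e_def f_def)
  have wG: "?w \<in> G" by (intro in_G similitude_coset_rep)
  obtain w' where w': "w' \<in> G" "?w * w' = 1\<^sub>m (n + n)" "w' * ?w = 1\<^sub>m (n + n)"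
    using G_inverse[OF wG] by blast
  have w'_eq: "w' = four_block_mat f e (- e) f"
  proof -
    let ?v = "four_block_mat f e (- e) f"
    have "?v * ?w = 1\<^sub>m (n + n)"
    proof -
      have z: "f * - e + e * f = 0\<^sub>m n n" "- e * f + f * e = 0\<^sub>m n n" "- e * - e + f * f = 1\<^sub>m n" "f * f + e * e = 1\<^sub>m n"
        using alg(5-9) e f by (auto simp: mat_eq_iff add.commute)
      show ?thesis
        unfolding w using e f z by (simp add: mult_four_block_mat[of _ n n _ n _ n _ _ n _ n])
    qed
    then have "w' = ?v * ?w * w'" using G_one_mult(1)[OF w'(1)] by simp
    also have "\<dots> = ?v * (?w * w')"
      using e f G_carrier[OF wG] G_carrier[OF w'(1)] by (intro assoc_mult_mat) auto
    also have "\<dots> = ?v" unfolding w'(2) using e f by simp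
    finally show ?thesis .
  qed
  define p'' where "p'' = w' * four_block_mat f (M' * B2) e (?T M * D1)"
  have p''G: "p'' \<in> G" unfolding p''_def using G_mult w'(1) g3G by blast
  have "p'' = four_block_mat (f * f + e * e) (f * (M' * B2) + e * (?T M * D1)) (- e * f + f * e) (- e * (M' * B2) + f * (?T M * D1))"
    unfolding p''_def w'_eq using e f M'c(1) Mc B2 c1
    by (simp add: mult_four_block_mat[of _ n n _ n _ n _ _ n _ n])
  moreover have "- e * f + f * e = 0\<^sub>m n n" using alg(7,8) e f by (auto simp: mat_eq_iff)
  ultimately have p''P: "p'' \<in> P"
    using p''G e f M'c(1) Mc B2 c1 P_I[of "f * f + e * e" "f * (M' * B2) + e * (?T M * D1)" "- e * (M' * B2) + f * (?T M * D1)"]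
    by simp
  have "?w * p'' = four_block_mat f (M' * B2) e (?T M * D1)"
    unfolding p''_def using G_assoc[OF wG w'(1) g3G] w'(2) G_one_mult(1)[OF g3G] by simp
  also have "\<dots> = ?p3 * (unipotent n S * (?p1 * g * ?q))"
    unfolding g1 g2 g3 ..
  also have "\<dots> = (?p3 * unipotent n S * ?p1) * g * ?q"
    using g P_in_G[OF p1] P_in_G[OF q] P_in_G[OF p3] P_in_G[OF u] by (simp add: G_assoc G_mult)
  finally show ?thesis
    using nf(3) p3 u p1 q p''P P_mult by metis
qed

end

section \<open>The double coset invariant and the Levi factor\<close>

definition lower_left :: "nat \<Rightarrow> 'a mat \<Rightarrow> 'a mat" where
  "lower_left n g = mat n n (\<lambda>(i, j). g $$ (n + i, j))"

lemma lower_left_four_block [simp]: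
  "A \<in> carrier_mat n n \<Longrightarrow> C \<in> carrier_mat n n \<Longrightarrow> D \<in> carrier_mat n n \<Longrightarrow> lower_left n (four_block_mat A B C D) = C"
  by (rule eq_matI) (auto simp: lower_left_def)

lemma lower_left_carrier: "lower_left n g \<in> carrier_mat n n"
  by (simp add: lower_left_def)

text \<open>The left kernel of the lower left block is the intersection of the Lagrangian subspaces
\<open>L\<^sub>0\<close> and \<open>L\<^sub>0 g\<close>, where \<open>L\<^sub>0\<close> consists of the row vectors \<open>(0, x)\<close>; its size is the invariant that separates the
double cosets of \<open>P\<close>.\<close>

definition meet_card :: "nat \<Rightarrow> 'a::field mat \<Rightarrow> nat" where
  "meet_card n g = kernel_card (transpose_mat (lower_left n g))"

context symplectic_group
begin

lemma in_G_same_multiplier: "g \<in> G \<Longrightarrow> similitude n (multiplier n g) h \<Longrightarrow> h \<in> G"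
proof -
  assume g: "g \<in> G" and h: "similitude n (multiplier n g) h"
  show "h \<in> G"
  proof (cases "G = Sp n")
    case True
    then have "multiplier n g = 1" using g multiplier_eq[OF n_pos] Sp_iff by blast
    then show ?thesis using h True by (simp add: Sp_iff)
  next
    case False
    then show ?thesis using G_cases h multiplier_nonzero[OF g] GSp_iff by blast
  qed
qed

lemma lower_left_mult_P:
  assumes "p \<in> P" "g \<in> G"
  obtains A A' D D' where "inverse_mats n A A'" "inverse_mats n D D'"
    "lower_left n (p * g) = D * lower_left n g" "lower_left n (g * p) = lower_left n g * A"
proof -
  obtain A B D where b: "A \<in> carrier_mat n n" "B \<in> carrier_mat n n" "D \<in> carrier_mat n n"
    "p = four_block_mat A B (0\<^sub>m n n) D"
    "inverse_mats n (transpose_mat A) (inverse (multiplier n p) \<cdot>\<^sub>m D)"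
    "inverse_mats n D (inverse (multiplier n p) \<cdot>\<^sub>m transpose_mat A)"
    using P_obtain[OF assms(1)] by metis
  obtain A1 B1 C1 D1 where b1: "A1 \<in> carrier_mat n n" "B1 \<in> carrier_mat n n" "C1 \<in> carrier_mat n n" "D1 \<in> carrier_mat n n"
    "g = four_block_mat A1 B1 C1 D1"
    using four_block_mat_obtain[OF G_carrier[OF assms(2)]] by metis
  have "p * g = four_block_mat (A * A1 + B * C1) (A * B1 + B * D1) (D * C1) (D * D1)"
    "g * p = four_block_mat (A1 * A) (A1 * B + B1 * D) (C1 * A) (C1 * B + D1 * D)"
    unfolding b(4) b1(5) using b(1-3) b1(1-4)
    by (simp_all add: mult_four_block_mat[of _ n n _ n _ n _ _ n _ n])
  then have "lower_left n (p * g) = D * lower_left n g" "lower_left n (g * p) = lower_left n g * A"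
    using b(1-3) b1 by simp_all
  then show ?thesis using that inverse_mats_transpose[OF b(5)] b(6) by simp
qed

lemma meet_card_mult_P:
  assumes "p \<in> P" "g \<in> G"
  shows "meet_card n (p * g) = meet_card n g" "meet_card n (g * p) = meet_card n g"
proof -
  obtain A A' D D' where inv: "inverse_mats n A A'" "inverse_mats n D D'"
    and ll: "lower_left n (p * g) = D * lower_left n g" "lower_left n (g * p) = lower_left n g * A"
    using lower_left_mult_P[OF assms] by metis
  let ?C = "lower_left n g"
  have C: "?C \<in> carrier_mat n n" by (rule lower_left_carrier)
  have iA: "inverse_mats n (transpose_mat A) (transpose_mat A')" and iD: "inverse_mats n (transpose_mat D) (transpose_mat D')"
    using inv by (simp_all add: inverse_mats_transpose)
  have "transpose_mat (D * ?C) = transpose_mat ?C * transpose_mat D" "transpose_mat (?C * A) = transpose_mat A * transpose_mat ?C"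
    using C inv by (simp_all add: transpose_mult[of _ n n _ n] inverse_mats_def)
  then show "meet_card n (p * g) = meet_card n g" "meet_card n (g * p) = meet_card n g"
    unfolding meet_card_def ll
    using kernel_card_mult_left[of "transpose_mat ?C" n n "transpose_mat A" "transpose_mat A'"]
      kernel_card_mult_right[of "transpose_mat ?C" n n "transpose_mat D" "transpose_mat D'"] C iA iD
    by (simp_all add: inverse_mats_def)
qed

lemma P_iff_lower_left: "g \<in> P \<longleftrightarrow> g \<in> G \<and> lower_left n g = 0\<^sub>m n n"
proof
  assume g: "g \<in> P"
  then show "g \<in> G \<and> lower_left n g = 0\<^sub>m n n"
    by (elim P_obtain) (use g P_in_G in auto)
next
  assume g: "g \<in> G \<and> lower_left n g = 0\<^sub>m n n"
  obtain A B C D where b: "A \<in> carrier_mat n n" "B \<in> carrier_mat n n" "C \<in> carrier_mat n n" "D \<in> carrier_mat n n"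
    "g = four_block_mat A B C D"
    using four_block_mat_obtain[OF G_carrier] g by metis
  then have "C = 0\<^sub>m n n" using g by simp
  with b g P_I[of A B D] show "g \<in> P" by simp
qed

lemma P_mult_iff:
  assumes "p \<in> P" "g \<in> G"
  shows "p * g \<in> P \<longleftrightarrow> g \<in> P" "g * p \<in> P \<longleftrightarrow> g \<in> P"
proof -
  obtain A A' D D' where inv: "inverse_mats n A A'" "inverse_mats n D D'"
    and ll: "lower_left n (p * g) = D * lower_left n g" "lower_left n (g * p) = lower_left n g * A"
    using lower_left_mult_P[OF assms] by metis
  let ?C = "lower_left n g"
  have c: "?C \<in> carrier_mat n n" "A \<in> carrier_mat n n" "A' \<in> carrier_mat n n" "D \<in> carrier_mat n n" "D' \<in> carrier_mat n n"
    and i: "A * A' = 1\<^sub>m n" "D' * D = 1\<^sub>m n"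
    using inv lower_left_carrier by (auto simp: inverse_mats_def)
  have "?C = D' * (D * ?C)" "?C = ?C * A * A'"
    using c i by (simp_all add: assoc_mult_mat[of _ n n _ n _ n, symmetric])
  then have "D * ?C = 0\<^sub>m n n \<longleftrightarrow> ?C = 0\<^sub>m n n" "?C * A = 0\<^sub>m n n \<longleftrightarrow> ?C = 0\<^sub>m n n"
    using c by (metis left_mult_zero_mat right_mult_zero_mat)+
  then show "p * g \<in> P \<longleftrightarrow> g \<in> P" "g * p \<in> P \<longleftrightarrow> g \<in> P"
    unfolding P_iff_lower_left ll using assms G_mult P_in_G by blast+
qed

lemma coset_rep_in_G: "coset_rep n r \<in> G"
  by (intro in_G similitude_coset_rep)

lemma multiplier_coset_rep: "multiplier n (coset_rep n r :: 'a mat) = 1"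
  by (intro multiplier_eq[OF n_pos] similitude_coset_rep)

lemma lower_left_coset_rep: "lower_left n (coset_rep n r :: 'a mat) = diag_idem n r"
  unfolding coset_rep_def using diag_idem_algebra(1,2)[of n r, where 'a = 'a] by simp

lemma meet_card_coset_rep:
  assumes "r \<le> n"
  shows "meet_card n (coset_rep n r :: 'a mat) = CARD('a) ^ (n - r)"
  unfolding meet_card_def lower_left_coset_rep diag_idem_algebra(3)
  using assms by (rule kernel_card_diag_idem)

lemma sum_siegel_U: "(\<Sum>u\<in>siegel_U n G. F u) = (\<Sum>S\<in>sym_mats n. F (unipotent n S))"
  unfolding siegel_U_eq using sum.reindex[OF inj_unipotent] by simp

lemma multiplier_unipotent: "S \<in> sym_mats n \<Longrightarrow> multiplier n (unipotent n S) = 1"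
  using similitude_unipotent_iff[OF sym_mats_carrier] multiplier_eq[OF n_pos] by blast

lemma multiplier_U: "u \<in> siegel_U n G \<Longrightarrow> multiplier n u = 1"
  using multiplier_unipotent unfolding siegel_U_eq by blast

lemma multiplier_Jinv: "multiplier n (Jinv n :: 'a mat) = 1"
  by (intro multiplier_eq[OF n_pos] similitude_Jinv)

lemma meet_card_big_cell:
  fixes S :: "'a mat"
  assumes S: "S \<in> sym_mats n" and r: "r \<le> n"
  shows "meet_card n (Jinv n * unipotent n S * coset_rep n r) = kernel_card (top_left r S)"
proof -
  let ?e = "diag_idem n r :: 'a mat" and ?f = "1\<^sub>m n - diag_idem n r :: 'a mat"
  have Sc: "S \<in> carrier_mat n n" by (rule sym_mats_carrier[OF S])
  note c = diag_idem_algebra(1,2)[of n r, where 'a = 'a]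
  have "Jinv n * unipotent n S = four_block_mat (0\<^sub>m n n) (1\<^sub>m n) (- 1\<^sub>m n) (- S)"
    unfolding Jinv_def unipotent_def using Sc
    by (simp add: mult_four_block_mat[of _ n n _ n _ n _ _ n _ n])
  then have "lower_left n (Jinv n * unipotent n S * coset_rep n r) = - 1\<^sub>m n * ?f + - S * ?e"
    unfolding coset_rep_def using Sc c
    by (simp add: mult_four_block_mat[of _ n n _ n _ n _ _ n _ n])
  also have "\<dots> = - ?f + - (S * ?e)"
    using Sc c by simp
  finally show ?thesis
    unfolding meet_card_def using kernel_card_big_cell[OF S r] by simp
qed

lemma sum_G_left_mult:
  assumes "h \<in> G"
  shows "(\<Sum>g\<in>G. F (h * g)) = (\<Sum>g\<in>G. F g)"
proof -
  obtain k where k: "k \<in> G" "h * k = 1\<^sub>m (n + n)" "k * h = 1\<^sub>m (n + n)"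
    using G_inverse[OF assms] by blast
  show ?thesis
  proof (rule sum.reindex_bij_witness[where i = "\<lambda>g. k * g" and j = "\<lambda>g. h * g"])
    fix g assume g: "g \<in> G"
    show "k * (h * g) = g" using G_assoc[OF k(1) assms g] k(3) G_one_mult(1)[OF g] by simp
    show "h * g \<in> G" "k * g \<in> G" using G_mult assms k(1) g by auto
    show "h * (k * g) = g" using G_assoc[OF assms k(1) g] k(2) G_one_mult(1)[OF g] by simp
  qed simp
qed

definition G_inv :: "'a mat \<Rightarrow> 'a mat" where
  "G_inv g = (SOME h. h \<in> G \<and> g * h = 1\<^sub>m (n + n) \<and> h * g = 1\<^sub>m (n + n))"

lemma G_inv:
  assumes "g \<in> G"
  shows "G_inv g \<in> G" "g * G_inv g = 1\<^sub>m (n + n)" "G_inv g * g = 1\<^sub>m (n + n)"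
proof -
  have "G_inv g \<in> G \<and> g * G_inv g = 1\<^sub>m (n + n) \<and> G_inv g * g = 1\<^sub>m (n + n)"
    unfolding G_inv_def by (rule someI_ex) (use G_inverse[OF assms] in blast)
  then show "G_inv g \<in> G" "g * G_inv g = 1\<^sub>m (n + n)" "G_inv g * g = 1\<^sub>m (n + n)" by auto
qed

lemma G_cancel:
  assumes "g \<in> G" "h \<in> G"
  shows "h * G_inv g * g = h" "h * g * G_inv g = h" "G_inv g * (g * h) = h" "g * (G_inv g * h) = h"
  using assms G_assoc[of h "G_inv g" g] G_assoc[of h g "G_inv g"] G_assoc[of "G_inv g" g h] G_assoc[of g "G_inv g" h]
    G_inv[OF assms(1)] G_one_mult[OF assms(2)] by simp_all

text \<open>Here \<open>t\<close> is the Levi part of \<open>p\<close>, and \<open>t'\<close> is \<open>t\<close> with its two blocks exchanged, which is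
conjugation by \<open>J\<close>. The last clause says that moving \<open>p\<close> to the left past the unipotent radical costs exactly
the Levi part.\<close>

lemma levi_swap:
  assumes "p \<in> P"
  obtains t t' where "t \<in> P" "t' \<in> P" "multiplier n t' = multiplier n p" "chi_J n \<phi> p = \<phi> t'"
    "Jinv n * t = t' * Jinv n" "\<And>u. u \<in> siegel_U n G \<Longrightarrow> G_inv t * (u * p) \<in> siegel_U n G"
proof -
  let ?l = "multiplier n p"
  obtain A B D where b: "A \<in> carrier_mat n n" "B \<in> carrier_mat n n" "D \<in> carrier_mat n n"
    "p = four_block_mat A B (0\<^sub>m n n) D" "transpose_mat A * D = ?l \<cdot>\<^sub>m 1\<^sub>m n"
    "inverse_mats n (transpose_mat A) (inverse ?l \<cdot>\<^sub>m D)"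
    using P_obtain[OF assms] by metis
  let ?t = "four_block_mat A (0\<^sub>m n n) (0\<^sub>m n n) D" and ?t' = "four_block_mat D (0\<^sub>m n n) (0\<^sub>m n n) A"
  have "transpose_mat D * A = transpose_mat (transpose_mat A * D)"
    using b(1,3) by (simp add: transpose_mult[of _ n n _ n])
  also have "\<dots> = ?l \<cdot>\<^sub>m 1\<^sub>m n" unfolding b(5) by (auto simp: mat_eq_iff)
  finally have DA: "transpose_mat D * A = ?l \<cdot>\<^sub>m 1\<^sub>m n" .
  have z: "?l \<cdot>\<^sub>m 1\<^sub>m n - 0\<^sub>m n n = ?l \<cdot>\<^sub>m 1\<^sub>m n" by (auto simp: mat_eq_iff)
  have sim: "similitude n ?l ?t" "similitude n ?l ?t'"
    using b(1,3,5) DA z by (simp_all add: similitude_four_block)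
  have G: "?t \<in> G" "?t' \<in> G"
    using in_G_same_multiplier[OF P_in_G[OF assms]] sim by auto
  have P: "?t \<in> P" "?t' \<in> P" using G b(1,3) P_I by auto
  have chi: "chi_J n \<phi> p = \<phi> ?t'"
  proof -
    have "split_block p n n = (A, B, 0\<^sub>m n n, D)"
      unfolding b(4) using b(1-3) by (auto simp: split_block_def Let_def)
    then show ?thesis by (simp add: chi_J_def)
  qed
  have JJ: "Jinv n * ?t = ?t' * Jinv n"
  proof -
    have "- 0\<^sub>m n n = (0\<^sub>m n n :: 'a mat)" by (auto simp: mat_eq_iff)
    then show ?thesis
      unfolding Jinv_def using b(1,3) by (simp add: mult_four_block_mat[of _ n n _ n _ n _ _ n _ n])
  qed
  have U: "G_inv ?t * (u * p) \<in> siegel_U n G" if u: "u \<in> siegel_U n G" for u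
  proof -
    obtain S where S: "S \<in> sym_mats n" "u = unipotent n S" using u unfolding siegel_U_eq by blast
    have Sc: "S \<in> carrier_mat n n" by (rule sym_mats_carrier[OF S(1)])
    obtain A' where A': "inverse_mats n A A'" using inverse_mats_transpose[OF b(6)] by auto
    then have A'c: "A' \<in> carrier_mat n n" "A * A' = 1\<^sub>m n" by (auto simp: inverse_mats_def)
    define E where "E = A' * (B + S * D)"
    have Ec: "E \<in> carrier_mat n n" using A'c b Sc by (simp add: E_def)
    have uG: "u \<in> G" using u P_in_G U_in_P by blast
    have "A * E = B + S * D"
    proof -
      have "A * E = (A * A') * (B + S * D)"
        unfolding E_def using A'c(1) b(1-3) Sc by (intro assoc_mult_mat[symmetric]) auto
      then show ?thesis using A'c(2) b(2,3) Sc by simp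
    qed
    then have eq: "?t * unipotent n E = u * p"
      unfolding S(2) unipotent_def b(4) using b(1-3) Ec Sc
      by (simp add: mult_four_block_mat[of _ n n _ n _ n _ _ n _ n])
    have upG: "u * p \<in> G" using G_mult uG P_in_G[OF assms] by blast
    have "unipotent n E = 1\<^sub>m (n + n) * unipotent n E"
      using Ec by (simp add: unipotent_def)
    also have "\<dots> = G_inv ?t * ?t * unipotent n E" using G_inv(3)[OF G(1)] by simp
    also have "\<dots> = G_inv ?t * (?t * unipotent n E)"
      using G_carrier[OF G(1)] G_carrier[OF G_inv(1)[OF G(1)]] Ec
      by (intro assoc_mult_mat[of _ "n + n" "n + n" _ "n + n" _ "n + n"]) (auto simp: unipotent_def)
    finally have E: "unipotent n E = G_inv ?t * (u * p)" unfolding eq .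
    then have "unipotent n E \<in> G" using G_mult G_inv(1)[OF G(1)] upG by simp
    then have "unipotent n E \<in> siegel_U n G"
      unfolding siegel_U_def using Ec unfolding unipotent_def by blast
    then show ?thesis unfolding E .
  qed
  show ?thesis
    by (rule that[OF P multiplier_eq[OF n_pos sim(2)] chi JJ U])
qed

end

lemma intertwiner_add: "intertwiner n G (f + h) = intertwiner n G f + intertwiner n G h"
  by (rule ext) (simp add: intertwiner_def sum.distrib)

lemma intertwiner_scale: "intertwiner n G (fscale c f) = fscale c (intertwiner n G f)"
  by (rule ext) (simp add: intertwiner_def fscale_def sum_distrib_left)

lemma subspace_Ind: "fn.subspace (Ind n G \<chi>)"
  unfolding fn.subspace_def by (auto simp: Ind_def fscale_def algebra_simps)

lemma subspace_Ind_equivariant: "fn.subspace (Ind_equivariant n G \<chi>)"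
  unfolding Ind_equivariant_def fn.subspace_def
  by (auto simp: Ind_def fscale_def algebra_simps)

section \<open>The intertwining operator on the induced space\<close>

text \<open>The case \<open>\<beta> = 1\<close>: then \<open>\<chi>\<close> is the restriction to \<open>P\<close> of a character of the whole group \<open>G\<close>,
namely \<open>\<alpha>\<close> composed with the similitude factor.\<close>

locale siegel_character = symplectic_group n G
  for n :: nat and G :: "'a::{field,finite} mat set" +
  fixes \<alpha> :: "'a \<Rightarrow> complex" and \<chi> :: "'a mat \<Rightarrow> complex"
  assumes \<alpha>: "lin_character (UNIV - {0}) \<alpha>"
    and \<chi>_eq: "p \<in> siegel_P n G \<Longrightarrow> \<chi> p = \<alpha> (multiplier n p)"
begin

abbreviation "T \<equiv> intertwiner n G"
abbreviation "W \<equiv> Ind n G \<chi>"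
abbreviation "V \<equiv> Ind_equivariant n G \<chi>"

definition q :: complex where "q = of_nat CARD('a)"

lemma q_nonzero: "q \<noteq> 0"
  by (simp add: q_def)

lemma card_gt_1: "1 < CARD('a)"
proof -
  have "card {0, 1 :: 'a} \<le> CARD('a)" by (intro card_mono) auto
  then show ?thesis by simp
qed

lemma inj_q: "inj (\<lambda>s. q ^ s)"
proof (rule injI)
  fix s t assume "q ^ s = q ^ t"
  then have "CARD('a) ^ s = CARD('a) ^ t"
    unfolding q_def of_nat_power[symmetric] of_nat_eq_iff .
  then show "s = t" using card_gt_1 by simp
qed

lemma \<alpha>_nonzero: "x \<noteq> 0 \<Longrightarrow> \<alpha> x \<noteq> 0"
  using \<alpha> by (simp add: lin_character_def)

lemma \<alpha>_mult: "x \<noteq> 0 \<Longrightarrow> y \<noteq> 0 \<Longrightarrow> \<alpha> (x * y) = \<alpha> x * \<alpha> y"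
  using \<alpha> by (simp add: lin_character_def)

lemma \<alpha>_one: "\<alpha> 1 = 1"
  using \<alpha>_mult[of 1 1] \<alpha>_nonzero[of 1] by simp

abbreviation "\<alpha>m g \<equiv> \<alpha> (multiplier n g)"

lemma \<alpha>m_mult: "g \<in> G \<Longrightarrow> h \<in> G \<Longrightarrow> \<alpha>m (g * h) = \<alpha>m g * \<alpha>m h"
  by (simp add: multiplier_mult \<alpha>_mult multiplier_nonzero)

lemma \<alpha>m_nonzero: "g \<in> G \<Longrightarrow> \<alpha>m g \<noteq> 0"
  by (simp add: \<alpha>_nonzero multiplier_nonzero)

lemma chi_J_eq: "p \<in> P \<Longrightarrow> chi_J n \<chi> p = \<chi> p"
  by (rule levi_swap[of p \<chi>]) (simp_all add: \<chi>_eq)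

lemma W_outside: "f \<in> W \<Longrightarrow> g \<notin> G \<Longrightarrow> f g = 0"
  by (simp add: Ind_def)

lemma W_left: "f \<in> W \<Longrightarrow> p \<in> P \<Longrightarrow> g \<in> G \<Longrightarrow> f (p * g) = \<alpha>m p * f g"
  by (simp add: Ind_def \<chi>_eq)

lemma V_W: "f \<in> V \<Longrightarrow> f \<in> W"
  by (simp add: Ind_equivariant_def)

lemma V_right: "f \<in> V \<Longrightarrow> p \<in> P \<Longrightarrow> g \<in> G \<Longrightarrow> f (g * p) = \<alpha>m p * f g"
  by (simp add: Ind_equivariant_def \<chi>_eq)

lemma W_I:
  assumes "\<And>g. g \<notin> G \<Longrightarrow> f g = 0" "\<And>p g. p \<in> P \<Longrightarrow> g \<in> G \<Longrightarrow> f (p * g) = \<alpha>m p * f g"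
  shows "f \<in> W"
  using assms by (simp add: Ind_def \<chi>_eq)

lemma V_I:
  assumes "f \<in> W" "\<And>p g. p \<in> P \<Longrightarrow> g \<in> G \<Longrightarrow> f (g * p) = \<alpha>m p * f g"
  shows "f \<in> V"
  using assms by (simp add: Ind_equivariant_def \<chi>_eq)

lemma T_eq: "g \<in> G \<Longrightarrow> T f g = (\<Sum>u\<in>siegel_U n G. f (Jinv n * u * g))"
  by (simp add: intertwiner_def)

lemma U_in_G: "u \<in> siegel_U n G \<Longrightarrow> u \<in> G"
  by (simp add: siegel_U_def)

lemma finite_U: "finite (siegel_U n G)"
  using finite_subset[OF _ finite_G] U_in_G by blast

text \<open>Moving \<open>p\<close> from the right of \<open>J\<^sup>-\<^sup>1 u\<close> to its left permutes the summands and replaces \<open>p\<close> by its Levi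
part with exchanged blocks, on which \<open>\<chi>\<close> takes the same value.\<close>

lemma T_W: assumes f: "f \<in> W" shows "T f \<in> W"
proof (rule W_I)
  fix p g assume p: "p \<in> P" and g: "g \<in> G"
  obtain t t' where t: "t \<in> P" "t' \<in> P" "multiplier n t' = multiplier n p" "Jinv n * t = t' * Jinv n"
    and U: "\<And>u. u \<in> siegel_U n G \<Longrightarrow> G_inv t * (u * p) \<in> siegel_U n G"
    by (rule levi_swap[OF p, of \<chi>]) (rule that; assumption)
  note inG = P_in_G[OF p] P_in_G[OF t(1)] P_in_G[OF t(2)] G_inv(1)[OF P_in_G[OF t(1)]] Jinv_in_G
  let ?\<tau> = "\<lambda>u. G_inv t * (u * p)"
  have inj: "inj_on ?\<tau> (siegel_U n G)"
  proof (rule inj_onI)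
    fix u u' assume u: "u \<in> siegel_U n G" "u' \<in> siegel_U n G" and eq: "?\<tau> u = ?\<tau> u'"
    then have "t * ?\<tau> u = t * ?\<tau> u'" by simp
    then have "u * p = u' * p"
      using G_cancel(4)[OF inG(2), of "u * p"] G_cancel(4)[OF inG(2), of "u' * p"] u U_in_G inG(1) G_mult by simp
    then have "u * p * G_inv p = u' * p * G_inv p" by simp
    then show "u = u'" using G_cancel(2)[OF inG(1)] u U_in_G by simp
  qed
  have bij: "bij_betw ?\<tau> (siegel_U n G) (siegel_U n G)"
    using inj endo_inj_surj[OF finite_U _ inj] U by (auto simp: bij_betw_def)
  have step: "f (Jinv n * u * (p * g)) = \<alpha>m p * f (Jinv n * ?\<tau> u * g)" if u: "u \<in> siegel_U n G" for u
  proof -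
    have uG: "u \<in> G" and \<tau>G: "?\<tau> u \<in> G" using u U U_in_G by auto
    have "u * p = t * ?\<tau> u" using G_cancel(4)[OF inG(2), of "u * p"] uG inG(1) G_mult by simp
    then have "Jinv n * u * (p * g) = Jinv n * (t * ?\<tau> u) * g"
      using uG inG g by (simp add: G_assoc G_mult)
    also have "\<dots> = Jinv n * t * (?\<tau> u * g)"
      using \<tau>G inG g by (simp add: G_assoc G_mult)
    also have "\<dots> = t' * (Jinv n * ?\<tau> u * g)"
      unfolding t(4) using \<tau>G inG g by (simp add: G_assoc G_mult)
    finally show ?thesis
      using W_left[OF f t(2), of "Jinv n * ?\<tau> u * g"] t(3) \<tau>G inG g by (simp add: G_mult)
  qed
  have "T f (p * g) = (\<Sum>u\<in>siegel_U n G. \<alpha>m p * f (Jinv n * ?\<tau> u * g))"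
    using step p g P_in_G by (simp add: T_eq G_mult)
  also have "\<dots> = \<alpha>m p * (\<Sum>u\<in>siegel_U n G. f (Jinv n * ?\<tau> u * g))"
    by (simp add: sum_distrib_left)
  also have "(\<Sum>u\<in>siegel_U n G. f (Jinv n * ?\<tau> u * g)) = T f g"
    using sum.reindex_bij_betw[OF bij, of "\<lambda>u. f (Jinv n * u * g)"] g by (simp add: T_eq)
  finally show "T f (p * g) = \<alpha>m p * T f g" .
qed (simp add: intertwiner_def)

lemma T_V: assumes f: "f \<in> V" shows "T f \<in> V"
proof (rule V_I[OF T_W[OF V_W[OF f]]])
  fix p g assume p: "p \<in> P" and g: "g \<in> G"
  have "f (Jinv n * u * (g * p)) = \<alpha>m p * f (Jinv n * u * g)" if u: "u \<in> siegel_U n G" for u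
    using V_right[OF f p, of "Jinv n * u * g"] U_in_G[OF u] Jinv_in_G g P_in_G[OF p]
    by (simp add: G_assoc G_mult)
  then show "T f (g * p) = \<alpha>m p * T f g"
    using g p P_in_G by (simp add: T_eq G_mult sum_distrib_left)
qed

text \<open>Substituting \<open>g\<close> for \<open>u g\<close> removes \<open>u\<close> from the second factor, and the first factor is invariant
because \<open>\<chi>\<close> is trivial on \<open>U\<close>.\<close>

lemma cip_T_right:
  assumes f: "f \<in> W" and h: "h \<in> W"
  shows "cip G f (T h) = of_nat (card (siegel_U n G)) * (\<Sum>g\<in>G. f g * cnj (h (Jinv n * g)))"
proof -
  have step: "(\<Sum>g\<in>G. f g * cnj (h (Jinv n * u * g))) = (\<Sum>g\<in>G. f g * cnj (h (Jinv n * g)))" if u: "u \<in> siegel_U n G" for u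
  proof -
    have "f (u * g) = f g" if "g \<in> G" for g
      using W_left[OF f U_in_P[OF u] that] multiplier_U[OF u] by (simp add: \<alpha>_one)
    then have "(\<Sum>g\<in>G. f g * cnj (h (Jinv n * u * g))) = (\<Sum>g\<in>G. f (u * g) * cnj (h (Jinv n * (u * g))))"
      using U_in_G[OF u] Jinv_in_G by (intro sum.cong) (simp_all add: G_assoc)
    then show ?thesis
      using sum_G_left_mult[OF U_in_G[OF u], of "\<lambda>g. f g * cnj (h (Jinv n * g))"] by simp
  qed
  have "cip G f (T h) = (\<Sum>g\<in>G. \<Sum>u\<in>siegel_U n G. f g * cnj (h (Jinv n * u * g)))"
    unfolding cip_def by (intro sum.cong) (simp_all add: T_eq sum_distrib_left)
  also have "\<dots> = (\<Sum>u\<in>siegel_U n G. \<Sum>g\<in>G. f g * cnj (h (Jinv n * u * g)))"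
    by (rule sum.swap)
  finally show ?thesis by (simp add: step)
qed

lemma Jinv_square: "Jinv n * Jinv n \<in> P" "multiplier n (Jinv n * Jinv n :: 'a mat) = 1"
proof -
  have "- 0\<^sub>m n n = (0\<^sub>m n n :: 'a mat)" by (auto simp: mat_eq_iff)
  then   have "Jinv n * Jinv n = four_block_mat (- 1\<^sub>m n) (0\<^sub>m n n) (0\<^sub>m n n) (- 1\<^sub>m n :: 'a mat)"
    unfolding Jinv_def by (simp add: mult_four_block_mat[of _ n n _ n _ n _ _ n _ n])
  then show "Jinv n * Jinv n \<in> P"
    using P_I[of "- 1\<^sub>m n" "0\<^sub>m n n" "- 1\<^sub>m n"] G_mult[OF Jinv_in_G Jinv_in_G] by simp
  show "multiplier n (Jinv n * Jinv n :: 'a mat) = 1"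
    using multiplier_mult[OF Jinv_in_G Jinv_in_G] multiplier_Jinv by simp
qed

text \<open>By \<open>cip_T_right\<close> both sides are the same multiple of a pairing in which one function is translated on the left
by \<open>J\<^sup>-\<^sup>1\<close>. The translation can be moved to the other function because its square, the left translation
by \<open>-1\<close>, is trivial on the induced space.\<close>

lemma T_symmetric:
  assumes f: "f \<in> W" and h: "h \<in> W"
  shows "cip G (T f) h = cip G f (T h)"
proof -
  let ?F = "\<lambda>g. h g * cnj (f (Jinv n * g))"
  have "cip G h (T f) = of_nat (card (siegel_U n G)) * (\<Sum>g\<in>G. ?F (Jinv n * g))"
    using cip_T_right[OF h f] sum_G_left_mult[OF Jinv_in_G, of ?F] by (simp only:)
  also have "(\<Sum>g\<in>G. ?F (Jinv n * g)) = (\<Sum>g\<in>G. h (Jinv n * g) * cnj (f g))"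
  proof (intro sum.cong refl)
    fix g assume g: "g \<in> G"
    have "f (Jinv n * (Jinv n * g)) = f g"
      using W_left[OF f Jinv_square(1) g] Jinv_square(2) G_assoc[OF Jinv_in_G Jinv_in_G g] by (simp add: \<alpha>_one)
    then show "?F (Jinv n * g) = h (Jinv n * g) * cnj (f g)" by simp
  qed
  finally have "cip G (T f) h = cnj (of_nat (card (siegel_U n G)) * (\<Sum>g\<in>G. h (Jinv n * g) * cnj (f g)))"
    by (subst cip_commute) simp
  then show ?thesis
    unfolding cip_T_right[OF f h] by (simp add: mult.commute)
qed

sublocale W: symmetric_operator G W T
  by unfold_locales
    (use finite_G subspace_Ind W_outside intertwiner_add intertwiner_scale T_W T_symmetric in auto)

sublocale V: symmetric_operator G V T
  by unfold_locales
    (use finite_G subspace_Ind_equivariant W_outside V_W intertwiner_add intertwiner_scale T_V T_symmetric in auto)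

lemma V_value:
  assumes g: "g \<in> G"
  obtains r where "r \<le> n" "meet_card n g = CARD('a) ^ (n - r)" "\<And>f. f \<in> V \<Longrightarrow> f g = \<alpha>m g * f (coset_rep n r)"
proof -
  obtain r p p' p'' where r: "r \<le> n" and P: "p \<in> P" "p' \<in> P" "p'' \<in> P"
    and eq: "p * g * p' = coset_rep n r * p''"
    using double_coset[OF g] by blast
  let ?w = "coset_rep n r :: 'a mat"
  note inG = P_in_G[OF P(1)] P_in_G[OF P(2)] P_in_G[OF P(3)] coset_rep_in_G[of r]
  have pg: "p * g \<in> G" using G_mult inG(1) g .
  have "meet_card n g = meet_card n (p * g * p')"
    using meet_card_mult_P(1)[OF P(1) g] meet_card_mult_P(2)[OF P(2) pg] by simp
  also have "\<dots> = CARD('a) ^ (n - r)"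
    unfolding eq using meet_card_mult_P(2)[OF P(3) inG(4)] meet_card_coset_rep[OF r] by simp
  finally have card: "meet_card n g = CARD('a) ^ (n - r)" .
  have "f g = \<alpha>m g * f ?w" if f: "f \<in> V" for f
  proof -
    have "f (p * g * p') = \<alpha>m p' * (\<alpha>m p * f g)"
      using V_right[OF f P(2) pg] W_left[OF V_W[OF f] P(1) g] by simp
    moreover have "f (?w * p'') = \<alpha>m p'' * f ?w" using V_right[OF f P(3) inG(4)] .
    moreover have "\<alpha>m p * \<alpha>m g * \<alpha>m p' = \<alpha>m p''"
      using \<alpha>m_mult[OF pg inG(2)] \<alpha>m_mult[OF inG(1) g] \<alpha>m_mult[OF inG(4,3)] eq
      by (simp add: multiplier_coset_rep \<alpha>_one)
    ultimately have "\<alpha>m p' * (\<alpha>m p * f g) = \<alpha>m p * \<alpha>m g * \<alpha>m p' * f ?w" using eq by simp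
    then show ?thesis using \<alpha>m_nonzero[OF inG(1)] \<alpha>m_nonzero[OF inG(2)] by simp
  qed
  then show ?thesis using that r card by blast
qed

text \<open>The twist by \<open>\<alpha>\<close> of a function of the double coset. By \<open>V_eq_biinvariant\<close> all biequivariant functions
have this form.\<close>

definition biinvariant :: "(complex \<Rightarrow> complex) \<Rightarrow> 'a mat \<Rightarrow> complex" where
  "biinvariant F g = (if g \<in> G then \<alpha>m g * F (of_nat (meet_card n g)) else 0)"

lemma biinvariant_in_V: "biinvariant F \<in> V"
proof (intro V_I W_I)
  fix p g assume p: "p \<in> P" and g: "g \<in> G"
  note pG = P_in_G[OF p]
  show "biinvariant F (p * g) = \<alpha>m p * biinvariant F g" "biinvariant F (g * p) = \<alpha>m p * biinvariant F g"
    using g pG by (simp_all add: biinvariant_def G_mult \<alpha>m_mult meet_card_mult_P[OF p g])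
qed (simp add: biinvariant_def)

lemma biinvariant_coset_rep: "s \<le> n \<Longrightarrow> biinvariant F (coset_rep n (n - s)) = F (q ^ s)"
  by (simp add: biinvariant_def coset_rep_in_G multiplier_coset_rep \<alpha>_one meet_card_coset_rep q_def)

lemma V_eq_biinvariant:
  assumes f: "f \<in> V" and F: "\<And>s. s \<le> n \<Longrightarrow> f (coset_rep n (n - s)) = F (q ^ s)"
  shows "f = biinvariant F"
proof
  fix g
  show "f g = biinvariant F g"
  proof (cases "g \<in> G")
    case True
    obtain r where r: "r \<le> n" "meet_card n g = CARD('a) ^ (n - r)" "f g = \<alpha>m g * f (coset_rep n r)"
      using V_value[OF True] f by metis
    have "f (coset_rep n r) = F (q ^ (n - r))" using F[of "n - r"] r(1) by simp
    then show ?thesis using True r by (simp add: biinvariant_def q_def)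
  next
    case False
    then show ?thesis using W_outside[OF V_W[OF f]] by (simp add: biinvariant_def)
  qed
qed

section \<open>Triangular form on the biequivariant functions\<close>

definition basis_fun :: "nat \<Rightarrow> 'a mat \<Rightarrow> complex" where
  "basis_fun j = biinvariant (newton_poly q j)"

lemma biinvariant_newton_sum:
  "f \<in> fn.span (basis_fun ` {..<j}) \<longleftrightarrow> (\<exists>c. f = biinvariant (\<lambda>z. \<Sum>i<j. c i * newton_poly q i z))"
proof
  let ?S = "{f. \<exists>c. f = biinvariant (\<lambda>z. \<Sum>i<j. c i * newton_poly q i z)}"
  have "fn.span (basis_fun ` {..<j}) \<subseteq> ?S"
  proof (rule fn.span_minimal)
    show "basis_fun ` {..<j} \<subseteq> ?S"
    proof clarify
      fix i assume "i < j"
      then have "basis_fun i = biinvariant (\<lambda>z. \<Sum>k<j. (if k = i then 1 else 0) * newton_poly q k z)"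
        unfolding basis_fun_def by (simp add: if_distrib[of "\<lambda>x. x * _"] cong: if_cong)
      then show "\<exists>c. basis_fun i = biinvariant (\<lambda>z. \<Sum>k<j. c k * newton_poly q k z)"
        by (intro exI[of _ "\<lambda>k. if k = i then 1 else 0"])
    qed
    show "fn.subspace ?S"
      unfolding fn.subspace_def
    proof (intro conjI ballI allI)
      have "0 = biinvariant (\<lambda>z. \<Sum>i<j. 0 * newton_poly q i z)"
        by (rule ext) (simp add: biinvariant_def)
      then show "0 \<in> ?S" unfolding mem_Collect_eq by (intro exI[of _ "\<lambda>_. 0"])
    next
      fix f h assume "f \<in> ?S" "h \<in> ?S"
      then obtain c d where "f = biinvariant (\<lambda>z. \<Sum>i<j. c i * newton_poly q i z)"
        "h = biinvariant (\<lambda>z. \<Sum>i<j. d i * newton_poly q i z)" by blast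
      then have "f + h = biinvariant (\<lambda>z. \<Sum>i<j. (c i + d i) * newton_poly q i z)"
        by (intro ext) (simp add: biinvariant_def distrib_left distrib_right sum.distrib)
      then show "f + h \<in> ?S" unfolding mem_Collect_eq by (intro exI[of _ "\<lambda>i. c i + d i"])
    next
      fix a f assume "f \<in> ?S"
      then obtain c where "f = biinvariant (\<lambda>z. \<Sum>i<j. c i * newton_poly q i z)" by blast
      then have "fscale a f = biinvariant (\<lambda>z. \<Sum>i<j. (a * c i) * newton_poly q i z)"
        by (intro ext) (simp add: biinvariant_def fscale_def sum_distrib_left mult_ac)
      then show "fscale a f \<in> ?S" unfolding mem_Collect_eq by (intro exI[of _ "\<lambda>i. a * c i"])
    qed
  qed
  then show "f \<in> fn.span (basis_fun ` {..<j}) \<Longrightarrow> \<exists>c. f = biinvariant (\<lambda>z. \<Sum>i<j. c i * newton_poly q i z)"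
    by blast
next
  have "biinvariant (\<lambda>z. \<Sum>i<j. c i * newton_poly q i z) \<in> fn.span (basis_fun ` {..<j})" for c
  proof (induction j)
    case 0
    have "biinvariant (\<lambda>z. \<Sum>i<0. c i * newton_poly q i z) = 0"
      by (rule ext) (simp add: biinvariant_def)
    then show ?case using fn.span_zero by (simp only:)
  next
    case (Suc j)
    have "biinvariant (\<lambda>z. \<Sum>i<Suc j. c i * newton_poly q i z) =
        biinvariant (\<lambda>z. \<Sum>i<j. c i * newton_poly q i z) + fscale (c j) (basis_fun j)"
      by (rule ext) (simp add: basis_fun_def biinvariant_def fscale_def algebra_simps)
    moreover have "biinvariant (\<lambda>z. \<Sum>i<j. c i * newton_poly q i z) \<in> fn.span (basis_fun ` {..<Suc j})"
    proof -
      have "basis_fun ` {..<j} \<subseteq> basis_fun ` {..<Suc j}" by auto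
      from fn.span_mono[OF this] Suc.IH show ?thesis by blast
    qed
    moreover have "basis_fun j \<in> fn.span (basis_fun ` {..<Suc j})" by (intro fn.span_base) auto
    ultimately show ?case by (simp only: fn.span_add fn.span_scale)
  qed
  then show "\<exists>c. f = biinvariant (\<lambda>z. \<Sum>i<j. c i * newton_poly q i z) \<Longrightarrow> f \<in> fn.span (basis_fun ` {..<j})"
    by blast
qed

lemma span_basis_fun: "fn.span (basis_fun ` {..<Suc n}) = V"
proof (intro equalityI subsetI)
  fix f assume "f \<in> fn.span (basis_fun ` {..<Suc n})"
  then show "f \<in> V" unfolding biinvariant_newton_sum using biinvariant_in_V by blast
next
  fix f assume f: "f \<in> V"
  obtain c where c: "\<And>s. s < Suc n \<Longrightarrow> (\<Sum>j<Suc n. c j * newton_poly q j (q ^ s)) = f (coset_rep n (n - s))"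
    using newton_interpolation[OF inj_q, of "Suc n" "\<lambda>s. f (coset_rep n (n - s))"] by blast
  have "f = biinvariant (\<lambda>z. \<Sum>j<Suc n. c j * newton_poly q j z)"
    using c by (intro V_eq_biinvariant[OF f]) (simp add: less_Suc_eq_le del: sum.lessThan_Suc)
  then show "f \<in> fn.span (basis_fun ` {..<Suc n})" unfolding biinvariant_newton_sum by blast
qed

lemma basis_fun_independent:
  assumes "j < Suc n"
  shows "basis_fun j \<notin> fn.span (basis_fun ` {..<j})"
proof
  assume "basis_fun j \<in> fn.span (basis_fun ` {..<j})"
  then obtain c where c: "basis_fun j = biinvariant (\<lambda>z. \<Sum>i<j. c i * newton_poly q i z)"
    unfolding biinvariant_newton_sum by blast
  have "newton_poly q j (q ^ s) = (\<Sum>i<j. c i * newton_poly q i (q ^ s))" if "s \<le> j" for s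
  proof -
    have s: "s \<le> n" using that assms by simp
    show ?thesis
      using biinvariant_coset_rep[OF s, of "newton_poly q j"]
        biinvariant_coset_rep[OF s, of "\<lambda>z. \<Sum>i<j. c i * newton_poly q i z"] c
      unfolding basis_fun_def by simp
  qed
  then show False using newton_poly_independent[OF inj_q] by blast
qed

text \<open>Both sides are biequivariant, so it suffices to compare them at the representatives. There the summand of
\<open>S\<close> depends only on the upper left block of \<open>S\<close> of size \<open>r\<close>, and the sum over these blocks is
the counting identity \<open>sum_sym_mats_newton_poly\<close>.\<close>

lemma T_basis_fun:
  "T (basis_fun j) = biinvariant (\<lambda>z. q ^ ((Suc n choose 2) + (j choose 2)) * (\<Prod>l<j. 1 + (- (q ^ l / q ^ n)) * z))"
proof (rule V_eq_biinvariant)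
  show "T (basis_fun j) \<in> V" unfolding basis_fun_def by (intro T_V biinvariant_in_V)
  fix s assume s: "s \<le> n"
  define r where "r = n - s"
  have r: "r \<le> n" "n = r + s" using s by (auto simp: r_def)
  let ?w = "coset_rep n r :: 'a mat"
  let ?N = "\<lambda>S. newton_poly q j (of_nat (kernel_card S))"
  have "basis_fun j (Jinv n * unipotent n S * ?w) = ?N (top_left r S)" if S: "S \<in> sym_mats n" for S :: "'a mat"
  proof -
    have uG: "unipotent n S \<in> G" using S U_in_G unfolding siegel_U_eq by blast
    have "multiplier n (Jinv n * unipotent n S * ?w) = 1"
      using uG by (simp add: multiplier_mult G_mult Jinv_in_G coset_rep_in_G multiplier_Jinv multiplier_coset_rep multiplier_unipotent[OF S])
    moreover have "Jinv n * unipotent n S * ?w \<in> G" using uG G_mult Jinv_in_G coset_rep_in_G by blast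
    ultimately show ?thesis
      by (simp add: basis_fun_def biinvariant_def \<alpha>_one meet_card_big_cell[OF S r(1)])
  qed
  then have "T (basis_fun j) ?w = (\<Sum>S\<in>(sym_mats n :: 'a mat set). ?N (top_left r S))"
    by (simp add: T_eq coset_rep_in_G sum_siegel_U)
  then have "q ^ (Suc r choose 2) * T (basis_fun j) ?w = q ^ (Suc n choose 2) * (\<Sum>S\<in>(sym_mats r :: 'a mat set). ?N S)"
    using sum_top_left[OF r(1), of ?N] by (simp add: q_def)
  also have "\<dots> = q ^ (Suc r choose 2) * (q ^ ((Suc n choose 2) + (j choose 2)) * (\<Prod>l<j. 1 - q ^ l / q ^ r))"
    unfolding sum_sym_mats_newton_poly[OF q_def] by (simp add: power_add)
  finally have "T (basis_fun j) ?w = q ^ ((Suc n choose 2) + (j choose 2)) * (\<Prod>l<j. 1 - q ^ l / q ^ r)"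
    using q_nonzero by simp
  moreover have "1 - q ^ l / q ^ r = 1 + (- (q ^ l / q ^ n)) * q ^ s" for l
    using q_nonzero unfolding r(2) by (simp add: power_add)
  ultimately show "T (basis_fun j) (coset_rep n (n - s)) = q ^ ((Suc n choose 2) + (j choose 2)) * (\<Prod>l<j. 1 + (- (q ^ l / q ^ n)) * q ^ s)"
    unfolding r_def[symmetric] by (simp only:)
qed

text \<open>The eigenvalues of the opposition operator; the index \<open>j\<close> is the degree in the Newton basis.\<close>

definition ev :: "nat \<Rightarrow> real" where
  "ev j = (-1) ^ j * real CARD('a) ^ ((j choose 2) + ((n + 1 - j) choose 2))"

lemma real_choose_2: "real (k choose 2) = real k * (real k - 1) / 2"
  by (induction k) (simp_all add: numeral_2_eq_2 field_simps)

lemma prod_q: "(\<Prod>l<j. - (q ^ l / q ^ n)) = (-1) ^ j * q ^ (j choose 2) / q ^ (n * j)"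
proof (induction j)
  case (Suc j)
  have "Suc j choose 2 = j + (j choose 2)" by (simp add: numeral_2_eq_2)
  with Suc show ?case by (simp add: power_add mult_ac)
qed (simp add: binomial_eq_0)

lemma ev_eq:
  assumes "j \<le> n"
  shows "q ^ ((Suc n choose 2) + (j choose 2)) * (\<Prod>l<j. - (q ^ l / q ^ n)) = of_real (ev j)"
proof -
  have "real ((Suc n choose 2) + (j choose 2) + (j choose 2)) = real (n * j + ((j choose 2) + ((n + 1 - j) choose 2)))"
    using assms by (simp add: real_choose_2 of_nat_diff field_simps)
  then have "(Suc n choose 2) + (j choose 2) + (j choose 2) = n * j + ((j choose 2) + ((n + 1 - j) choose 2))"
    unfolding of_nat_eq_iff .
  then have "q ^ ((Suc n choose 2) + (j choose 2)) * q ^ (j choose 2) = q ^ (n * j) * q ^ ((j choose 2) + ((n + 1 - j) choose 2))"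
    by (simp only: power_add[symmetric])
  then have "q ^ ((Suc n choose 2) + (j choose 2)) * ((-1) ^ j * q ^ (j choose 2) / q ^ (n * j)) =
      (-1) ^ j * q ^ ((j choose 2) + ((n + 1 - j) choose 2))"
    using q_nonzero by (simp add: field_simps)
  then show ?thesis
    unfolding prod_q ev_def by (simp add: q_def)
qed

text \<open>Comparison of leading coefficients in \<open>T_basis_fun\<close>.\<close>

lemma T_triangular:
  assumes "j < Suc n"
  shows "T (basis_fun j) - fscale (of_real (ev j)) (basis_fun j) \<in> fn.span (basis_fun ` {..<j})"
proof -
  let ?Q = "q ^ ((Suc n choose 2) + (j choose 2))"
  obtain c where c: "\<And>z. (\<Prod>l<j. 1 + (- (q ^ l / q ^ n)) * z) =
      (\<Prod>l<j. - (q ^ l / q ^ n)) * newton_poly q j z + (\<Sum>i<j. c i * newton_poly q i z)"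
    using newton_expansion[where j = j and a = "\<lambda>_. 1" and b = "\<lambda>l. - (q ^ l / q ^ n)" and q = q] by blast
  have expand: "?Q * (\<Prod>l<j. 1 + (- (q ^ l / q ^ n)) * z) = of_real (ev j) * newton_poly q j z + (\<Sum>i<j. ?Q * c i * newton_poly q i z)" for z
    unfolding c distrib_left sum_distrib_left mult.assoc[symmetric] using ev_eq[of j] assms by simp
  have "T (basis_fun j) - fscale (of_real (ev j)) (basis_fun j) = biinvariant (\<lambda>z. \<Sum>i<j. ?Q * c i * newton_poly q i z)"
    unfolding T_basis_fun expand unfolding basis_fun_def
    by (intro ext) (simp add: biinvariant_def fscale_def distrib_left mult_ac)
  then show ?thesis unfolding biinvariant_newton_sum by (intro exI[of _ "\<lambda>i. ?Q * c i"])
qed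

lemma ex_eigenbasis: "\<exists>v. V.orthogonal_eigenbasis (Suc n) ev v"
  using V.triangular_eigenbasis[of "Suc n" basis_fun ev] basis_fun_independent T_triangular span_basis_fun by blast

definition right_translate :: "'a mat \<Rightarrow> ('a mat \<Rightarrow> complex) \<Rightarrow> 'a mat \<Rightarrow> complex" where
  "right_translate h f g = (if g \<in> G then f (g * h) else 0)"

lemma right_translate_W:
  assumes "f \<in> W" "h \<in> G"
  shows "right_translate h f \<in> W"
proof (rule W_I)
  fix p g assume p: "p \<in> P" and g: "g \<in> G"
  then show "right_translate h f (p * g) = \<alpha>m p * right_translate h f g"
    using W_left[OF assms(1) p, of "g * h"] assms(2) P_in_G[OF p]
    by (simp add: right_translate_def G_mult G_assoc)
qed (simp add: right_translate_def)

lemma T_right_translate: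
  assumes "h \<in> G"
  shows "T (right_translate h f) = right_translate h (T f)"
proof
  fix g
  show "T (right_translate h f) g = right_translate h (T f) g"
    using assms Jinv_in_G U_in_G
    by (cases "g \<in> G") (auto simp: right_translate_def T_eq G_mult G_assoc intertwiner_def intro!: sum.cong)
qed

lemma one_in_P: "1\<^sub>m (n + n) \<in> P"
  using levi_in_P(1)[OF inverse_mats_one[of n]] by simp

text \<open>The function supported on the trivial double coset. It is the unit of the Hecke algebra up to scaling, and
its right translates span the induced space.\<close>

definition delta_P :: "'a mat \<Rightarrow> complex" where
  "delta_P g = (if g \<in> P then \<alpha>m g else 0)"

lemma delta_P_in_V: "delta_P \<in> V"
proof (intro V_I W_I)
  fix p g assume p: "p \<in> P" and g: "g \<in> G"
  show "delta_P (p * g) = \<alpha>m p * delta_P g" "delta_P (g * p) = \<alpha>m p * delta_P g"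
    using p g P_in_G[OF p] P_in_G by (simp_all add: delta_P_def P_mult_iff[OF p g] \<alpha>m_mult)
qed (use P_in_G in \<open>auto simp: delta_P_def\<close>)

text \<open>The summand of \<open>h\<close> at \<open>x\<close> is \<open>f x\<close> when \<open>x h\<^sup>-\<^sup>1 \<in> P\<close> and zero otherwise, and there are as many such
\<open>h\<close> as elements of \<open>P\<close>.\<close>

lemma W_as_sum_of_translates:
  assumes f: "f \<in> W"
  shows "f = (\<Sum>h\<in>G. fscale (f h / of_nat (card P)) (right_translate (G_inv h) delta_P))"
proof
  fix x
  have sum_apply: "(\<Sum>h\<in>A. F h) x = (\<Sum>h\<in>A. F h x)" if "finite A" for A and F :: "'a mat \<Rightarrow> 'a mat \<Rightarrow> complex"
    using that by induction auto
  show "f x = (\<Sum>h\<in>G. fscale (f h / of_nat (card P)) (right_translate (G_inv h) delta_P)) x"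
  proof (cases "x \<in> G")
    case True
    have summand: "f h * delta_P (x * G_inv h) = (if x * G_inv h \<in> P then f x else 0)" if h: "h \<in> G" for h
      using W_left[OF f, of "x * G_inv h" h] h G_cancel(1)[OF h True] by (auto simp: delta_P_def)
    have "bij_betw (\<lambda>h. x * G_inv h) {h \<in> G. x * G_inv h \<in> P} P"
    proof (rule bij_betwI[where g = "\<lambda>p. G_inv p * x"])
      have "x * G_inv (G_inv p * x) = p" if p: "p \<in> G" for p
      proof -
        let ?k = "G_inv p * x"
        have k: "?k \<in> G" using G_mult G_inv(1)[OF p] True by blast
        have "x * G_inv ?k = p * ?k * G_inv ?k" using G_cancel(4)[OF p True] by simp
        then show ?thesis using G_cancel(2)[OF k p] by simp
      qed
      note cancel = this
      then show "(\<lambda>p. G_inv p * x) \<in> P \<rightarrow> {h \<in> G. x * G_inv h \<in> P}"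
        using P_in_G G_mult G_inv(1) True by auto
      show "x * G_inv (G_inv p * x) = p" if "p \<in> P" for p using cancel P_in_G[OF that] .
      show "G_inv (x * G_inv h) * x = h" if "h \<in> {h \<in> G. x * G_inv h \<in> P}" for h
      proof -
        have h: "h \<in> G" using that by simp
        let ?k = "x * G_inv h"
        have k: "?k \<in> G" using G_mult G_inv(1)[OF h] True by blast
        have "G_inv ?k * x = G_inv ?k * (?k * h)" using G_cancel(1)[OF h True] by simp
        then show ?thesis using G_cancel(3)[OF k h] by simp
      qed
    qed auto
    then have card: "card {h \<in> G. x * G_inv h \<in> P} = card P" by (rule bij_betw_same_card)
    have "finite P" using finite_subset[OF _ finite_G] P_in_G by blast
    then have P0: "card P \<noteq> 0" using one_in_P by auto
    have "(\<Sum>h\<in>G. fscale (f h / of_nat (card P)) (right_translate (G_inv h) delta_P)) x =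
        (\<Sum>h\<in>G. f h * delta_P (x * G_inv h)) / of_nat (card P)"
      using True by (simp add: sum_apply[OF finite_G] fscale_def right_translate_def sum_divide_distrib)
    also have "(\<Sum>h\<in>G. f h * delta_P (x * G_inv h)) = (\<Sum>h\<in>G. if x * G_inv h \<in> P then f x else 0)"
      using summand by (intro sum.cong) auto
    also have "\<dots> = of_nat (card P) * f x"
      using finite_G card by (simp add: sum.If_cases Int_def)
    finally show ?thesis using P0 by simp
  next
    case False
    then show ?thesis
      using W_outside[OF f] by (simp add: sum_apply[OF finite_G] fscale_def right_translate_def)
  qed
qed

lemma span_translates:
  assumes v: "V.orthogonal_eigenbasis (Suc n) ev v"
  shows "fn.span {right_translate h (v j) | h j. h \<in> G \<and> j < Suc n} = W" (is "fn.span ?E = W")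
proof (intro equalityI)
  have vV: "v j \<in> V" if "j < Suc n" for j using v that unfolding V.orthogonal_eigenbasis_def by blast
  show "fn.span ?E \<subseteq> W"
    using vV V_W right_translate_W by (intro fn.span_minimal subspace_Ind) blast
  have "delta_P \<in> fn.span (v ` {..<Suc n})"
    using v delta_P_in_V unfolding V.orthogonal_eigenbasis_def by blast
  moreover have "fn.span (v ` {..<Suc n}) \<subseteq> {f. right_translate h f \<in> fn.span ?E}" if h: "h \<in> G" for h
  proof (rule fn.span_minimal)
    show "v ` {..<Suc n} \<subseteq> {f. right_translate h f \<in> fn.span ?E}"
      using h by (auto intro!: fn.span_base)
    have "right_translate h 0 = 0" "\<And>f g. right_translate h (f + g) = right_translate h f + right_translate h g"
      "\<And>c f. right_translate h (fscale c f) = fscale c (right_translate h f)"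
      by (auto simp: right_translate_def fscale_def fun_eq_iff)
    then show "fn.subspace {f. right_translate h f \<in> fn.span ?E}"
      unfolding fn.subspace_def
      by (intro conjI ballI allI) (simp_all only: mem_Collect_eq fn.span_zero fn.span_add fn.span_scale)
  qed
  ultimately have d: "right_translate h delta_P \<in> fn.span ?E" if "h \<in> G" for h using that by blast
  show "W \<subseteq> fn.span ?E"
  proof
    fix f assume "f \<in> W"
    then have "f = (\<Sum>h\<in>G. fscale (f h / of_nat (card P)) (right_translate (G_inv h) delta_P))"
      by (rule W_as_sum_of_translates)
    also have "\<dots> \<in> fn.span ?E" using d G_inv(1) by (intro fn.span_sum fn.span_scale) auto
    finally show "f \<in> fn.span ?E" .
  qed
qed

lemma diagonalizable_W: "diagonalizable_on W T"
  and eigenvalues_W: "eigenvalues_on W T = of_real ` ev ` {..<Suc n}"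
proof -
  obtain v where v: "V.orthogonal_eigenbasis (Suc n) ev v" using ex_eigenbasis by blast
  let ?E = "{right_translate h (v j) | h j. h \<in> G \<and> j < Suc n}"
  have vV: "\<And>j. j < Suc n \<Longrightarrow> v j \<in> V \<and> v j \<noteq> 0 \<and> T (v j) = fscale (of_real (ev j)) (v j)"
    using v unfolding V.orthogonal_eigenbasis_def by blast
  have eig: "\<exists>l\<in>ev ` {..<Suc n}. T f = fscale (of_real l) f" if "f \<in> ?E" for f
  proof -
    obtain h j where hj: "h \<in> G" "j < Suc n" "f = right_translate h (v j)" using \<open>f \<in> ?E\<close> by blast
    have "T f = right_translate h (fscale (of_real (ev j)) (v j))"
      using T_right_translate[OF hj(1), of "v j"] vV[OF hj(2)] hj(3) by simp
    also have "\<dots> = fscale (of_real (ev j)) f"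
      unfolding hj(3) by (auto simp: right_translate_def fscale_def fun_eq_iff)
    finally show ?thesis using hj(2) by blast
  qed
  show "diagonalizable_on W T"
    using W.span_eigenvectors_diagonalizable[OF span_translates[OF v]] eig by blast
  show "eigenvalues_on W T = of_real ` ev ` {..<Suc n}"
  proof (rule W.span_eigenvectors_eigenvalues[OF span_translates[OF v] eig])
    fix l assume "l \<in> ev ` {..<Suc n}"
    then obtain j where "j < Suc n" "l = ev j" by blast
    then show "\<exists>f\<in>W. f \<noteq> 0 \<and> T f = fscale (of_real l) f" using vV[of j] V_W by blast
  qed
qed

lemma multiplicity_V: "eigenvalue_mult V T \<mu> = card {j. j < Suc n \<and> of_real (ev j) = \<mu>}"
  using V.eigenbasis_multiplicity ex_eigenbasis by blast

section \<open>The list of eigenvalues\<close>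

text \<open>The two indices add up to \<open>2 m + 1\<close>; they are paired because they give the same power of \<open>q\<close>, here with
opposite signs.\<close>

lemma exponent_even:
  "((m - i) choose 2) + ((m + 1 + i) choose 2) = m\<^sup>2 + i * (i + 1)" if "i \<le> m"
proof -
  have "real (((m - i) choose 2) + ((m + 1 + i) choose 2)) = real (m\<^sup>2 + i * (i + 1))"
    using that by (simp add: real_choose_2 of_nat_diff field_simps power2_eq_square)
  then show ?thesis unfolding of_nat_eq_iff .
qed

text \<open>The two indices add up to \<open>2 m + 2\<close>, so that here the signs agree as well and the eigenvalues
coincide in pairs.\<close>

lemma exponent_odd:
  "((m + 1 - k) choose 2) + ((m + 1 + k) choose 2) = m * (m + 1) + k\<^sup>2" if "k \<le> m + 1"
proof -
  have "real (((m + 1 - k) choose 2) + ((m + 1 + k) choose 2)) = real (m * (m + 1) + k\<^sup>2)"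
    using that by (simp add: real_choose_2 of_nat_diff field_simps power2_eq_square)
  then show ?thesis unfolding of_nat_eq_iff .
qed

lemma ev_even:
  assumes "n = 2 * m"
  shows "i \<le> m \<Longrightarrow> of_real (ev (m - i)) = (-1) ^ (m + i) * q ^ (m\<^sup>2 + i * (i + 1))"
    and "i < m \<Longrightarrow> of_real (ev (m + 1 + i)) = - ((-1) ^ (m + i) * q ^ (m\<^sup>2 + i * (i + 1)))"
proof -
  assume i: "i \<le> m"
  have "n + 1 - (m - i) = m + 1 + i" using assms i by simp
  moreover have "(-1 :: real) ^ (m - i) = (-1) ^ (m + i)" using i by (simp add: minus_one_power_iff)
  ultimately have "ev (m - i) = (-1) ^ (m + i) * real CARD('a) ^ (m\<^sup>2 + i * (i + 1))"
    unfolding ev_def using exponent_even[OF i] by simp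
  then show "of_real (ev (m - i)) = (-1) ^ (m + i) * q ^ (m\<^sup>2 + i * (i + 1))"
    by (simp add: q_def)
next
  assume i: "i < m"
  have "n + 1 - (m + 1 + i) = m - i" using assms i by simp
  then have "ev (m + 1 + i) = (-1) ^ (m + 1 + i) * real CARD('a) ^ (m\<^sup>2 + i * (i + 1))"
    unfolding ev_def using exponent_even[of i m] i by (simp add: add.commute)
  then show "of_real (ev (m + 1 + i)) = - ((-1) ^ (m + i) * q ^ (m\<^sup>2 + i * (i + 1)))"
    by (simp add: q_def)
qed

lemma ev_odd:
  assumes "n = 2 * m + 1"
  shows "k \<le> m + 1 \<Longrightarrow> of_real (ev (m + 1 - k)) = - ((-1) ^ (m + k) * q ^ (m * (m + 1) + k\<^sup>2))"
    and "k \<le> m \<Longrightarrow> of_real (ev (m + 1 + k)) = - ((-1) ^ (m + k) * q ^ (m * (m + 1) + k\<^sup>2))"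
proof -
  assume k: "k \<le> m + 1"
  have "n + 1 - (m + 1 - k) = m + 1 + k" using assms k by simp
  moreover have "(-1 :: real) ^ (m + 1 - k) = - ((-1) ^ (m + k))" using k by (auto simp: minus_one_power_iff)
  ultimately have "ev (m + 1 - k) = - ((-1) ^ (m + k)) * real CARD('a) ^ (m * (m + 1) + k\<^sup>2)"
    unfolding ev_def using exponent_odd[OF k] by simp
  then show "of_real (ev (m + 1 - k)) = - ((-1) ^ (m + k) * q ^ (m * (m + 1) + k\<^sup>2))"
    by (simp add: q_def)
next
  assume k: "k \<le> m"
  have "n + 1 - (m + 1 + k) = m + 1 - k" using assms k by simp
  then have "ev (m + 1 + k) = (-1) ^ (m + 1 + k) * real CARD('a) ^ (m * (m + 1) + k\<^sup>2)"
    unfolding ev_def using exponent_odd[of k m] k by (simp add: add.commute)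
  then show "of_real (ev (m + 1 + k)) = - ((-1) ^ (m + k) * q ^ (m * (m + 1) + k\<^sup>2))"
    by (simp add: q_def)
qed

lemma eigenvalues_even:
  assumes n: "n = 2 * m"
  shows "(of_real ` ev ` {..<Suc n} :: complex set) =
    (\<Union>i\<in>{..<m}. {q ^ (m\<^sup>2 + i * (i + 1)), - (q ^ (m\<^sup>2 + i * (i + 1)))}) \<union> {q ^ ((2 * m + 1) choose 2)}"
    (is "?L = ?E1 \<union> ?E2")
proof -
  have top: "of_real (ev 0) = q ^ ((2 * m + 1) choose 2)"
  proof -
    have "ev 0 = real CARD('a) ^ ((n + 1) choose 2)" by (simp add: ev_def binomial_eq_0)
    moreover have "n + 1 = 2 * m + 1" using n by simp
    ultimately show ?thesis by (simp only: of_real_power of_real_of_nat_eq q_def)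
  qed
  have sign: "(-1 :: complex) ^ k = 1 \<or> (-1 :: complex) ^ k = - 1" for k
    by (simp add: minus_one_power_iff)
  show ?thesis
  proof (intro equalityI subsetI)
    fix x :: complex assume "x \<in> ?L"
    then obtain j where j: "j < Suc n" "x = of_real (ev j)" by blast
    consider "j = 0" | "0 < j" "j \<le> m" | "m < j" by linarith
    then show "x \<in> ?E1 \<union> ?E2"
    proof cases
      case 1
      then show ?thesis using top j(2) by simp
    next
      case 2
      have "x = (-1) ^ (m + (m - j)) * q ^ (m\<^sup>2 + (m - j) * ((m - j) + 1))"
        using ev_even(1)[OF n, of "m - j"] j(2) 2 by simp
      then have "x \<in> {q ^ (m\<^sup>2 + (m - j) * ((m - j) + 1)), - (q ^ (m\<^sup>2 + (m - j) * ((m - j) + 1)))}"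
        using sign[of "m + (m - j)"] by auto
      then show ?thesis using 2 by (intro UnI1 UN_I[of "m - j"]) auto
    next
      case 3
      define i where "i = j - m - 1"
      have i: "i < m" "j = m + 1 + i" using 3 j(1) n by (auto simp: i_def)
      have "x = - ((-1) ^ (m + i) * q ^ (m\<^sup>2 + i * (i + 1)))"
        using ev_even(2)[OF n i(1)] j(2) i(2) by simp
      then have "x \<in> {q ^ (m\<^sup>2 + i * (i + 1)), - (q ^ (m\<^sup>2 + i * (i + 1)))}"
        using sign[of "m + i"] by auto
      then show ?thesis using i(1) by (intro UnI1 UN_I[of i]) auto
    qed
  next
    fix x :: complex assume "x \<in> ?E1 \<union> ?E2"
    then consider "x \<in> ?E2" | i where "i < m" "x \<in> {q ^ (m\<^sup>2 + i * (i + 1)), - (q ^ (m\<^sup>2 + i * (i + 1)))}" by blast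
    then show "x \<in> ?L"
    proof cases
      case 1
      then have "x = of_real (ev 0)" using top by simp
      then show ?thesis by blast
    next
      case (2 i)
      let ?y = "(-1) ^ (m + i) * q ^ (m\<^sup>2 + i * (i + 1))"
      have "x = ?y \<or> x = - ?y" using 2(2) sign[of "m + i"] by auto
      then have "x = of_real (ev (m - i)) \<or> x = of_real (ev (m + 1 + i))"
        using ev_even(1)[OF n, of i] ev_even(2)[OF n 2(1)] 2(1) by simp
      moreover have "m - i < Suc n" "m + 1 + i < Suc n" using n 2(1) by auto
      ultimately show ?thesis by blast
    qed
  qed
qed

text \<open>All the exponents in the first set are smaller than \<open>(2 m + 1) choose 2\<close>, which is the value of
\<open>m\<^sup>2 + i (i + 1)\<close> at \<open>i = m\<close>.\<close>

lemma eigenvalues_even_disjoint: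
  "(\<Union>i\<in>{..<m}. {q ^ (m\<^sup>2 + i * (i + 1)), - (q ^ (m\<^sup>2 + i * (i + 1)))}) \<inter> {q ^ ((2 * m + 1) choose 2)} = {}"
proof -
  have False if i: "i < m" and x: "x = q ^ ((2 * m + 1) choose 2)" "x = q ^ (m\<^sup>2 + i * (i + 1)) \<or> x = - (q ^ (m\<^sup>2 + i * (i + 1)))" for i x
  proof -
    have "norm (q ^ ((2 * m + 1) choose 2)) = norm (q ^ (m\<^sup>2 + i * (i + 1)))" using x by auto
    then have "real CARD('a) ^ ((2 * m + 1) choose 2) = real CARD('a) ^ (m\<^sup>2 + i * (i + 1))"
      by (simp add: q_def norm_power)
    then have "(2 * m + 1) choose 2 = m\<^sup>2 + i * (i + 1)"
      using card_gt_1 by (subst (asm) power_inject_exp) auto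
    moreover have "(2 * m + 1) choose 2 = m\<^sup>2 + m * (m + 1)"
      using exponent_even[of m m] by (simp add: binomial_eq_0 mult_2)
    ultimately have "i * (i + 1) = m * (m + 1)" by simp
    moreover have "i * (i + 1) < m * (m + 1)" using i by (intro mult_strict_mono) auto
    ultimately show False by simp
  qed
  then show ?thesis by blast
qed

text \<open>With \<open>k = i div 2\<close>, the even \<open>i = 2 k\<close> corresponds to \<open>j = m + 1 - k\<close> and the odd
\<open>i = 2 k + 1\<close> to \<open>j = m + 1 + k\<close>.\<close>

lemma eigenvalue_mset_odd:
  assumes n: "n = 2 * m + 1"
  shows "image_mset (\<lambda>i. - ((-1) powi (int m - int (i div 2)) * q ^ (m * (m + 1) + (i div 2)\<^sup>2))) (mset_set {1..n + 1})
    = image_mset (\<lambda>j. of_real (ev j)) (mset_set {..<Suc n})"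
proof -
  define \<phi> where "\<phi> j = (if j \<le> m then 2 * (m + 1 - j) else 2 * (j - m - 1) + 1)" for j
  have bij: "bij_betw \<phi> {..<Suc n} {1..n + 1}"
    by (rule bij_betwI[where g = "\<lambda>i. if even i then m + 1 - i div 2 else m + 1 + i div 2"])
      (auto simp: \<phi>_def n elim!: oddE evenE)
  have value_at: "- ((-1) powi (int m - int (\<phi> j div 2)) * q ^ (m * (m + 1) + (\<phi> j div 2)\<^sup>2)) = of_real (ev j)"
    if j: "j < Suc n" for j
  proof -
    define k where "k = \<phi> j div 2"
    have powi: "(-1 :: complex) powi (int m - int k) = (-1) ^ (m + k)"
      by (simp add: power_int_diff power_add) (simp add: minus_one_power_iff)
    have "of_real (ev j) = - ((-1) ^ (m + k) * q ^ (m * (m + 1) + k\<^sup>2))"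
    proof (cases "j \<le> m")
      case True
      then have "k \<le> m + 1" "j = m + 1 - k" by (auto simp: k_def \<phi>_def)
      then show ?thesis using ev_odd(1)[OF n, of k] by simp
    next
      case False
      then have "k \<le> m" "j = m + 1 + k" using j n by (auto simp: k_def \<phi>_def)
      then show ?thesis using ev_odd(2)[OF n, of k] by simp
    qed
    then show ?thesis unfolding k_def[symmetric] powi by simp
  qed
  have "mset_set {1..n + 1} = image_mset \<phi> (mset_set {..<Suc n})"
    using image_mset_mset_set[of \<phi> "{..<Suc n}"] bij by (simp add: bij_betw_def)
  then show ?thesis
    using value_at by (auto simp: multiset.map_comp comp_def simp del: lessThan_Suc intro!: image_mset_cong)
qed

lemma eigenvalue_mset_V: "has_eigenvalue_mset V T (image_mset (\<lambda>j. of_real (ev j)) (mset_set {..<Suc n}))"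
  unfolding has_eigenvalue_mset_def
proof (intro conjI allI)
  show "T ` V \<subseteq> V" using T_V by blast
  fix \<mu> :: complex
  have "count (image_mset (\<lambda>j. of_real (ev j)) (mset_set {..<Suc n})) \<mu> = card {j \<in> {..<Suc n}. of_real (ev j) = \<mu>}"
    by (simp add: count_image_mset_eq_card_vimage del: lessThan_Suc)
  then show "count (image_mset (\<lambda>j. of_real (ev j)) (mset_set {..<Suc n})) \<mu> = eigenvalue_mult V T \<mu>"
    unfolding multiplicity_V by (simp del: lessThan_Suc)
qed

end

theorem theorem4p5p1:
  fixes n q :: nat
    and G :: "'a::{field,finite} mat set"
    and \<chi> :: "'a mat \<Rightarrow> complex"
    and \<alpha> \<beta> :: "'a \<Rightarrow> complex"
  assumes "q = CARD('a)" and "odd q" and "\<not> 3 dvd q" and "n \<ge> 1"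
    and "G = GSp n \<or> G = Sp n"
    and "lin_character (siegel_P n G) \<chi>"
    and "lin_character (UNIV - {0}) \<alpha>" and "lin_character (UNIV - {0}) \<beta>"
    and "\<forall>p\<in>siegel_P n G. \<chi> p = \<alpha> (siegel_m n p) * \<beta> (chi_det n p)"
    and "\<forall>x. x \<noteq> 0 \<longrightarrow> \<beta> x = 1"
  shows "(\<forall>p\<in>siegel_P n G. chi_J n \<chi> p = \<chi> p)
    \<and> (\<forall>m. n = 2 * m \<longrightarrow>
        (let E1 = (\<Union>i\<in>{..<m}. {of_nat q ^ (m^2 + i * (i + 1)), - (of_nat q ^ (m^2 + i * (i + 1)))});
             E2 = {of_nat q ^ ((2 * m + 1) choose 2)}
         in diagonalizable_on (Ind n G \<chi>) (intertwiner n G)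
            \<and> eigenvalues_on (Ind n G \<chi>) (intertwiner n G) = E1 \<union> E2
            \<and> E1 \<inter> E2 = {}))
    \<and> (\<forall>m. n = 2 * m + 1 \<longrightarrow>
        (let M = image_mset
               (\<lambda>i. - ((-1) powi (int m - int (i div 2)) * of_nat q ^ (m * (m + 1) + (i div 2)^2)))
               (mset_set {1..n + 1})
         in diagonalizable_on (Ind n G \<chi>) (intertwiner n G)
            \<and> has_eigenvalue_mset (Ind_equivariant n G \<chi>) (intertwiner n G) M
            \<and> eigenvalues_on (Ind n G \<chi>) (intertwiner n G) = set_mset M))"
proof -
  interpret symplectic_group n G
    by unfold_locales (use assms in auto)
  interpret X: siegel_character n G \<alpha> \<chi>
  proof unfold_locales
    fix p assume p: "p \<in> siegel_P n G"
    then show "\<chi> p = \<alpha> (multiplier n p)"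
      using assms(9,10) siegel_m_eq_multiplier[OF p] chi_det_nonzero[OF p] by simp
  qed (use assms in auto)
  have q: "of_nat q = X.q" using assms(1) by (simp add: X.q_def)
  show ?thesis
    unfolding Let_def q
  proof (intro conjI allI impI ballI)
    fix m assume n: "n = 2 * m + 1"
    let ?M = "image_mset (\<lambda>i. - ((-1) powi (int m - int (i div 2)) * X.q ^ (m * (m + 1) + (i div 2)^2))) (mset_set {1..n + 1})"
    show "has_eigenvalue_mset (Ind_equivariant n G \<chi>) (intertwiner n G) ?M"
      unfolding X.eigenvalue_mset_odd[OF n] by (rule X.eigenvalue_mset_V)
    show "eigenvalues_on (Ind n G \<chi>) (intertwiner n G) = set_mset ?M"
      unfolding X.eigenvalue_mset_odd[OF n] X.eigenvalues_W by (auto simp: image_image)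
  qed (use X.chi_J_eq X.diagonalizable_W X.eigenvalues_W X.eigenvalues_even X.eigenvalues_even_disjoint in \<open>simp_all only:\<close>)
qed

end
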